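(* Let $f\in\mu_{q-1}[x_1^{\pm1},\dots,x_n^{\pm1}]$ be a non-constant Laurent polynomial, let $v_1,\dots,v_m\in\mathbb{Z}^m$ be an integral basis of $\mathbb{R}^m$, let $g(y)=\sum_{j=1}^m b_jy^{v_j}$ with $b_j\in\mu_{q-1}^n$, and let $d\in(\mathbb{Z}^n\otimes\mathbb{Z}^m)/(q-1)$. Then $$L_{f\otimes g,\omega^{-d}}(s,T)^{(-1)^{mn-1}}=\prod_{u}\Big(\bigotimes_{j=1}^m L_{f,\omega^{-u_j(q^{|u|}-1)}}(\,\cdot\,,T,\mathbb{F}_{q^{|u|}})^{(-1)^{n-1}}\Big)\Big(s^{|u|}\prod_{j=1}^m b_j^{u_j(q^{|u|}-1)}\Big),$$ where $u=(u_1,\dots,u_m)$ runs over the elements of the orbit space $q\backslash(\mathbb{Z}_{(p)}^n/\mathbb{Z}^n)^m$ satisfying $u_1\otimes v_1+\cdots+u_m\otimes v_m\equiv\frac{d}{q-1}$ modulo $\mathbb{Z}^n\otimes\mathbb{Z}^m$ (a finite product). Here the tensor product of the $m$ series is formed with respect to their series variable, and the resulting series is evaluated at $s^{|u|}\prod_j b_j^{u_j(q^{|u|}-1)}$.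
   Context: $p$ is a prime, $q$ a power of $p$, $\mathbb{Z}_{q^k}=W(\mathbb{F}_{q^k})$, $\mu_{q^k-1}\subset\mathbb{Z}_{q^k}$ the group of $(q^k-1)$-th roots of unity, $\psi(x)=(1+T)^x$ for $x\in\mathbb{Z}_p$, $\psi_{q^k}=\psi\circ\mathrm{Tr}_{\mathbb{Z}_{q^k}/\mathbb{Z}_p}$. The notation $f\in\mu_{q-1}[x_1^{\pm1},\dots,x_n^{\pm1}]$ means $f=\sum_{u\in I}a_ux^u$ with $I\subset\mathbb{Z}^n$ finite and $a_u\in\mu_{q-1}$. For a Laurent polynomial $h$ in $N$ variables over $\mathbb{Z}_q$, $k\ge1$ and $e\in\mathbb{Z}^N/(q^k-1)$, put $$S_h(T,\omega^{-e},\mathbb{F}_{q^k})=\sum_{x\in\mu_{q^k-1}^N}x^{-e}\psi_{q^k}(h(x)),$$ $$L_{h,\omega^{-e}}(s,T,\mathbb{F}_{q^k})=\exp\Big(\sum_{l\ge1}S_h\big(T,\omega^{-e\frac{q^{kl}-1}{q^k-1}},\mathbb{F}_{q^{kl}}\big)\frac{s^l}{l}\Big),$$ where $x^{-e}=\prod_i x_i^{-e_i}$ and $\omega$ denotes the Teichmüller character of the finite field in question. $L_{h,\omega^{-e}}(s,T)$ without field means $k=1$. An integral basis of $\mathbb{R}^m$ is an $\mathbb{R}$-basis consisting of vectors in $\mathbb{Z}^m$. For $f=\sum_u a_ux^u$ and $g=\sum_v b_vy^v$ with $b_v\in\mu_{q-1}^n$, the diagonal base change is $f\otimes g=\sum_{u,v}a_ub_v^uz^{u\otimes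 v}$, a Laurent polynomial in the $nm$ variables $z_{ij}$ ($1\le i\le n$, $1\le j\le m$), with $b_v^u=\prod_i b_{v,i}^{u_i}$ and $z^{u\otimes v}=\prod_{i,j}z_{ij}^{u_iv_j}$; $\mathbb{Z}^n\otimes\mathbb{Z}^m$ is identified with $\mathbb{Z}^{nm}$. Tensor operation: if $A(s)=\exp(-\sum_k a_k\frac{s^k}{k})$ and $B(s)=\exp(-\sum_k b_k\frac{s^k}{k})$ then $A\otimes B(s)=\exp(-\sum_k a_kb_k\frac{s^k}{k})$. $\mathbb{Z}_{(p)}$ is the localization of $\mathbb{Z}$ at $p$. Multiplication by $q$ acts on $(\mathbb{Z}_{(p)}^n/\mathbb{Z}^n)^m$; $q\backslash(\cdot)$ is the set of orbits, and $|u|$ is the length of the orbit of $u=(u_1,\dots,u_m)$, i.e. the least $k\ge1$ with $(q^k-1)u_j\equiv0$ for all $j$. Thus $u_j(q^{|u|}-1)$ is an element of $\mathbb{Z}^n/(q^{|u|}-1)$, and $b_j^{u_j(q^{|u|}-1)}=\prod_i b_{j,i}^{(u_j(q^{|u|}-1))_i}$. The congruence condition and the factors depend only on the orbit. *)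

theory Defs
  imports "HOL-Analysis.Analysis" "HOL-Computational_Algebra.Computational_Algebra"
    "HOL-Library.Poly_Mapping"
begin

subsection \<open>Integral polynomials in countably many variables\<close>

type_synonym mpoly_int = "(nat \<Rightarrow>\<^sub>0 nat) \<Rightarrow>\<^sub>0 int"

definition mp_var :: "nat \<Rightarrow> mpoly_int"
  where "mp_var i = Poly_Mapping.single (Poly_Mapping.single i 1) 1"

definition mp_monom :: "(nat \<Rightarrow> 'a::comm_ring_1) \<Rightarrow> (nat \<Rightarrow>\<^sub>0 nat) \<Rightarrow> 'a"
  where "mp_monom \<sigma> m = (\<Prod>i\<in>Poly_Mapping.keys m. \<sigma> i ^ Poly_Mapping.lookup m i)"

definition mp_eval :: "(nat \<Rightarrow> 'a::comm_ring_1) \<Rightarrow> mpoly_int \<Rightarrow> 'a"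
  where "mp_eval \<sigma> f =
    (\<Sum>m\<in>Poly_Mapping.keys f. of_int (Poly_Mapping.lookup f m) * mp_monom \<sigma> m)"

lemma mp_induct [case_names zero one diff]:
  fixes f :: mpoly_int
  assumes "P 0" "\<And>m. P (Poly_Mapping.single m 1)" "\<And>a b. P a \<Longrightarrow> P b \<Longrightarrow> P (a - b)"
  shows "P f"
  by (rule frag_induction[of f UNIV]) (use assms in auto)

lemma mp_monom_superset:
  "finite S \<Longrightarrow> Poly_Mapping.keys m \<subseteq> S \<Longrightarrow> mp_monom \<sigma> m = (\<Prod>i\<in>S. \<sigma> i ^ Poly_Mapping.lookup m i)"
  unfolding mp_monom_def by (rule prod.mono_neutral_left) (auto simp: in_keys_iff)

lemma mp_monom_add: "mp_monom \<sigma> (m + m') = mp_monom \<sigma> m * mp_monom \<sigma> m'"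
proof -
  let ?S = "Poly_Mapping.keys m \<union> Poly_Mapping.keys m'"
  have "Poly_Mapping.keys (m + m') \<subseteq> ?S" by (rule keys_add)
  then show ?thesis
    by (simp add: mp_monom_superset[of ?S] lookup_add power_add prod.distrib)
qed

lemma mp_eval_single: "mp_eval \<sigma> (Poly_Mapping.single m c) = of_int c * mp_monom \<sigma> m"
  by (cases "c = 0") (auto simp: mp_eval_def)

lemma mp_eval_0 [simp]: "mp_eval \<sigma> 0 = 0"
  by (simp add: mp_eval_def)

lemma mp_eval_1 [simp]: "mp_eval \<sigma> 1 = 1"
  by (simp add: mp_eval_single mp_monom_def flip: single_one)

lemma mp_eval_add [simp]: "mp_eval \<sigma> (f + g) = mp_eval \<sigma> f + mp_eval \<sigma> g"
  unfolding mp_eval_def by (rule setsum_keys_plus_distrib) (auto simp: algebra_simps)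

lemma mp_eval_diff [simp]: "mp_eval \<sigma> (f - g) = mp_eval \<sigma> f - mp_eval \<sigma> g"
  by (metis add_diff_cancel_right' diff_add_cancel mp_eval_add)

lemma mp_eval_minus [simp]: "mp_eval \<sigma> (- f) = - mp_eval \<sigma> f"
  using mp_eval_diff[of \<sigma> 0 f] by simp

lemma mp_eval_mult [simp]: "mp_eval \<sigma> (f * g) = mp_eval \<sigma> f * mp_eval \<sigma> g"
proof -
  have 1: "mp_eval \<sigma> (frag_of m * g) = mp_eval \<sigma> (frag_of m) * mp_eval \<sigma> g" for m g
  proof (induction g rule: mp_induct)
    case (one x)
    then show ?case by (simp add: mult_single mp_eval_single mp_monom_add)
  qed (auto simp: right_diff_distrib)
  show ?thesis
    by (induction f rule: mp_induct) (auto simp: left_diff_distrib 1)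
qed

lemma mp_eval_power [simp]: "mp_eval \<sigma> (f ^ n) = mp_eval \<sigma> f ^ n"
  by (induction n) auto

lemma mp_eval_of_nat [simp]: "mp_eval \<sigma> (of_nat n) = of_nat n"
  by (induction n) auto

lemma mp_eval_sum [simp]: "mp_eval \<sigma> (sum F A) = (\<Sum>x\<in>A. mp_eval \<sigma> (F x))"
  by (induction A rule: infinite_finite_induct) auto

lemma mp_eval_prod [simp]: "mp_eval \<sigma> (prod F A) = (\<Prod>x\<in>A. mp_eval \<sigma> (F x))"
  by (induction A rule: infinite_finite_induct) auto

lemma mp_eval_var [simp]: "mp_eval \<sigma> (mp_var i) = \<sigma> i"
  by (simp add: mp_var_def mp_eval_single mp_monom_def)

lemma mp_monom_hom:
  assumes "\<And>x y. h (x * y) = h x * h y" "h 1 = 1"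
  shows "h (mp_monom \<sigma> m) = mp_monom (\<lambda>i. h (\<sigma> i)) m"
proof -
  have pw: "h (x ^ n) = h x ^ n" for x n
    by (induction n) (auto simp: assms)
  have "h (\<Prod>i\<in>S. \<sigma> i ^ Poly_Mapping.lookup m i) = (\<Prod>i\<in>S. h (\<sigma> i) ^ Poly_Mapping.lookup m i)" for S
    by (induction S rule: infinite_finite_induct) (auto simp: assms pw)
  then show ?thesis by (simp add: mp_monom_def)
qed

lemma mp_eval_hom:
  fixes h :: "'a::comm_ring_1 \<Rightarrow> 'b::comm_ring_1"
  assumes "\<And>x y. h (x + y) = h x + h y" "\<And>x y. h (x * y) = h x * h y" "h 1 = 1"
  shows "h (mp_eval \<sigma> f) = mp_eval (\<lambda>i. h (\<sigma> i)) f"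
proof -
  have h0: "h 0 = 0" using assms(1)[of 0 0] by simp
  have hd: "h (x - y) = h x - h y" for x y
    using assms(1)[of "x - y" y] by (simp add: algebra_simps)
  show ?thesis
  proof (induction f rule: mp_induct)
    case (one m)
    then show ?case
      by (simp add: mp_eval_single mp_monom_hom[of h, OF assms(2,3)])
  qed (auto simp: h0 hd)
qed

lemma mp_eval_comp: "mp_eval \<tau> (mp_eval \<sigma> f) = mp_eval (\<lambda>i. mp_eval \<tau> (\<sigma> i)) f"
  by (rule mp_eval_hom) auto

lemma mp_var_power: "mp_var i ^ n = Poly_Mapping.single (Poly_Mapping.single i n) 1"
  by (induction n) (auto simp: mp_var_def mult_single simp flip: single_add)

lemma mp_monom_var: "mp_monom mp_var m = Poly_Mapping.single m 1"
proof -
  have *: "(\<Prod>i\<in>S. mp_var i ^ k i) = Poly_Mapping.single (\<Sum>i\<in>S. Poly_Mapping.single i (k i)) 1"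
    if "finite S" for S k
    using that by (induction S) (auto simp: mp_var_power mult_single)
  have "(\<Sum>i\<in>Poly_Mapping.keys m. Poly_Mapping.single i (Poly_Mapping.lookup m i)) = m"
    by (rule poly_mapping_eqI) (auto simp: lookup_sum lookup_single when_def in_keys_iff)
  then show ?thesis by (simp add: mp_monom_def *)
qed

subsection \<open>Congruences modulo powers of a prime\<close>

lemma dvd_power_prime_diff:
  fixes x y :: "'a::comm_ring_1"
  assumes "prime p" "k \<ge> 1" "of_nat p ^ k dvd x - y"
  shows "of_nat p ^ Suc k dvd x ^ p - y ^ p"
proof -
  have pd: "of_nat p dvd x - y"
    using dvd_trans[OF dvd_power[of k "of_nat p"] assms(3)] assms(2) by simp
  have "x ^ p - y ^ p = (x - y) * (\<Sum>i<p. y ^ (p - Suc i) * x ^ i)"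
    by (rule power_diff_sumr2)
  moreover have "of_nat p dvd (\<Sum>i<p. y ^ (p - Suc i) * x ^ i)"
  proof -
    have px: "of_nat p dvd x ^ i - y ^ i" for i
      using pd power_diff_sumr2[of x i y] by (metis dvd_mult2)
    have "of_nat p dvd (\<Sum>i<p. y ^ (p - Suc i) * (x ^ i - y ^ i))"
      by (intro dvd_sum dvd_mult px)
    also have "(\<Sum>i<p. y ^ (p - Suc i) * (x ^ i - y ^ i)) =
      (\<Sum>i<p. y ^ (p - Suc i) * x ^ i) - (\<Sum>i<p. y ^ (p - 1))"
      by (simp add: right_diff_distrib sum_subtractf flip: power_add)
    finally have "of_nat p dvd (\<Sum>i<p. y ^ (p - Suc i) * x ^ i) - of_nat p * y ^ (p - 1)" by simp
    then show ?thesis by (metis diff_add_cancel dvd_add dvd_triv_left)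
  qed
  ultimately have "of_nat p ^ k * of_nat p dvd x ^ p - y ^ p"
    using assms(3) by (simp only: mult_dvd_mono)
  then show ?thesis by (simp only: power_Suc2)
qed

lemma dvd_power_prime_power_diff:
  fixes x y :: "'a::comm_ring_1"
  assumes "prime p" "of_nat p dvd x - y"
  shows "of_nat p ^ Suc k dvd x ^ (p ^ k) - y ^ (p ^ k)"
proof (induction k)
  case (Suc k)
  show ?case
    using dvd_power_prime_diff[OF assms(1) _ Suc] by (simp add: mult.commute flip: power_mult)
qed (use assms in auto)

lemma dvd_freshman:
  fixes x y :: "'a::comm_ring_1"
  assumes "prime p"
  shows "of_nat p dvd (x + y) ^ p - (x ^ p + y ^ p)"
proof -
  have p: "p > 0" using assms prime_gt_0_nat by blast
  have "(x + y) ^ p = (\<Sum>k\<le>p. of_nat (p choose k) * x ^ k * y ^ (p - k))"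
    by (rule binomial_ring)
  also have "{..p} = insert 0 (insert p {1..<p})" using p by auto
  finally have "(x + y) ^ p - (x ^ p + y ^ p) = (\<Sum>k\<in>{1..<p}. of_nat (p choose k) * x ^ k * y ^ (p - k))"
    using p by (simp add: algebra_simps)
  also have "of_nat p dvd \<dots>"
  proof (intro dvd_sum dvd_mult2)
    fix k assume "k \<in> {1..<p}"
    then have "p dvd (p choose k)" using assms by (intro dvd_choose_prime) auto
    then show "of_nat p dvd (of_nat (p choose k) :: 'a)" by (metis dvd_def of_nat_mult)
  qed
  finally show ?thesis .
qed

definition mp_frob :: "nat \<Rightarrow> mpoly_int \<Rightarrow> mpoly_int"
  where "mp_frob p = mp_eval (\<lambda>i. mp_var i ^ p)"

lemma mp_frob_cong:
  assumes "prime p"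
  shows "of_nat p dvd mp_frob p f - f ^ p"
proof (induction f rule: mp_induct)
  case zero show ?case using prime_gt_0_nat[OF assms] by (simp add: mp_frob_def zero_power)
next
  case (one m)
  have "mp_frob p (frag_of m) = mp_monom mp_var m ^ p"
    by (simp add: mp_frob_def mp_eval_single mp_monom_def power_mult prod_power_distrib mult.commute
          flip: power_mult)
  then show ?case by (simp add: mp_monom_var)
next
  case (diff a b)
  have "of_nat p dvd ((a - b) + b) ^ p - ((a - b) ^ p + b ^ p)" by (rule dvd_freshman[OF assms])
  then have "of_nat p dvd (mp_frob p a - a ^ p) - (mp_frob p b - b ^ p) + (a ^ p - ((a - b) ^ p + b ^ p))"
    by (intro dvd_add[OF dvd_diff[OF diff]]) simp
  then show ?case by (simp add: mp_frob_def algebra_simps)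
qed

subsection \<open>Ghost components and Dwork's lemma\<close>

lemma power_Suc_split: "i \<le> n \<Longrightarrow> a ^ Suc n = a ^ i * (a::'a::comm_ring_1) ^ Suc (n - i)"
  by (metis power_add add_Suc_right le_add_diff_inverse)

lemma sum_diff_dvd:
  assumes "\<And>i. i \<in> A \<Longrightarrow> (c::'a::comm_ring_1) dvd f i - g i"
  shows "c dvd sum f A - sum g A"
  using dvd_sum[of A c "\<lambda>i. f i - g i"] assms by (simp add: sum_subtractf)

definition ghost :: "nat \<Rightarrow> (nat \<Rightarrow> 'a::comm_ring_1) \<Rightarrow> nat \<Rightarrow> 'a"
  where "ghost p a n = (\<Sum>i\<le>n. of_nat p ^ i * a i ^ (p ^ (n - i)))"

lemma ghost_eval: "mp_eval \<sigma> (ghost p S n) = ghost p (\<lambda>i. mp_eval \<sigma> (S i)) n"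
  by (simp add: ghost_def)

lemma ghost_last: "ghost p a n = (\<Sum>i<n. of_nat p ^ i * a i ^ (p ^ (n - i))) + of_nat p ^ n * a n"
  by (simp add: ghost_def flip: lessThan_Suc_atMost)

lemma ghost_Suc:
  "ghost p a (Suc n) = ghost p (\<lambda>i. a i ^ p) n + of_nat p ^ Suc n * a (Suc n)"
  unfolding ghost_last[of p a "Suc n"] lessThan_Suc_atMost
  by (simp add: ghost_def Suc_diff_le flip: power_mult)

lemma ghost_cong_imp:
  fixes a b :: "nat \<Rightarrow> mpoly_int"
  assumes "prime p" "\<And>n. of_nat p ^ Suc n dvd ghost p a n - ghost p b n"
  shows "of_nat p dvd a n - b n"
proof (induction n rule: less_induct)
  case (less n)
  have "of_nat p ^ Suc n dvd of_nat p ^ i * a i ^ (p ^ (n - i)) - of_nat p ^ i * b i ^ (p ^ (n - i))"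
    if "i \<in> {..<n}" for i
  proof -
    have "of_nat p ^ i * of_nat p ^ Suc (n - i) dvd of_nat p ^ i * (a i ^ (p ^ (n - i)) - b i ^ (p ^ (n - i)))"
      using that less by (intro mult_dvd_mono dvd_power_prime_power_diff[OF assms(1)]) auto
    moreover have "i \<le> n" using that by simp
    ultimately show ?thesis unfolding power_Suc_split[OF \<open>i \<le> n\<close>] right_diff_distrib by simp
  qed
  then have "of_nat p ^ Suc n dvd (\<Sum>i<n. of_nat p ^ i * a i ^ (p ^ (n - i))) - (\<Sum>i<n. of_nat p ^ i * b i ^ (p ^ (n - i)))"
    by (rule sum_diff_dvd)
  from dvd_diff[OF assms(2)[of n] this]
  have "of_nat p ^ n * of_nat p dvd of_nat p ^ n * (a n - b n)"
    by (simp add: ghost_last algebra_simps)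
  moreover have "(of_nat p :: mpoly_int) ^ n \<noteq> 0" using prime_gt_0_nat[OF assms(1)] by simp
  ultimately show ?case by (metis dvd_mult_cancel_left)
qed

lemma ghost_inj:
  fixes a b :: "nat \<Rightarrow> mpoly_int"
  assumes "prime p" "\<And>n. ghost p a n = ghost p b n"
  shows "a = b"
proof
  fix n show "a n = b n"
  proof (induction n rule: less_induct)
    case (less n)
    have "of_nat p ^ n * a n = of_nat p ^ n * b n"
      using assms(2)[of n] less by (simp add: ghost_last)
    then show ?case using prime_gt_0_nat[OF assms(1)] by simp
  qed
qed

definition dwork :: "nat \<Rightarrow> (nat \<Rightarrow> mpoly_int) \<Rightarrow> bool"
  where "dwork p w \<longleftrightarrow> (\<forall>n. of_nat p ^ Suc n dvd w (Suc n) - mp_frob p (w n))"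

lemma mp_frob_ghost: "mp_frob p (ghost p a n) = ghost p (\<lambda>i. mp_frob p (a i)) n"
  by (simp add: mp_frob_def ghost_eval)

lemma dwork_add: "dwork p v \<Longrightarrow> dwork p w \<Longrightarrow> dwork p (\<lambda>n. v n + w n)"
  unfolding dwork_def
proof safe
  fix n assume "\<forall>n. of_nat p ^ Suc n dvd v (Suc n) - mp_frob p (v n)"
     "\<forall>n. of_nat p ^ Suc n dvd w (Suc n) - mp_frob p (w n)"
  then have "of_nat p ^ Suc n dvd (v (Suc n) - mp_frob p (v n)) + (w (Suc n) - mp_frob p (w n))"
    by (intro dvd_add) auto
  then show "of_nat p ^ Suc n dvd v (Suc n) + w (Suc n) - mp_frob p (v n + w n)"
    by (simp add: mp_frob_def algebra_simps)
qed

lemma dwork_uminus: "dwork p v \<Longrightarrow> dwork p (\<lambda>n. - v n)"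
  unfolding dwork_def
proof safe
  fix n assume "\<forall>n. of_nat p ^ Suc n dvd v (Suc n) - mp_frob p (v n)"
  then have "of_nat p ^ Suc n dvd - (v (Suc n) - mp_frob p (v n))"
    by (subst dvd_minus_iff) auto
  then show "of_nat p ^ Suc n dvd - v (Suc n) - mp_frob p (- v n)"
    by (simp add: mp_frob_def algebra_simps)
qed

lemma dwork_mult: "dwork p v \<Longrightarrow> dwork p w \<Longrightarrow> dwork p (\<lambda>n. v n * w n)"
  unfolding dwork_def
proof safe
  fix n assume "\<forall>n. of_nat p ^ Suc n dvd v (Suc n) - mp_frob p (v n)"
     "\<forall>n. of_nat p ^ Suc n dvd w (Suc n) - mp_frob p (w n)"
  then have "of_nat p ^ Suc n dvd (v (Suc n) - mp_frob p (v n)) * w (Suc n)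
      + mp_frob p (v n) * (w (Suc n) - mp_frob p (w n))"
    by (intro dvd_add dvd_mult dvd_mult2) auto
  then show "of_nat p ^ Suc n dvd v (Suc n) * w (Suc n) - mp_frob p (v n * w n)"
    by (simp add: mp_frob_def algebra_simps)
qed

lemma ghost_frob_cong:
  assumes p: "prime p"
  shows "of_nat p ^ Suc n dvd ghost p (\<lambda>i. a i ^ p) n - mp_frob p (ghost p a n)"
  unfolding mp_frob_ghost unfolding ghost_def
proof (rule sum_diff_dvd)
  fix i assume i: "i \<in> {..n}"
  have "of_nat p dvd a i ^ p - mp_frob p (a i)"
    by (metis dvd_minus_iff minus_diff_eq mp_frob_cong[OF p])
  then have "of_nat p ^ i * of_nat p ^ Suc (n - i) dvd
      of_nat p ^ i * ((a i ^ p) ^ (p ^ (n - i)) - mp_frob p (a i) ^ (p ^ (n - i)))"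
    by (intro mult_dvd_mono dvd_power_prime_power_diff[OF p]) auto
  then show "of_nat p ^ Suc n dvd of_nat p ^ i * (a i ^ p) ^ (p ^ (n - i)) -
        of_nat p ^ i * mp_frob p (a i) ^ (p ^ (n - i))"
    using power_Suc_split[of i n "of_nat p :: mpoly_int"] i by (simp only: right_diff_distrib atMost_iff)
qed

lemma dwork_ghost: "prime p \<Longrightarrow> dwork p (ghost p a)"
  unfolding dwork_def
proof
  fix n assume "prime p"
  then have "of_nat p ^ Suc n dvd
      (ghost p (\<lambda>i. a i ^ p) n - mp_frob p (ghost p a n)) + of_nat p ^ Suc n * a (Suc n)"
    by (intro dvd_add ghost_frob_cong dvd_triv_left)
  then show "of_nat p ^ Suc n dvd ghost p a (Suc n) - mp_frob p (ghost p a n)"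
    by (simp only: ghost_Suc algebra_simps)
qed

lemma dwork_exists:
  assumes p: "prime p" and w: "dwork p w"
  shows "\<exists>S. \<forall>n. ghost p S n = w n"
proof -
  define P where "P n S \<longleftrightarrow> (\<forall>m\<le>n. ghost p S m = w m)" for n S
  have "\<exists>f. \<forall>n. P n (f n) \<and> (\<forall>i\<le>n. f (Suc n) i = f n i)"
  proof (rule dependent_nat_choice[of P "\<lambda>n S S'. \<forall>i\<le>n. S' i = S i"])
    show "\<exists>S. P 0 S" by (rule exI[of _ "\<lambda>_. w 0"]) (simp add: ghost_def P_def)
  next
    fix S n assume "P n S"
    then have S: "\<And>m. m \<le> n \<Longrightarrow> ghost p S m = w m" by (auto simp: P_def)
    have "of_nat p ^ Suc n dvd (w (Suc n) - mp_frob p (w n)) -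
        (ghost p (\<lambda>i. S i ^ p) n - mp_frob p (ghost p S n))"
      using w unfolding dwork_def by (intro dvd_diff[OF _ ghost_frob_cong[OF p]]) blast
    then obtain c where c: "w (Suc n) - ghost p (\<lambda>i. S i ^ p) n = of_nat p ^ Suc n * c"
      using S[of n] by (auto elim: dvdE)
    have eq: "ghost p (S(Suc n := c)) m = ghost p S m" if "m \<le> n" for m
      unfolding ghost_def using that by (intro sum.cong) auto
    have "ghost p (\<lambda>i. (S(Suc n := c)) i ^ p) n = ghost p (\<lambda>i. S i ^ p) n"
      unfolding ghost_def by (intro sum.cong) auto
    then have "ghost p (S(Suc n := c)) (Suc n) = w (Suc n)"
      using c by (simp add: ghost_Suc algebra_simps)
    then have "P (Suc n) (S(Suc n := c))"
      unfolding P_def using S eq by (metis le_Suc_eq)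
    then show "\<exists>S'. P (Suc n) S' \<and> (\<forall>i\<le>n. S' i = S i)"
      by (intro exI[of _ "S(Suc n := c)"]) auto
  qed
  then obtain f where f: "\<And>n. P n (f n)" "\<And>n i. i \<le> n \<Longrightarrow> f (Suc n) i = f n i" by blast
  have agree: "m \<le> n \<Longrightarrow> f n m = f m m" for n m
  proof (induction n rule: dec_induct)
    case (step k)
    then show ?case using f(2)[of m k] by simp
  qed simp
  have "ghost p (\<lambda>i. f i i) n = ghost p (f n) n" for n
    unfolding ghost_def
  proof (rule sum.cong)
    fix i assume "i \<in> {..n}"
    then have "f i i = f n i" using agree[of i n] by simp
    then show "of_nat p ^ i * f i i ^ (p ^ (n - i)) = of_nat p ^ i * f n i ^ (p ^ (n - i))"
      by (simp only:)
  qed simp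
  then show ?thesis using f(1) unfolding P_def by (metis order_refl)
qed


subsection \<open>Witt vectors\<close>

text \<open>
  The Witt sum, product and negation polynomials are the integral polynomials with prescribed
  ghost components; they exist and are unique by \<open>ghost_witt_poly\<close> and \<open>ghost_inj\<close>. The two
  arguments are the even and the odd variables.
\<close>
definition witt_poly :: "nat \<Rightarrow> (nat \<Rightarrow> mpoly_int) \<Rightarrow> nat \<Rightarrow> mpoly_int"
  where "witt_poly p w = (THE S. \<forall>n. ghost p S n = w n)"

definition mp_X :: "nat \<Rightarrow> mpoly_int" where "mp_X i = mp_var (2 * i)"
definition mp_Y :: "nat \<Rightarrow> mpoly_int" where "mp_Y i = mp_var (2 * i + 1)"

definition witt_plus :: "nat \<Rightarrow> (nat \<Rightarrow> 'a::comm_ring_1) \<Rightarrow> (nat \<Rightarrow> 'a) \<Rightarrow> nat \<Rightarrow> 'a"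
  where "witt_plus p a b n = mp_eval (\<lambda>i. if even i then a (i div 2) else b (i div 2))
    (witt_poly p (\<lambda>n. ghost p mp_X n + ghost p mp_Y n) n)"

definition witt_times :: "nat \<Rightarrow> (nat \<Rightarrow> 'a::comm_ring_1) \<Rightarrow> (nat \<Rightarrow> 'a) \<Rightarrow> nat \<Rightarrow> 'a"
  where "witt_times p a b n = mp_eval (\<lambda>i. if even i then a (i div 2) else b (i div 2))
    (witt_poly p (\<lambda>n. ghost p mp_X n * ghost p mp_Y n) n)"

definition witt_neg :: "nat \<Rightarrow> (nat \<Rightarrow> 'a::comm_ring_1) \<Rightarrow> nat \<Rightarrow> 'a"
  where "witt_neg p a n = mp_eval (\<lambda>i. a (i div 2)) (witt_poly p (\<lambda>n. - ghost p mp_X n) n)"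

definition witt_one :: "nat \<Rightarrow> 'a::comm_ring_1"
  where "witt_one n = (if n = 0 then 1 else 0)"

lemma ghost_witt_poly:
  assumes "prime p" "dwork p w"
  shows "ghost p (witt_poly p w) n = w n"
proof -
  have "\<exists>!S. \<forall>n. ghost p S n = w n"
    using dwork_exists[OF assms] by (auto intro!: ex_ex1I ghost_inj[OF assms(1)])
  from theI'[OF this] show ?thesis unfolding witt_poly_def by blast
qed

lemma ghost_plus:
  assumes "prime p"
  shows "ghost p (witt_plus p a b) n = ghost p a n + ghost p b n"
  using ghost_witt_poly[OF assms dwork_add[OF dwork_ghost dwork_ghost], OF assms assms]
  unfolding witt_plus_def ghost_eval[symmetric] by (simp add: ghost_eval mp_X_def mp_Y_def)

lemma ghost_times:
  assumes "prime p"
  shows "ghost p (witt_times p a b) n = ghost p a n * ghost p b n"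
  using ghost_witt_poly[OF assms dwork_mult[OF dwork_ghost dwork_ghost], OF assms assms]
  unfolding witt_times_def ghost_eval[symmetric] by (simp add: ghost_eval mp_X_def mp_Y_def)

lemma ghost_neg:
  assumes "prime p"
  shows "ghost p (witt_neg p a) n = - ghost p a n"
  using ghost_witt_poly[OF assms dwork_uminus[OF dwork_ghost], OF assms]
  unfolding witt_neg_def ghost_eval[symmetric] by (simp add: ghost_eval mp_X_def mp_Y_def)

lemma ghost_zero: "prime p \<Longrightarrow> ghost p (\<lambda>_. 0) n = 0"
  by (simp add: ghost_def prime_gt_0_nat zero_power)

lemma ghost_one: "prime p \<Longrightarrow> ghost p witt_one n = 1"
  by (simp add: ghost_def witt_one_def prime_gt_0_nat sum.atMost_shift zero_power)

lemma witt_hom: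
  fixes h :: "'a::comm_ring_1 \<Rightarrow> 'b::comm_ring_1"
  assumes "\<And>x y. h (x + y) = h x + h y" "\<And>x y. h (x * y) = h x * h y" "h 1 = 1"
  shows "(\<lambda>n. h (witt_plus p a b n)) = witt_plus p (\<lambda>n. h (a n)) (\<lambda>n. h (b n))"
    and "(\<lambda>n. h (witt_times p a b n)) = witt_times p (\<lambda>n. h (a n)) (\<lambda>n. h (b n))"
    and "(\<lambda>n. h (witt_neg p a n)) = witt_neg p (\<lambda>n. h (a n))"
  unfolding witt_plus_def witt_times_def witt_neg_def mp_eval_hom[of h, OF assms]
  by (simp_all add: if_distrib[of h])

lemmas witt_eval = witt_hom[of "mp_eval \<tau>" for \<tau>, OF mp_eval_add mp_eval_mult mp_eval_1]

lemma witt_universal: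
  obtains \<tau> and A B C :: "nat \<Rightarrow> mpoly_int"
  where "(\<lambda>n. mp_eval \<tau> (A n)) = a" "(\<lambda>n. mp_eval \<tau> (B n)) = b" "(\<lambda>n. mp_eval \<tau> (C n)) = c"
proof
  let ?t = "\<lambda>i. if i mod 3 = 0 then a (i div 3) else if i mod 3 = 1 then b (i div 3) else c (i div 3)"
  have d: "Suc (3 * n) div 3 = n" "Suc (Suc (3 * n)) div 3 = n"
    "Suc (3 * n) mod 3 = Suc 0" "Suc (Suc (3 * n)) mod 3 = 2" for n
    by presburger+
  show "(\<lambda>n. mp_eval ?t (mp_var (3 * n))) = a" by simp
  show "(\<lambda>n. mp_eval ?t (mp_var (3 * n + 1))) = b" by (simp add: d)
  show "(\<lambda>n. mp_eval ?t (mp_var (3 * n + 2))) = c" by (simp add: d)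
qed

lemma witt_ring_axioms:
  fixes a b c :: "nat \<Rightarrow> 'a::comm_ring_1"
  assumes p: "prime p"
  shows witt_plus_assoc: "witt_plus p (witt_plus p a b) c = witt_plus p a (witt_plus p b c)"
    and witt_plus_commute: "witt_plus p a b = witt_plus p b a"
    and witt_plus_zero: "witt_plus p (\<lambda>_. 0) a = a"
    and witt_plus_neg: "witt_plus p (witt_neg p a) a = (\<lambda>_. 0)"
    and witt_times_assoc: "witt_times p (witt_times p a b) c = witt_times p a (witt_times p b c)"
    and witt_times_commute: "witt_times p a b = witt_times p b a"
    and witt_times_one: "witt_times p witt_one a = a"
    and witt_distrib: "witt_times p (witt_plus p a b) c =
      witt_plus p (witt_times p a c) (witt_times p b c)"
proof -
  obtain \<tau> A B C where ABC: "(\<lambda>n. mp_eval \<tau> (A n)) = a" "(\<lambda>n. mp_eval \<tau> (B n)) = b"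
      "(\<lambda>n. mp_eval \<tau> (C n)) = c" by (rule witt_universal)
  have one: "(\<lambda>n. mp_eval \<tau> (witt_one n)) = witt_one" by (auto simp: witt_one_def)
  note gh = ghost_plus[OF p] ghost_times[OF p] ghost_neg[OF p] ghost_zero[OF p] ghost_one[OF p]
  have transfer: "(\<lambda>n. mp_eval \<tau> (F n)) = (\<lambda>n. mp_eval \<tau> (G n))"
    if "\<And>n. ghost p F n = ghost p G n" for F G
    using ghost_inj[OF p that] by simp
  note ev = witt_eval ABC one mp_eval_0
  show "witt_plus p (witt_plus p a b) c = witt_plus p a (witt_plus p b c)"
    using transfer[of "witt_plus p (witt_plus p A B) C" "witt_plus p A (witt_plus p B C)"]
    by (simp add: gh ev algebra_simps)
  show "witt_plus p a b = witt_plus p b a"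
    using transfer[of "witt_plus p A B" "witt_plus p B A"] by (simp add: gh ev algebra_simps)
  show "witt_plus p (\<lambda>_. 0) a = a"
    using transfer[of "witt_plus p (\<lambda>_. 0) A" A] by (simp add: gh ev)
  show "witt_plus p (witt_neg p a) a = (\<lambda>_. 0)"
    using transfer[of "witt_plus p (witt_neg p A) A" "\<lambda>_. 0"] by (simp add: gh ev)
  show "witt_times p (witt_times p a b) c = witt_times p a (witt_times p b c)"
    using transfer[of "witt_times p (witt_times p A B) C" "witt_times p A (witt_times p B C)"]
    by (simp add: gh ev algebra_simps)
  show "witt_times p a b = witt_times p b a"
    using transfer[of "witt_times p A B" "witt_times p B A"] by (simp add: gh ev algebra_simps)
  show "witt_times p witt_one a = a"
    using transfer[of "witt_times p witt_one A" A] by (simp add: gh ev)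
  show "witt_times p (witt_plus p a b) c = witt_plus p (witt_times p a c) (witt_times p b c)"
    using transfer[of "witt_times p (witt_plus p A B) C"
        "witt_plus p (witt_times p A C) (witt_times p B C)"]
    by (simp add: gh ev algebra_simps)
qed

text \<open>
  The \<open>p\<close>-typical Witt vectors over a ring of prime characteristic \<open>p\<close>; the prime is read off
  from the type.
\<close>
datatype 'a witt = Witt (witt_coord: "nat \<Rightarrow> 'a")

instantiation witt :: (comm_ring_prime_char) comm_ring_1
begin

definition "0 = Witt (\<lambda>_. 0)"
definition "1 = Witt witt_one"
definition "x + y = Witt (witt_plus CHAR('a) (witt_coord x) (witt_coord y))"
definition "x * y = Witt (witt_times CHAR('a) (witt_coord x) (witt_coord y))"
definition "- x = Witt (witt_neg CHAR('a) (witt_coord x))"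
definition "x - y = x + - (y :: 'a witt)"

instance
proof
  show "(0::'a witt) \<noteq> 1"
    by (auto simp: zero_witt_def one_witt_def witt_one_def fun_eq_iff)
  fix x y z :: "'a witt"
  note defs = zero_witt_def one_witt_def plus_witt_def times_witt_def uminus_witt_def witt.sel
  note p = CHAR_prime[where 'a = 'a]
  show "x + y + z = x + (y + z)" by (simp only: defs witt_plus_assoc[OF p])
  show "x + y = y + x" unfolding defs by (subst witt_plus_commute[OF p]) (rule refl)
  show "0 + x = x" by (simp only: defs witt_plus_zero[OF p] witt.collapse)
  show "- x + x = 0" by (simp only: defs witt_plus_neg[OF p])
  show "x - y = x + - y" by (rule minus_witt_def)
  show "x * y * z = x * (y * z)" by (simp only: defs witt_times_assoc[OF p])
  show "x * y = y * x" unfolding defs by (subst witt_times_commute[OF p]) (rule refl)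
  show "1 * x = x" by (simp only: defs witt_times_one[OF p] witt.collapse)
  show "(x + y) * z = x * z + y * z" by (simp only: defs witt_distrib[OF p])
qed

end

lemma witt_coord_simps:
  fixes x y :: "'a::comm_ring_prime_char witt"
  shows "witt_coord (0 :: 'a witt) = (\<lambda>_. 0)" "witt_coord (1 :: 'a witt) = witt_one"
    "witt_coord (x + y) = witt_plus CHAR('a) (witt_coord x) (witt_coord y)"
    "witt_coord (x * y) = witt_times CHAR('a) (witt_coord x) (witt_coord y)"
  by (simp_all add: zero_witt_def one_witt_def plus_witt_def times_witt_def)

lemma ghost_0 [simp]: "ghost p a 0 = a 0" by (simp add: ghost_def)

lemma witt_coord_0:
  fixes x y :: "'a::comm_ring_prime_char witt"
  shows "witt_coord (x + y) 0 = witt_coord x 0 + witt_coord y 0"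
    "witt_coord (x * y) 0 = witt_coord x 0 * witt_coord y 0"
  using ghost_plus[OF CHAR_prime, of "witt_coord x" "witt_coord y" 0]
    ghost_times[OF CHAR_prime, of "witt_coord x" "witt_coord y" 0]
  by (simp_all add: witt_coord_simps)

lemma witt_coord_of_nat_0:
  "witt_coord (of_nat n :: 'a::comm_ring_prime_char witt) 0 = of_nat n"
  by (induction n) (simp_all add: witt_coord_0, simp_all add: witt_coord_simps witt_one_def)

lemma witt_coord_CHAR_times:
  fixes x :: "'a::comm_ring_prime_char witt"
  defines "p \<equiv> CHAR('a)"
  shows "witt_coord (of_nat p * x) k = (if k = 0 then 0 else witt_coord x (k - 1) ^ p)"
proof -
  have p: "prime p" by (simp add: p_def)
  define S where "S m = (witt_plus p mp_var ^^ m) (\<lambda>_. 0)" for m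
  have S: "(\<lambda>n. mp_eval (witt_coord x) (S m n)) = witt_coord (of_nat m * x)" for m
    by (induction m) (auto simp: S_def witt_coord_simps witt_eval distrib_right p_def)
  have gS: "ghost p (S m) n = of_nat m * ghost p mp_var n" for m n
    by (induction m) (auto simp: S_def ghost_plus[OF p] ghost_zero[OF p] algebra_simps)
  define y where "y i = (if i = 0 then 0 else mp_var (i - 1) ^ p)" for i
  have "ghost p y n = of_nat p * ghost p mp_var n - of_nat p ^ Suc n * mp_var n" for n
  proof (cases n)
    case (Suc m)
    have "ghost p y n = of_nat p * ghost p (\<lambda>i. mp_var i ^ p) m"
      unfolding Suc ghost_def sum.atMost_Suc_shift
      using prime_gt_0_nat[OF p]
      by (simp add: y_def zero_power sum_distrib_left mult.assoc)
    then show ?thesis by (simp add: Suc ghost_Suc algebra_simps)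
  qed (simp add: y_def)
  then have "of_nat p dvd S p k - y k"
    by (intro ghost_cong_imp[OF p]) (simp add: gS)
  then obtain c where "S p k - y k = of_nat p * c" by (elim dvdE)
  then have "mp_eval (witt_coord x) (S p k) - mp_eval (witt_coord x) (y k) =
      of_nat p * mp_eval (witt_coord x) c"
    by (metis mp_eval_diff mp_eval_mult mp_eval_of_nat)
  also have "of_nat p = (0 :: 'a)" by (simp add: p_def)
  finally show ?thesis using fun_cong[OF S[of p], of k] by (simp add: y_def)
qed

definition witt_frob :: "'a::comm_ring_prime_char witt \<Rightarrow> 'a witt"
  where "witt_frob x = Witt (\<lambda>n. witt_coord x n ^ CHAR('a))"

lemma witt_frob_hom:
  fixes x y :: "'a::comm_ring_prime_char witt"
  shows "witt_frob (x * y) = witt_frob x * witt_frob y" 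
    and "witt_frob (x + y) = witt_frob x + witt_frob y"
  unfolding witt_frob_def plus_witt_def times_witt_def witt.sel
  by (subst witt_hom, auto simp: freshmans_dream power_mult_distrib)+

lemma witt_frob_simps [simp]:
  "witt_frob 0 = (0 :: 'a::comm_ring_prime_char witt)"
  "witt_frob 1 = (1 :: 'a::comm_ring_prime_char witt)"
  by (auto simp: witt_frob_def zero_witt_def one_witt_def witt_one_def zero_power)

lemma witt_frob_of_nat [simp]: "witt_frob (of_nat n) = of_nat n"
  by (induction n) (auto simp: witt_frob_hom)

lemma witt_frob_pow_hom:
  "(witt_frob ^^ n) (x * y) = (witt_frob ^^ n) x * (witt_frob ^^ n) y"
  "(witt_frob ^^ n) 0 = 0" "(witt_frob ^^ n) (of_nat m) = of_nat m"
  "(witt_frob ^^ n) (of_nat m ^ k) = of_nat m ^ k"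
  by (induction n) (auto simp: witt_frob_hom simp flip: of_nat_power)

lemma witt_coord_frob_pow:
  "witt_coord ((witt_frob ^^ n) (x :: 'a::comm_ring_prime_char witt)) k = witt_coord x k ^ (CHAR('a) ^ n)"
  by (induction n) (auto simp: witt_frob_def power_mult mult.commute simp flip: power_mult)

lemma witt_shift:
  fixes x :: "'a::comm_ring_prime_char witt"
  assumes "\<forall>k<i. witt_coord x k = 0"
  shows "\<exists>x'. (witt_frob ^^ i) x = of_nat CHAR('a) ^ i * x' \<and> witt_coord x' 0 = witt_coord x i"
  using assms
proof (induction i arbitrary: x)
  case (Suc i)
  define y where "y = Witt (\<lambda>k. witt_coord x (Suc k))"
  have "witt_frob x = of_nat CHAR('a) * y"
    using Suc.prems by (intro witt.expand ext)
      (auto simp: witt_frob_def y_def witt_coord_CHAR_times zero_power)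
  moreover obtain x' where "(witt_frob ^^ i) y = of_nat CHAR('a) ^ i * x'" "witt_coord x' 0 = witt_coord y i"
    using Suc.IH[of y] Suc.prems by (auto simp: y_def)
  ultimately show ?case
    by (intro exI[of _ x']) (simp add: funpow_Suc_right witt_frob_pow_hom y_def mult.assoc del: funpow.simps)
qed auto

lemma witt_CHAR_power_times_eq_0:
  fixes x :: "'a::idom_prime_char witt"
  shows "of_nat CHAR('a) ^ n * x = 0 \<longleftrightarrow> x = 0"
proof (induction n)
  case (Suc n)
  have "y = 0" if "of_nat CHAR('a) * y = 0" for y :: "'a witt"
  proof (intro witt.expand ext)
    fix k
    have "witt_coord (of_nat CHAR('a) * y) (Suc k) = 0" using that by (simp add: witt_coord_simps)
    then show "witt_coord y k = witt_coord 0 k"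
      by (simp only: witt_coord_CHAR_times) (simp add: witt_coord_simps)
  qed
  then show ?case using Suc by (auto simp: mult.assoc)
qed auto

instance witt :: (idom_prime_char) idom
proof
  fix x y :: "'a witt"
  assume "x \<noteq> 0" "y \<noteq> 0"
  have least: "\<exists>i. witt_coord z i \<noteq> 0 \<and> (\<forall>k<i. witt_coord z k = 0)" if "z \<noteq> 0" for z :: "'a witt"
  proof -
    have "\<exists>i. witt_coord z i \<noteq> 0" using that by (metis witt.collapse zero_witt_def ext)
    then show ?thesis using exists_least_iff[of "\<lambda>i. witt_coord z i \<noteq> 0"] by auto
  qed
  obtain i j where ij: "witt_coord x i \<noteq> 0" "\<forall>k<i. witt_coord x k = 0"
      "witt_coord y j \<noteq> 0" "\<forall>k<j. witt_coord y k = 0"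
    using least[OF \<open>x \<noteq> 0\<close>] least[OF \<open>y \<noteq> 0\<close>] by auto
  obtain x' y' where x': "(witt_frob ^^ i) x = of_nat CHAR('a) ^ i * x'" "witt_coord x' 0 = witt_coord x i"
    and y': "(witt_frob ^^ j) y = of_nat CHAR('a) ^ j * y'" "witt_coord y' 0 = witt_coord y j"
    using witt_shift[OF ij(2)] witt_shift[OF ij(4)] by auto
  define z where "z = (witt_frob ^^ j) x' * (witt_frob ^^ i) y'"
  have "(witt_frob ^^ (j + i)) x * (witt_frob ^^ (i + j)) y = of_nat CHAR('a) ^ (i + j) * z"
    unfolding funpow_add o_apply x' y' witt_frob_pow_hom z_def by (simp add: power_add mult_ac)
  then have eq: "(witt_frob ^^ (i + j)) (x * y) = of_nat CHAR('a) ^ (i + j) * z"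
    by (simp add: witt_frob_pow_hom add.commute)
  have "witt_coord z 0 \<noteq> 0"
    using ij by (simp add: z_def witt_coord_0 witt_coord_frob_pow x' y')
  then have "z \<noteq> 0" by (auto simp: witt_coord_simps)
  show "x * y \<noteq> 0"
  proof
    assume "x * y = 0"
    with eq have "of_nat CHAR('a) ^ (i + j) * z = 0" by (simp only: witt_frob_pow_hom(2))
    with \<open>z \<noteq> 0\<close> show False by (simp only: witt_CHAR_power_times_eq_0)
  qed
qed

instance witt :: (idom_prime_char) ring_char_0
proof
  have nz: "n > 0 \<Longrightarrow> (of_nat n :: 'a witt) \<noteq> 0" for n
  proof (induction n rule: less_induct)
    case (less n)
    show ?case
    proof
      assume eq: "(of_nat n :: 'a witt) = 0"
      then have "(of_nat n :: 'a) = 0" by (metis witt_coord_of_nat_0 witt_coord_simps(1))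
      then obtain m where m: "n = CHAR('a) * m" by (auto simp: of_nat_eq_0_iff_char_dvd)
      then have "(of_nat m :: 'a witt) = 0"
        using eq witt_CHAR_power_times_eq_0[of 1 "of_nat m :: 'a witt"] by simp
      moreover have "0 < m" "m < n" using m less.prems prime_gt_1_nat[OF CHAR_prime[where 'a='a]] by auto
      ultimately show False using less.IH by blast
    qed
  qed
  show "inj (of_nat :: nat \<Rightarrow> 'a witt)"
  proof (rule linorder_injI)
    fix m n :: nat assume "m < n"
    then have "(of_nat (n - m) :: 'a witt) \<noteq> 0" by (intro nz) simp
    then show "(of_nat m :: 'a witt) \<noteq> of_nat n" using \<open>m < n\<close> by (simp add: of_nat_diff)
  qed
qed

lemma to_fract_of_nat [simp]: "to_fract (of_nat n) = of_nat n"
  by (induction n) auto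

instance fract :: ("{idom,ring_char_0}") field_char_0
proof
  show "inj (of_nat :: nat \<Rightarrow> 'a fract)"
    by (rule injI) (simp flip: to_fract_of_nat)
qed

subsection \<open>The rings $\mathbb{Z}_{q^k}$ and their traces\<close>

text \<open>
  Let \<open>'k\<close> be an algebraically closed field of characteristic \<open>p = CHAR('k)\<close>, for instance an
  algebraic closure of a prime field. For a power \<open>r\<close> of \<open>p\<close> its subfield with \<open>r\<close> elements is \<open>{x. x ^ r = x}\<close>, and the rings of Witt
  vectors of these finite fields are compatible subrings of \<open>'k witt\<close>. Everything is placed inside
  the fraction field \<open>'k witt fract\<close>, which has characteristic 0.
\<close>

definition W_ring :: "nat \<Rightarrow> 'k::field_prime_char witt fract set"
  where "W_ring r = to_fract ` {w. \<forall>i. witt_coord w i ^ r = witt_coord w i}"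

definition mu :: "nat \<Rightarrow> 'k::field_prime_char witt fract set"
  where "mu r = {x \<in> W_ring r. x ^ (r - 1) = 1}"

definition W_aut :: "nat \<Rightarrow> ('k::field_prime_char witt fract \<Rightarrow> 'k witt fract) set"
  where "W_aut r = {\<tau> \<in> extensional (W_ring r). bij_betw \<tau> (W_ring r) (W_ring r) \<and>
    (\<forall>x\<in>W_ring r. \<forall>y\<in>W_ring r. \<tau> (x + y) = \<tau> x + \<tau> y \<and> \<tau> (x * y) = \<tau> x * \<tau> y) \<and>
    (\<forall>x\<in>W_ring CHAR('k). \<tau> x = x)}"

text \<open>
  The trace of the Galois extension $\mathbb{Z}_r/\mathbb{Z}_p$, where $\mathbb{Z}_p$ is
  \<open>W_ring p\<close>. Automorphisms are extensional functions, so that each is counted once.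
\<close>
definition W_trace :: "nat \<Rightarrow> 'k::field_prime_char witt fract \<Rightarrow> 'k witt fract"
  where "W_trace r x = (\<Sum>\<tau>\<in>W_aut r. \<tau> x)"


subsection \<open>Exponentials of power series and the tensor operation\<close>

text \<open>
  A series in \<open>s\<close> whose coefficients are series in \<open>T\<close> has type \<open>'a fps fps\<close>, the outer variable
  being \<open>s\<close>. The following is $\exp(\sum_{l \ge 1} a_l s^l / l)$; the value \<open>a 0\<close> is ignored.
\<close>
definition exp_series :: "(nat \<Rightarrow> 'a::field_char_0 fps) \<Rightarrow> 'a fps fps"
  where "exp_series a = Abs_fps (\<lambda>n. fps_const (inverse (fact n))) oo
    Abs_fps (\<lambda>l. if l = 0 then 0 else fps_const (inverse (of_nat l)) * a l)"

lemma exp_series_nth_0 [simp]: "fps_nth (exp_series a) 0 = 1"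
  by (simp add: exp_series_def fps_compose_nth)

lemma exp_series_eq_iff:
  fixes a b :: "nat \<Rightarrow> 'a::field_char_0 fps"
  shows "exp_series a = exp_series b \<longleftrightarrow> (\<forall>l\<ge>1. a l = b l)"
proof
  define E :: "'a fps fps" where "E = Abs_fps (\<lambda>n. fps_const (inverse (fact n)))"
  define F where "F a = Abs_fps (\<lambda>l. if l = 0 then 0 else fps_const (inverse (of_nat l)) * a l)"
    for a :: "nat \<Rightarrow> 'a fps"
  have exp: "exp_series a = E oo F a" for a :: "nat \<Rightarrow> 'a fps" by (simp add: exp_series_def E_def F_def)
  have E': "fps_deriv E = E"
  proof (rule fps_ext)
    fix n
    have "(of_nat (Suc n) :: 'a fps) = fps_const (of_nat (Suc n))"
      by (simp only: fps_of_nat)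
    moreover have "of_nat (Suc n) * inverse (fact (Suc n)) = inverse (fact n :: 'a)"
      by (simp add: field_simps del: of_nat_Suc)
    ultimately show "fps_nth (fps_deriv E) n = fps_nth E n"
      by (simp add: E_def del: of_nat_Suc fact_Suc)
  qed
  have deriv: "fps_deriv (exp_series a) = exp_series a * Abs_fps (\<lambda>n. a (Suc n))" for a :: "nat \<Rightarrow> 'a fps"
  proof -
    have "fps_deriv (exp_series a) = exp_series a * fps_deriv (F a)"
      unfolding exp by (subst fps_compose_deriv) (simp_all add: E' F_def)
    also have "fps_deriv (F a) = Abs_fps (\<lambda>n. a (Suc n))"
    proof (rule fps_ext)
      fix n
      have "(of_nat (Suc n) :: 'a fps) * (fps_const (inverse (of_nat (Suc n))) * a (Suc n)) = a (Suc n)"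
        by (simp add: mult.assoc [symmetric] del: of_nat_Suc flip: fps_of_nat)
      then show "fps_nth (fps_deriv (F a)) n = fps_nth (Abs_fps (\<lambda>n. a (Suc n))) n"
        by (simp add: F_def del: of_nat_Suc)
    qed
    finally show ?thesis .
  qed
  show "\<forall>l\<ge>1. a l = b l" if eq: "exp_series a = exp_series b"
  proof -
    have "exp_series a \<noteq> 0" by (metis exp_series_nth_0 fps_zero_nth zero_neq_one)
    then have "Abs_fps (\<lambda>n. a (Suc n)) = Abs_fps (\<lambda>n. b (Suc n))"
      using deriv[of a] deriv[of b] unfolding eq by simp
    then have "a (Suc n) = b (Suc n)" for n by (simp add: fps_eq_iff)
    then show ?thesis by (metis Suc_le_D One_nat_def)
  qed
  show "exp_series a = exp_series b" if "\<forall>l\<ge>1. a l = b l"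
  proof -
    have "F a = F b" using that by (simp add: F_def fps_eq_iff)
    then show ?thesis by (simp add: exp)
  qed
qed

text \<open>
  If $A = \exp(-\sum_{l \ge 1} a_l s^l / l)$, then \<open>exp_coeffs A l\<close> is $a_l$ for $l \ge 1$; such a
  sequence exists for every series with constant term 1. The tensor product of a finite family
  multiplies these sequences pointwise, see \<open>fps_tensor_exp_series\<close>.
\<close>
definition exp_coeffs :: "'a::field_char_0 fps fps \<Rightarrow> nat \<Rightarrow> 'a fps"
  where "exp_coeffs A = (SOME a. A = exp_series (\<lambda>l. - a l))"

definition fps_tensor :: "('m::finite \<Rightarrow> 'a::field_char_0 fps fps) \<Rightarrow> 'a fps fps"
  where "fps_tensor A = exp_series (\<lambda>l. - (\<Prod>j\<in>UNIV. exp_coeffs (A j) l))"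

lemma fps_tensor_exp_series:
  fixes a :: "'m::finite \<Rightarrow> nat \<Rightarrow> 'a::field_char_0 fps"
  shows "fps_tensor (\<lambda>j. exp_series (\<lambda>l. - a j l)) = exp_series (\<lambda>l. - (\<Prod>j\<in>UNIV. a j l))"
proof -
  have "exp_series (\<lambda>l. - a j l) = exp_series (\<lambda>l. - exp_coeffs (exp_series (\<lambda>l. - a j l)) l)" for j
    unfolding exp_coeffs_def by (rule someI[of _ "a j"]) (rule refl)
  then have "exp_coeffs (exp_series (\<lambda>l. - a j l)) l = a j l" if "l \<ge> 1" for j l
    using that unfolding exp_series_eq_iff by force
  then show ?thesis
    unfolding fps_tensor_def exp_series_eq_iff by simp
qed


subsection \<open>Laurent polynomials, exponential sums and L-functions\<close>

text \<open>
  A Laurent polynomial in variables indexed by a finite type \<open>'n\<close> is a finitely supported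
  function on the exponent lattice \<open>int ^ 'n\<close>.
\<close>

definition monom_val :: "'a::field ^ 'n \<Rightarrow> int ^ 'n \<Rightarrow> 'a"
  where "monom_val x u = (\<Prod>i\<in>UNIV. x $ i powi (u $ i))"

definition laurent_eval :: "((int ^ 'n) \<Rightarrow>\<^sub>0 'a::field) \<Rightarrow> 'a ^ 'n \<Rightarrow> 'a"
  where "laurent_eval h x =
    (\<Sum>u\<in>Poly_Mapping.keys h. Poly_Mapping.lookup h u * monom_val x u)"

text \<open>
  \<open>expsum h r e\<close> is $S_h(T, \omega^{-e}, \mathbb{F}_r)$, with the class of \<open>e\<close> modulo \<open>r - 1\<close> given
  by a representative. The series $\psi(y) = (1 + T)^y$ is \<open>fps_binomial y\<close>.
\<close>
definition expsum :: "((int ^ 'n::finite) \<Rightarrow>\<^sub>0 'k::field_prime_char witt fract) \<Rightarrow> nat \<Rightarrow> int ^ 'n \<Rightarrow>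
    'k witt fract fps"
  where "expsum h r e = (\<Sum>x\<in>{x. \<forall>i. x $ i \<in> mu r}.
    fps_const (monom_val x (- e)) * fps_binomial (W_trace r (laurent_eval h x)))"

text \<open>\<open>Lfun h r e\<close> is $L_{h,\omega^{-e}}(s, T, \mathbb{F}_r)$.\<close>
definition Lfun :: "((int ^ 'n::finite) \<Rightarrow>\<^sub>0 'k::field_prime_char witt fract) \<Rightarrow> nat \<Rightarrow> int ^ 'n \<Rightarrow>
    'k witt fract fps fps"
  where "Lfun h r e =
    exp_series (\<lambda>l. expsum h (r ^ l) (\<chi> i. e $ i * int ((r ^ l - 1) div (r - 1))))"


subsection \<open>Diagonal base change\<close>

definition tensor_vec :: "'a::times ^ 'n \<Rightarrow> 'a ^ 'm \<Rightarrow> 'a ^ ('n \<times> 'm)"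
  where "tensor_vec u v = (\<chi> ij. u $ fst ij * v $ snd ij)"

text \<open>The coefficients of \<open>g\<close> are vectors, one entry for each variable of \<open>f\<close>.\<close>
definition diag_base_change ::
  "((int ^ 'n::finite) \<Rightarrow>\<^sub>0 'a::field) \<Rightarrow> ((int ^ 'm::finite) \<Rightarrow>\<^sub>0 'a ^ 'n) \<Rightarrow> (int ^ ('n \<times> 'm)) \<Rightarrow>\<^sub>0 'a"
  where "diag_base_change f g = (\<Sum>u\<in>Poly_Mapping.keys f. \<Sum>v\<in>Poly_Mapping.keys g.
    Poly_Mapping.single (tensor_vec u v)
      (Poly_Mapping.lookup f u * monom_val (Poly_Mapping.lookup g v) u))"

definition integral_basis :: "('m::finite \<Rightarrow> int ^ 'm) \<Rightarrow> bool"
  where "integral_basis v \<longleftrightarrow> (let w = (\<lambda>j. \<chi> i. real_of_int (v j $ i)) in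
    inj w \<and> independent (range w) \<and> span (range w) = (UNIV :: (real ^ 'm) set))"


subsection \<open>Orbits of multiplication by q\<close>

definition Z_loc :: "nat \<Rightarrow> rat set"
  where "Z_loc p = {of_int a / of_int c | a c. \<not> int p dvd c}"

definition loc_tuples :: "nat \<Rightarrow> (rat ^ 'n ^ 'm) set"
  where "loc_tuples p = {u. \<forall>j i. u $ j $ i \<in> Z_loc p}"

text \<open>
  The orbit space $q \backslash (\mathbb{Z}_{(p)}^n/\mathbb{Z}^n)^m$ as a quotient of
  $(\mathbb{Z}_{(p)}^n)^m$: two tuples are related if the class modulo $\mathbb{Z}^n$ of one is
  obtained from that of the other by a power of \<open>q\<close>. Multiplication by \<open>q\<close> has finite order on each
  class, so exponents \<open>k \<ge> 0\<close> suffice.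
\<close>
definition orbit_rel :: "nat \<Rightarrow> nat \<Rightarrow> (rat ^ 'n ^ 'm) rel"
  where "orbit_rel p q = {(u, u'). u \<in> loc_tuples p \<and> u' \<in> loc_tuples p \<and>
    (\<exists>k. \<forall>j i. u' $ j $ i - of_nat (q ^ k) * u $ j $ i \<in> \<int>)}"

definition orbit_length :: "nat \<Rightarrow> rat ^ 'n ^ 'm \<Rightarrow> nat"
  where "orbit_length q u = (LEAST k. k \<ge> 1 \<and> (\<forall>j i. (of_nat (q ^ k) - 1) * u $ j $ i \<in> \<int>))"

text \<open>The integral vector $u_j (q^{|u|} - 1)$.\<close>
definition orbit_exponent :: "nat \<Rightarrow> rat ^ 'n ^ 'm \<Rightarrow> 'm \<Rightarrow> int ^ 'n"
  where "orbit_exponent q u j = (\<chi> i. \<lfloor>u $ j $ i * (of_nat (q ^ orbit_length q u) - 1)\<rfloor>)"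

text \<open>
  The orbits whose members satisfy
  $u_1 \otimes v_1 + \dots + u_m \otimes v_m \equiv d/(q-1)$ modulo $\mathbb{Z}^n \otimes \mathbb{Z}^m$.
\<close>
definition admissible_orbits ::
  "nat \<Rightarrow> nat \<Rightarrow> ('m::finite \<Rightarrow> int ^ 'm) \<Rightarrow> int ^ ('n::finite \<times> 'm) \<Rightarrow> (rat ^ 'n ^ 'm) set set"
  where "admissible_orbits p q v d = {C \<in> loc_tuples p // orbit_rel p q. \<forall>u\<in>C. \<forall>ij.
    (\<Sum>j\<in>UNIV. tensor_vec (u $ j) (\<chi> l. of_int (v j $ l))) $ ij - of_int (d $ ij) / (of_nat q - 1) \<in> \<int>}"

end

theory Submission
  imports Defs
begin

text \<open>
  \<^bold>\<open>The identity for one exponential sum.\<close> Since $g$ has the terms $b_j y^{v_j}$, the diagonal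
  base change satisfies $(f \otimes g)(z) = \sum_j f(b_j z^{v_j})$, where $z^{v_j}$ is the vector of
  the monomials $z_i^{v_j}$ in the rows of \<open>z\<close>. Fix $r = q^k$. Additivity of the trace and of
  $x \mapsto (1+T)^x$ turn the sum into a product over \<open>j\<close>, so the exponential sum of
  $f \otimes g$ is $\sum_z z^{-d} F(\phi(z))$ for a product function $F$ of \<open>m\<close> vectors and the map
  $\phi(z) = (b_j z^{v_j})_j$ on tuples of elements of $\mu_{r-1}$. Orthogonality of characters,
  for the summation over \<open>z\<close> and for the one over exponents, gives
  \[ S_{f \otimes g}(\omega^{-d}) =
     \sum_{e} \prod_j b_j^{e_j} S_f(\omega^{-e_j}), \]
  where $e = (e_1, \dots, e_m)$ runs over the exponent tuples modulo $r - 1$ with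
  $\sum_j e_j \otimes v_j \equiv d$ (\<open>expsum_diag_base_change\<close>).

  \<^bold>\<open>Grouping into orbits.\<close> Dividing exponents by $q^k - 1$ identifies the exponent tuples
  modulo $q^k - 1$ with the classes $u \in (\mathbb{Z}_{(p)}^n/\mathbb{Z}^n)^m$ that are fixed by
  $q^k$, and the congruence becomes $\sum_j u_j \otimes v_j \equiv d/(q-1)$ for every \<open>k\<close> at once
  (\<open>tensor_cond_exp_quot\<close>). An orbit of length \<open>R\<close> contributes \<open>R\<close> tuples if $R \mid k$ and none
  otherwise (\<open>exp_box_orbit_fibre\<close>). All tuples of an orbit contribute the same summand
  (\<open>diag_expsum_orbit_term\<close>): the substitution $x \mapsto x^q$ permutes the roots of unity, acts on
  values of \<open>f\<close> as a power of the Frobenius because the coefficients lie in $\mu_{q-1}$, and the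
  trace is invariant under automorphisms (\<open>expsum_frob\<close>).

  \<^bold>\<open>Comparing logarithms.\<close> An orbit of length \<open>R\<close> thus contributes to the coefficient of
  $s^k/k$, $k = Rl$, the number $R$ times a product over \<open>j\<close> of exponential sums of \<open>f\<close> over the field
  with $q^{Rl}$ elements, twisted by $(\prod_j b_j^{u_j(q^R-1)})^l$. This is what
  the tensor product of the series $L_f$, evaluated at a multiple of $s^R$, contributes, as
  $R \cdot s^{Rl}/(Rl) = s^{Rl}/l$; the signs $(-1)^{n-1}$ turn each $L_f$ into
  $\exp(-\sum_l (-1)^n S_l s^l/l)$, the form to which the tensor operation refers.
  There are finitely many orbits because the integral basis has a rational
  inverse, which bounds the denominators of \<open>u\<close>.
\<close>

text \<open>The dollar sign is reserved for the entries of vectors; coefficients of series are written with \<open>fps_nth\<close>.\<close>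
no_notation fps_nth (infixl \<open>$\<close> 75)

section \<open>Exponentials of power series\<close>

text \<open>
  The exponential is handled through its logarithmic derivative: all identities below between
  values of \<open>exp_series\<close> follow from the fact that it is the solution of a linear differential equation.
\<close>
lemma exp_series_deriv:
  fixes a :: "nat \<Rightarrow> 'a::field_char_0 fps"
  shows "fps_deriv (exp_series a) = exp_series a * Abs_fps (\<lambda>n. a (Suc n))"
proof -
  define E :: "'a fps fps" where "E = Abs_fps (\<lambda>n. fps_const (inverse (fact n)))"
  define F where "F = Abs_fps (\<lambda>l. if l = 0 then 0 else fps_const (inverse (of_nat l)) * a l)"
  have exp: "exp_series a = E oo F" by (simp add: exp_series_def E_def F_def)
  have E': "fps_deriv E = E"
  proof (rule fps_ext)
    fix n
    have "(of_nat (Suc n) :: 'a fps) = fps_const (of_nat (Suc n))"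
      by (simp only: fps_of_nat)
    moreover have "of_nat (Suc n) * inverse (fact (Suc n)) = inverse (fact n :: 'a)"
      by (simp add: field_simps del: of_nat_Suc)
    ultimately show "fps_nth (fps_deriv E) n = fps_nth E n"
      by (simp add: E_def del: of_nat_Suc fact_Suc)
  qed
  have "fps_deriv (exp_series a) = exp_series a * fps_deriv F"
    unfolding exp by (subst fps_compose_deriv) (simp_all add: E' F_def)
  also have "fps_deriv F = Abs_fps (\<lambda>n. a (Suc n))"
  proof (rule fps_ext)
    fix n
    have "(of_nat (Suc n) :: 'a fps) * (fps_const (inverse (of_nat (Suc n))) * a (Suc n)) = a (Suc n)"
      by (simp add: mult.assoc [symmetric] del: of_nat_Suc flip: fps_of_nat)
    then show "fps_nth (fps_deriv F) n = fps_nth (Abs_fps (\<lambda>n. a (Suc n))) n"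
      by (simp add: F_def del: of_nat_Suc)
  qed
  finally show ?thesis .
qed

lemma fps_linear_ode_unique:
  fixes A B F :: "'a::{idom,semiring_char_0} fps"
  assumes "fps_deriv A = A * F" "fps_deriv B = B * F" "fps_nth A 0 = fps_nth B 0"
  shows "A = B"
proof (rule fps_ext)
  fix n show "fps_nth A n = fps_nth B n"
  proof (induction n rule: less_induct)
    case (less n)
    show ?case
    proof (cases n)
      case (Suc m)
      have "of_nat (Suc m) * fps_nth A (Suc m) = fps_nth (fps_deriv A) m" by simp
      also have "\<dots> = (\<Sum>i=0..m. fps_nth A i * fps_nth F (m - i))"
        unfolding assms(1) by (simp add: fps_mult_nth)
      also have "\<dots> = (\<Sum>i=0..m. fps_nth B i * fps_nth F (m - i))"
        by (intro sum.cong) (auto simp: less Suc)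
      also have "\<dots> = fps_nth (fps_deriv B) m"
        unfolding assms(2) by (simp add: fps_mult_nth)
      also have "\<dots> = of_nat (Suc m) * fps_nth B (Suc m)" by simp
      finally show ?thesis unfolding Suc mult_cancel_left by (simp del: of_nat_Suc)
    qed (use assms(3) in simp)
  qed
qed

lemma exp_series_unique:
  fixes a :: "nat \<Rightarrow> 'a::field_char_0 fps"
  assumes "fps_nth A 0 = 1" "fps_deriv A = A * Abs_fps (\<lambda>n. a (Suc n))"
  shows "A = exp_series a"
  using assms by (intro fps_linear_ode_unique[OF _ exp_series_deriv]) simp_all

lemma exp_series_add:
  fixes a b :: "nat \<Rightarrow> 'a::field_char_0 fps"
  shows "exp_series a * exp_series b = exp_series (\<lambda>l. a l + b l)"
proof (rule exp_series_unique)
  have "Abs_fps (\<lambda>n. a (Suc n) + b (Suc n)) = Abs_fps (\<lambda>n. a (Suc n)) + Abs_fps (\<lambda>n. b (Suc n))"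
    by (simp add: fps_eq_iff)
  then show "fps_deriv (exp_series a * exp_series b) =
      exp_series a * exp_series b * Abs_fps (\<lambda>n. a (Suc n) + b (Suc n))"
    by (simp add: exp_series_deriv algebra_simps)
qed simp

lemma exp_series_zero: "exp_series (\<lambda>_. 0) = 1"
  by (rule sym, rule exp_series_unique) (auto simp: fps_eq_iff)

lemma exp_series_sum:
  "(\<Prod>x\<in>X. exp_series (a x)) = exp_series (\<lambda>l. \<Sum>x\<in>X. a x l)"
  by (induction X rule: infinite_finite_induct) (auto simp: exp_series_zero exp_series_add)

lemma exp_series_powi_sign:
  fixes a :: "nat \<Rightarrow> 'a::field_char_0 fps"
  shows "exp_series a powi ((-1) ^ k) = exp_series (\<lambda>l. (-1) ^ k * a l)"
proof (cases "even k")
  case False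
  have inv1: "inverse (1 :: 'a fps) = 1" by simp
  have "exp_series a * inverse (exp_series a) = 1"
    unfolding fps_inverse_def[of "exp_series a"] exp_series_nth_0 inv1
    by (rule fps_right_inverse) simp
  moreover have "exp_series a * exp_series (\<lambda>l. - a l) = 1"
    by (simp add: exp_series_add exp_series_zero)
  moreover have "exp_series a \<noteq> 0"
    by (metis exp_series_nth_0 fps_zero_nth zero_neq_one)
  ultimately have "inverse (exp_series a) = exp_series (\<lambda>l. - a l)"
    by (metis mult_cancel_left)
  with False show ?thesis by (simp add: power_int_def)
qed (simp add: power_int_def)

lemma fps_nth_compose_monom:
  fixes F :: "'a::comm_ring_1 fps"
  assumes "r \<ge> 1"
  shows "fps_nth (F oo (fps_const c * fps_X ^ r)) k =
    (if r dvd k then fps_nth F (k div r) * c ^ (k div r) else 0)"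
proof -
  have "fps_nth (F oo (fps_const c * fps_X ^ r)) k =
     (\<Sum>i=0..k. if r * i = k then fps_nth F i * c ^ i else 0)"
    unfolding fps_compose_nth
    by (intro sum.cong) (auto simp: power_mult_distrib fps_X_power_nth simp flip: power_mult)
  also have "\<dots> = (if r dvd k then fps_nth F (k div r) * c ^ (k div r) else 0)"
  proof (cases "r dvd k")
    case True
    then obtain i where i: "k = r * i" by blast
    have "(\<Sum>i'=0..k. if r * i' = k then fps_nth F i' * c ^ i' else 0) = 
       (\<Sum>i'=0..k. if i' = i then fps_nth F i' * c ^ i' else 0)"
      using assms by (intro sum.cong) (auto simp: i)
    then show ?thesis using assms by (simp add: i)
  qed (auto intro!: sum.neutral)
  finally show ?thesis .
qed

text \<open>
  Substituting $c\,s^r$ moves the term $a_l s^l/l$ to exponent $k = rl$, where $1/l = r/k$; this is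
  the source of the factor \<open>r\<close>.
\<close>
lemma exp_series_compose_monom:
  fixes a :: "nat \<Rightarrow> 'a::field_char_0 fps"
  assumes "r \<ge> 1"
  shows "exp_series a oo (fps_const c * fps_X ^ r) =
    exp_series (\<lambda>k. if r dvd k then of_nat r * c ^ (k div r) * a (k div r) else 0)"
proof (rule exp_series_unique)
  define G where "G = fps_const c * fps_X ^ r"
  have G0: "fps_nth G 0 = 0" using assms by (simp add: G_def)
  have dG: "fps_deriv G = fps_const (of_nat r * c) * fps_X ^ (r - 1)"
    using assms by (simp add: G_def fps_deriv_power fps_of_nat[symmetric] mult_ac)
  have "fps_deriv (exp_series a oo G) = (exp_series a oo G) * ((Abs_fps (\<lambda>n. a (Suc n)) oo G) * fps_deriv G)"
    using G0 by (simp add: fps_compose_deriv exp_series_deriv fps_compose_mult_distrib mult_ac)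
  also have "(Abs_fps (\<lambda>n. a (Suc n)) oo G) * fps_deriv G =
      Abs_fps (\<lambda>n. if r dvd Suc n then of_nat r * c ^ (Suc n div r) * a (Suc n div r) else 0)"
  proof (rule fps_ext)
    fix n
    have "fps_nth ((Abs_fps (\<lambda>n. a (Suc n)) oo G) * fps_deriv G) n =
       of_nat r * c * (if n < r - 1 then 0 else fps_nth (Abs_fps (\<lambda>n. a (Suc n)) oo G) (n - (r - 1)))"
      unfolding dG by (subst mult.commute, subst mult.assoc) (simp add: fps_X_power_mult_nth)
    also have "\<dots> = (if r dvd Suc n then of_nat r * c ^ (Suc n div r) * a (Suc n div r) else 0)"
    proof (cases "n < r - 1")
      case True
      then have "\<not> r dvd Suc n" by (auto dest: dvd_imp_le)
      with True show ?thesis by simp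
    next
      case False
      then obtain m where m: "Suc n = m + r" using assms by (metis le_add_diff_inverse2 not_less Suc_pred' less_Suc_eq_le Suc_le_lessD One_nat_def)
      then have "n - (r - 1) = m" using assms by simp
      moreover have "r dvd Suc n \<longleftrightarrow> r dvd m" "r dvd m \<Longrightarrow> Suc n div r = Suc (m div r)"
        using assms by (simp_all add: m)
      ultimately show ?thesis
        using False assms unfolding G_def by (simp add: fps_nth_compose_monom mult_ac)
    qed
    finally show "fps_nth ((Abs_fps (\<lambda>n. a (Suc n)) oo G) * fps_deriv G) n = fps_nth (Abs_fps (\<lambda>n. if r dvd Suc n then of_nat r * c ^ (Suc n div r) * a (Suc n div r) else 0)) n" 
      by simp
  qed
  finally show "fps_deriv (exp_series a oo (fps_const c * fps_X ^ r)) = (exp_series a oo (fps_const c * fps_X ^ r)) *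
      Abs_fps (\<lambda>n. if r dvd Suc n then of_nat r * c ^ (Suc n div r) * a (Suc n div r) else 0)"
    by (simp add: G_def)
qed simp

section \<open>Witt vectors of finite fields, roots of unity and traces\<close>

text \<open>
  The polynomial $X^n - 1$ splits, and a double root would be a common zero with $n X^{n-1}$.
\<close>
lemma card_roots_of_unity_alg_closed:
  assumes "n \<ge> 1" "\<not> CHAR('a) dvd n"
  shows "card {x :: 'a::alg_closed_field. x ^ n = 1} = n"
proof -
  define P :: "'a poly" where "P = monom 1 n - 1"
  have deg: "degree P = n"
    unfolding P_def diff_conv_add_uminus using assms(1) by (subst degree_add_eq_left) (auto simp: degree_monom_eq)
  have P0: "P \<noteq> 0" using deg assms(1) by auto
  have roots: "{x. poly P x = 0} = {x. x ^ n = 1}"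
    by (simp add: P_def poly_monom)
  have "order x P \<le> 1" for x
  proof (rule ccontr)
    assume "\<not> order x P \<le> 1"
    then have "[:-x, 1:] ^ 2 dvd P" using P0 by (simp add: order_divides)
    then obtain Q where Q: "P = [:-x, 1:] ^ 2 * Q" by blast
    have "poly P x = 0" "poly (pderiv P) x = 0"
      by (simp_all add: Q pderiv_mult power2_eq_square del: mult_pCons_left mult_pCons_right)
    moreover from this have "of_nat n * x ^ (n - 1) = 0"
      by (simp add: P_def pderiv_diff pderiv_monom poly_monom)
    then have "x = 0" using assms(2) by (simp add: of_nat_eq_0_iff_char_dvd)
    ultimately show False using assms(1) by (auto simp: P_def poly_monom zero_power)
  qed
  then have "count (proots P) x = count (mset_set {x. poly P x = 0}) x" for x
    using P0 poly_roots_finite[OF P0] order_root[of P x]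
    by (cases "poly P x = 0") (auto simp: order_0I intro: le_antisym Suc_leI)
  then have proots: "proots P = mset_set {x. poly P x = 0}"
    by (rule multiset_eqI)
  obtain A where A: "size A = degree P" "P = smult (lead_coeff P) (\<Prod>x\<in>#A. [:-x, 1:])"
    using alg_closed_imp_factorization[OF P0] by blast
  have "proots P = proots (\<Prod>x\<in>#A. [:-x, 1:])"
    by (subst A(2), subst proots_smult) (use P0 in auto)
  also have "\<dots> = A"
  proof (induction A)
    case (add x A)
    have "(\<Prod>x\<in>#A. [:-x, 1:]) \<noteq> 0" by (auto simp: prod_mset_zero_iff)
    then show ?case using add by (simp add: proots_mult del: mult_pCons_left mult_pCons_right)
  qed simp
  finally have "card {x. poly P x = 0} = n"
    using proots A(1) deg by (metis size_mset_set)
  then show ?thesis by (simp add: roots)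
qed

definition teich :: "'a::comm_ring_prime_char \<Rightarrow> 'a witt"
  where "teich x = Witt (\<lambda>n. if n = 0 then x else 0)"

lemma ghost_teich:
  assumes "prime p"
  shows "ghost p (\<lambda>n. if n = 0 then x else 0) n = x ^ (p ^ n)"
proof -
  have "ghost p (\<lambda>n. if n = 0 then x else 0) n = (\<Sum>i\<le>n. if i = 0 then x ^ (p ^ n) else 0)"
    unfolding ghost_def using prime_gt_0_nat[OF assms] by (intro sum.cong) (auto simp: zero_power)
  then show ?thesis by simp
qed

text \<open>
  It suffices to compare the two sides for polynomial variables over the integers, where a Witt vector is
  determined by its ghost components; those of a Teichmueller representative are the powers
  $x^{p^n}$.
\<close>
lemma teich_mult:
  fixes x y :: "'a::comm_ring_prime_char"
  shows "teich (x * y) = teich x * teich y"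
proof -
  define p where "p = CHAR('a)"
  have p: "prime p" by (simp add: p_def)
  define t :: "mpoly_int \<Rightarrow> nat \<Rightarrow> mpoly_int" where "t X n = (if n = 0 then X else 0)" for X n
  have gt: "ghost p (t X) n = X ^ (p ^ n)" for X n
    unfolding t_def by (rule ghost_teich[OF p])
  have eq: "witt_times p (t (mp_var 0)) (t (mp_var 1)) = t (mp_var 0 * mp_var 1)"
    by (intro ghost_inj[OF p]) (simp add: ghost_times[OF p] gt power_mult_distrib)
  define \<tau> where "\<tau> i = (if i = 0 then x else y)" for i :: nat
  have ev: "(\<lambda>n. mp_eval \<tau> (t X n)) = (\<lambda>n. if n = 0 then mp_eval \<tau> X else 0)" for X
    by (auto simp: t_def)
  have "witt_times p (\<lambda>n. if n = 0 then x else 0) (\<lambda>n. if n = 0 then y else 0) =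
      (\<lambda>n. if n = 0 then x * y else 0)"
    using arg_cong[OF eq, of "\<lambda>f n. mp_eval \<tau> (f n)"]
    by (simp add: witt_eval ev \<tau>_def cong: if_cong)
  then show ?thesis by (simp add: teich_def times_witt_def p_def)
qed

lemma teich_1 [simp]: "teich 1 = 1"
  by (simp add: teich_def one_witt_def witt_one_def[abs_def])

lemma teich_power: "teich (x ^ n) = teich x ^ n"
  by (induction n) (auto simp: teich_mult)

lemma inj_teich: "inj teich"
  by (rule injI) (auto simp: teich_def fun_eq_iff split: if_splits)

lemma witt_frob_pow_add: "(witt_frob ^^ n) (x + y) = (witt_frob ^^ n) x + (witt_frob ^^ n) y"
  by (induction n) (auto simp: witt_frob_hom)

lemma witt_frob_pow_teich: "(witt_frob ^^ n) (teich x) = teich x ^ (CHAR('a) ^ n)"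
  for x :: "'a::comm_ring_prime_char"
proof -
  have "(witt_frob ^^ n) (teich x) = teich (x ^ (CHAR('a) ^ n))"
    by (intro witt.expand ext) (simp add: witt_coord_frob_pow, simp add: teich_def zero_power)
  then show ?thesis by (simp add: teich_power)
qed

text \<open>
  The Witt vectors of the field with $p^c$ elements are the fixed points of the \<open>c\<close>-th power of the
  Frobenius.
\<close>
lemma W_ring_eq: "W_ring (CHAR('k) ^ c) = to_fract ` {w :: 'k::field_prime_char witt. (witt_frob ^^ c) w = w}"
proof -
  have "(witt_frob ^^ c) w = w \<longleftrightarrow> (\<forall>i. witt_coord w i ^ (CHAR('k) ^ c) = witt_coord w i)" for w :: "'k witt"
    by (metis (no_types, lifting) ext witt.expand witt_coord_frob_pow)
  then show ?thesis by (simp add: W_ring_def)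
qed

text \<open>
  The Frobenius power as a map of the fraction field; it has its meaning only on the image of the Witt
  vectors, hence the description operator.
\<close>
definition W_frob :: "nat \<Rightarrow> 'k::field_prime_char witt fract \<Rightarrow> 'k witt fract"
  where "W_frob c x = to_fract ((witt_frob ^^ c) (THE w. x = to_fract w))"

lemma W_frob_to_fract: "W_frob c (to_fract w) = to_fract ((witt_frob ^^ c) w)"
  by (simp add: W_frob_def)

lemma W_ring_closed:
  fixes x y :: "'k::field_prime_char witt fract"
  assumes "x \<in> W_ring (CHAR('k) ^ c)" "y \<in> W_ring (CHAR('k) ^ c)"
  shows "x + y \<in> W_ring (CHAR('k) ^ c)" "x * y \<in> W_ring (CHAR('k) ^ c)"
    and "W_frob e (x + y) = W_frob e x + W_frob e y" "W_frob e (x * y) = W_frob e x * W_frob e y"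
proof -
  obtain w where w: "x = to_fract w" "(witt_frob ^^ c) w = w" using assms(1) by (auto simp: W_ring_eq)
  obtain w' where w': "y = to_fract w'" "(witt_frob ^^ c) w' = w'" using assms(2) by (auto simp: W_ring_eq)
  show "x + y \<in> W_ring (CHAR('k) ^ c)" unfolding W_ring_eq
    by (rule image_eqI[of _ _ "w + w'"]) (auto simp: w w' witt_frob_pow_add)
  show "x * y \<in> W_ring (CHAR('k) ^ c)" unfolding W_ring_eq
    by (rule image_eqI[of _ _ "w * w'"]) (auto simp: w w' witt_frob_pow_hom)
  show "W_frob e (x + y) = W_frob e x + W_frob e y" 
    by (simp add: w(1) w'(1) W_frob_to_fract witt_frob_pow_add flip: to_fract_add)
  show "W_frob e (x * y) = W_frob e x * W_frob e y" 
    by (simp add: w(1) w'(1) W_frob_to_fract witt_frob_pow_hom flip: to_fract_mult)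
qed

lemma W_frob_closed:
  fixes x :: "'k::field_prime_char witt fract"
  assumes "x \<in> W_ring (CHAR('k) ^ c)"
  shows "W_frob e x \<in> W_ring (CHAR('k) ^ c)" "W_frob c x = x" "W_frob e (W_frob e' x) = W_frob (e + e') x"
proof -
  obtain w where w: "x = to_fract w" "(witt_frob ^^ c) w = w" using assms by (auto simp: W_ring_eq)
  show "W_frob e x \<in> W_ring (CHAR('k) ^ c)" unfolding W_ring_eq w(1) W_frob_to_fract
    using w(2) by (metis (mono_tags, lifting) add.commute comp_apply funpow_add image_eqI mem_Collect_eq)
  show "W_frob c x = x" by (simp add: W_frob_to_fract w)
  show "W_frob e (W_frob e' x) = W_frob (e + e') x" by (simp add: W_frob_to_fract w(1) funpow_add)
qed

lemma W_ring_0: "(0 :: 'k::field_prime_char witt fract) \<in> W_ring (CHAR('k) ^ c)" for c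
  unfolding W_ring_eq by (rule image_eqI[of _ _ "0 :: 'k witt"]) (auto simp: witt_frob_pow_hom)

lemma W_ring_1: "(1 :: 'k::field_prime_char witt fract) \<in> W_ring (CHAR('k) ^ c)" for c
  unfolding W_ring_eq using witt_frob_pow_hom(3)[of c 1] 
  by (intro image_eqI[of _ _ "1 :: 'k witt"]) auto

lemma W_ring_sum:
  fixes g :: "'i \<Rightarrow> 'k::field_prime_char witt fract"
  assumes "\<And>i. i \<in> X \<Longrightarrow> g i \<in> W_ring (CHAR('k) ^ c)"
  shows "sum g X \<in> W_ring (CHAR('k) ^ c)" "W_frob e (sum g X) = (\<Sum>i\<in>X. W_frob e (g i))"
proof -
  have W0: "W_frob e 0 = (0 :: 'k witt fract)"
    using W_frob_to_fract[of e 0] by (simp add: witt_frob_pow_hom)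
  have "sum g X \<in> W_ring (CHAR('k) ^ c) \<and> W_frob e (sum g X) = (\<Sum>i\<in>X. W_frob e (g i))"
    using assms
  proof (induction X rule: infinite_finite_induct)
    case (insert x F)
    then show ?case using W_ring_closed(1,3)[of "g x" c "sum g F"] by simp
  qed (auto simp: W_ring_0 W0)
  then show "sum g X \<in> W_ring (CHAR('k) ^ c)" "W_frob e (sum g X) = (\<Sum>i\<in>X. W_frob e (g i))" by auto
qed

lemma W_ring_mono: "c \<ge> 1 \<Longrightarrow> W_ring (CHAR('k) ^ c) \<subseteq> (W_ring (CHAR('k) ^ (c * n)) :: 'k::field_prime_char witt fract set)"
proof -
  have "((witt_frob ^^ c) ^^ n) w = w" if "(witt_frob ^^ c) w = w" for w :: "'k witt"
    by (induction n) (auto simp: that)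
  then show ?thesis unfolding W_ring_eq by (auto simp: funpow_mult mult.commute)
qed

text \<open>
  The Teichmueller representatives supply $r - 1$ elements of \<open>mu r\<close>, and the polynomial
  $X^{r-1} - 1$ has no more roots than that in the field of fractions. The description of \<open>mu r\<close> by
  representatives is what makes the Frobenius act on it as a power map.
\<close>
lemma mu_eq_teich:
  assumes "c \<ge> 1"
  shows "mu (CHAR('k) ^ c) = (to_fract \<circ> teich) ` {x :: 'k::{alg_closed_field,field_prime_char}. x ^ (CHAR('k) ^ c - 1) = 1}"
    and "card (mu (CHAR('k) ^ c) :: 'k witt fract set) = CHAR('k) ^ c - 1"
    and "finite (mu (CHAR('k) ^ c) :: 'k witt fract set)"
proof -
  define p where "p = CHAR('k)"
  have p: "prime p" by (simp add: p_def)
  define r where "r = p ^ c"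
  have r: "r > 1" unfolding r_def by (rule one_less_power) (use assms prime_gt_1_nat[OF p] in auto)
  have pr: "p dvd r" using assms by (auto simp: r_def intro: dvd_power)
  have "\<not> p dvd r - 1"
  proof
    assume "p dvd r - 1"
    then have "p dvd r - (r - 1)" using pr dvd_diff_nat by blast
    then show False using r p by simp
  qed
  then have card: "card {x :: 'k. x ^ (r - 1) = 1} = r - 1"
    using r by (intro card_roots_of_unity_alg_closed) (auto simp: p_def)
  define T where "T = (to_fract \<circ> teich) ` {x :: 'k. x ^ (r - 1) = 1}"
  have cT: "card T = r - 1"
    unfolding T_def by (subst card_image) (use card inj_teich in \<open>auto simp: inj_on_def\<close>)
  have sub: "T \<subseteq> mu r"
  proof
    fix y assume "y \<in> T"
    then obtain x where x: "x ^ (r - 1) = 1" "y = to_fract (teich x)" by (auto simp: T_def)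
    have "x ^ r = x" using x(1) r by (metis Suc_diff_1 less_trans power_Suc2 zero_less_one mult_1_left)
    then have "(witt_frob ^^ c) (teich x) = teich x" 
      by (simp add: witt_frob_pow_teich r_def p_def flip: teich_power)
    then have "y \<in> W_ring r" unfolding r_def p_def W_ring_eq using x(2) by blast
    moreover have "to_fract (teich x ^ n) = to_fract (teich x) ^ n" for n
      by (induction n) auto
    then have "y ^ (r - 1) = 1" using x by (metis teich_1 teich_power to_fract_1)
    ultimately show "y \<in> mu r" by (simp add: mu_def)
  qed
  define P :: "'k witt fract poly" where "P = monom 1 (r - 1) - 1"
  have deg: "degree P = r - 1"
    unfolding P_def diff_conv_add_uminus using r by (subst degree_add_eq_left) (auto simp: degree_monom_eq)
  have P0: "P \<noteq> 0" using deg r by auto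
  have muP: "mu r \<subseteq> {x. poly P x = 0}" by (auto simp: mu_def P_def poly_monom)
  then have fin: "finite (mu r :: 'k witt fract set)" using poly_roots_finite[OF P0] finite_subset by blast
  have "card (mu r :: 'k witt fract set) \<le> r - 1"
    using card_mono[OF poly_roots_finite[OF P0] muP] card_poly_roots_bound[OF P0] deg by simp
  with cT have "T = mu r" using card_subset_eq[OF fin sub] card_mono[OF fin sub] by simp
  with cT fin show "mu (CHAR('k) ^ c) = (to_fract \<circ> teich) ` {x :: 'k. x ^ (CHAR('k) ^ c - 1) = 1}"
    "card (mu (CHAR('k) ^ c) :: 'k witt fract set) = CHAR('k) ^ c - 1"
    "finite (mu (CHAR('k) ^ c) :: 'k witt fract set)"
    by (auto simp: T_def r_def p_def)
qed

lemma mu_W_ring: "x \<in> mu r \<Longrightarrow> x \<in> W_ring r"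
  by (simp add: mu_def)

lemma mu_power_eq_1: "x \<in> mu r \<Longrightarrow> x ^ (r - 1) = 1"
  by (simp add: mu_def)

lemma mu_nonzero: "r > 1 \<Longrightarrow> x \<in> mu r \<Longrightarrow> x \<noteq> 0"
  by (auto simp: mu_def zero_power)

lemma mu_mult:
  "x \<in> mu (CHAR('k) ^ c) \<Longrightarrow> y \<in> mu (CHAR('k) ^ c) \<Longrightarrow> x * y \<in> mu (CHAR('k) ^ c)"
  for x y :: "'k::field_prime_char witt fract"
  by (simp add: mu_def W_ring_closed power_mult_distrib)

lemma mu_1: "(1 :: 'k::field_prime_char witt fract) \<in> mu (CHAR('k) ^ c)"
  by (simp add: mu_def W_ring_1)

lemma mu_power: "x \<in> mu (CHAR('k) ^ c) \<Longrightarrow> x ^ n \<in> mu (CHAR('k) ^ c)"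
  for x :: "'k::field_prime_char witt fract"
  by (induction n) (auto simp: mu_1 mu_mult)

lemma CHAR_power_gt_1: "c \<ge> 1 \<Longrightarrow> CHAR('k::field_prime_char) ^ c > 1"
  using prime_gt_1_nat[OF CHAR_prime[where 'a = 'k]] by (intro one_less_power) auto

lemma mu_inverse: "c \<ge> 1 \<Longrightarrow> x \<in> mu (CHAR('k) ^ c) \<Longrightarrow> inverse x \<in> mu (CHAR('k) ^ c)"
  for x :: "'k::field_prime_char witt fract"
proof -
  assume c: "c \<ge> 1" and x: "x \<in> mu (CHAR('k) ^ c)"
  define r where "r = CHAR('k) ^ c"
  have r: "r > 1" using CHAR_power_gt_1[OF c, where 'k = 'k] by (simp add: r_def)
  have "x * x ^ (r - 2) = x ^ (r - 1)" using r by (metis Suc_diff_Suc numeral_2_eq_2 power_Suc One_nat_def)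
  also have "\<dots> = 1" using mu_power_eq_1 x by (simp add: r_def)
  finally have "inverse x = x ^ (r - 2)" by (rule inverse_unique)
  then show ?thesis using x mu_power by simp
qed

lemma mu_powi: "c \<ge> 1 \<Longrightarrow> x \<in> mu (CHAR('k) ^ c) \<Longrightarrow> x powi n \<in> mu (CHAR('k) ^ c)"
  for x :: "'k::field_prime_char witt fract"
  by (auto simp: power_int_def mu_inverse mu_power simp flip: power_inverse)

lemma mu_prod:
  fixes g :: "'i \<Rightarrow> 'k::field_prime_char witt fract"
  shows "(\<And>i. i \<in> X \<Longrightarrow> g i \<in> mu (CHAR('k) ^ c)) \<Longrightarrow> prod g X \<in> mu (CHAR('k) ^ c)"
  by (induction X rule: infinite_finite_induct) (auto simp: mu_1 mu_mult)

definition mu_vec :: "nat \<Rightarrow> ('k::field_prime_char witt fract ^ 'n) set"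
  where "mu_vec r = {x. \<forall>i. x $ i \<in> mu r}"

lemma mu_monom_val: "c \<ge> 1 \<Longrightarrow> x \<in> mu_vec (CHAR('k) ^ c) \<Longrightarrow> monom_val x u \<in> mu (CHAR('k) ^ c)"
  for x :: "'k::field_prime_char witt fract ^ 'n"
  unfolding monom_val_def mu_vec_def by (intro mu_prod mu_powi) auto

lemma nat_minus_1_dvd_power_minus_1:
  assumes "x \<ge> 1"
  shows "x - 1 dvd x ^ n - (1::nat)"
proof -
  have "int x - 1 dvd int x ^ n - 1" by (simp add: power_diff_1_eq)
  then have "int (x - 1) dvd int (x ^ n - 1)" using assms by (simp add: of_nat_diff)
  then show ?thesis by (simp only: int_dvd_int_iff)
qed

lemma mu_mono: "c \<ge> 1 \<Longrightarrow> n \<ge> 1 \<Longrightarrow> mu (CHAR('k) ^ c) \<subseteq> (mu (CHAR('k) ^ (c * n)) :: 'k::field_prime_char witt fract set)"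
proof
  fix x :: "'k witt fract" assume c: "c \<ge> 1" and n: "n \<ge> 1" and x: "x \<in> mu (CHAR('k) ^ c)"
  have "CHAR('k) ^ c - 1 dvd (CHAR('k) ^ c) ^ n - 1"
    using CHAR_power_gt_1[OF c, where 'k = 'k] by (intro nat_minus_1_dvd_power_minus_1) simp
  then show "x \<in> mu (CHAR('k) ^ (c * n))"
    using x W_ring_mono[OF c, of n] by (auto simp: mu_def power_mult elim!: dvdE)
qed

lemma W_frob_mu:
  fixes x :: "'k::{alg_closed_field,field_prime_char} witt fract"
  assumes "c \<ge> 1" "x \<in> mu (CHAR('k) ^ c)"
  shows "W_frob e x = x ^ (CHAR('k) ^ e)"
proof -
  have pw: "to_fract (w ^ n) = to_fract w ^ n" for w :: "'k witt" and n
    by (induction n) auto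
  show ?thesis
    using assms(2) unfolding mu_eq_teich(1)[OF assms(1)]
    by (auto simp: W_frob_to_fract witt_frob_pow_teich pw)
qed

lemma W_frob_twist_aut:
  fixes \<tau> :: "'k::field_prime_char witt fract \<Rightarrow> 'k witt fract"
  assumes c: "c \<ge> 1" and e: "e \<le> c" and t: "\<tau> \<in> W_aut (CHAR('k) ^ c)"
  shows "restrict (\<tau> \<circ> W_frob e) (W_ring (CHAR('k) ^ c)) \<in> W_aut (CHAR('k) ^ c)"
proof -
  let ?W = "W_ring (CHAR('k) ^ c) :: 'k witt fract set"
  note cl = W_ring_closed[where c = c] W_frob_closed[where c = c]
  have bij: "bij_betw (W_frob e) ?W ?W"
  proof (rule bij_betw_byWitness[where f' = "W_frob (c - e)"])
    show "\<forall>x\<in>?W. W_frob (c - e) (W_frob e x) = x" "\<forall>x\<in>?W. W_frob e (W_frob (c - e) x) = x"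
      by (simp_all add: cl e)
    show "W_frob e ` ?W \<subseteq> ?W" "W_frob (c - e) ` ?W \<subseteq> ?W" using cl(5) by auto
  qed
  from t have t': "bij_betw \<tau> ?W ?W" "\<And>x y. x \<in> ?W \<Longrightarrow> y \<in> ?W \<Longrightarrow> \<tau> (x + y) = \<tau> x + \<tau> y \<and> \<tau> (x * y) = \<tau> x * \<tau> y"
    "\<And>x. x \<in> W_ring CHAR('k) \<Longrightarrow> \<tau> x = x" by (auto simp: W_aut_def)
  have Wp: "W_frob e x = x" "x \<in> ?W" if x: "x \<in> W_ring CHAR('k)" for x :: "'k witt fract"
  proof -
    have "x \<in> W_ring (CHAR('k) ^ 1)" using x by simp
    then obtain w where w: "x = to_fract w" "witt_frob w = w" unfolding W_ring_eq by auto
    have "(witt_frob ^^ e) w = w" for e by (induction e) (auto simp: w(2))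
    then show "W_frob e x = x" "x \<in> ?W" unfolding W_ring_eq by (auto simp: w(1) W_frob_to_fract)
  qed
  have "bij_betw (restrict (\<tau> \<circ> W_frob e) ?W) ?W ?W"
    using bij_betw_trans[OF bij t'(1)] by (subst bij_betw_restrict_eq) 
  then show ?thesis
    unfolding W_aut_def using t'(2,3) cl Wp by (auto simp: cl)
qed

text \<open>
  Composition with the Frobenius permutes the automorphisms over which the trace is summed. Since
  automorphisms are extensional functions, the composite has to be restricted again.
\<close>
lemma W_trace_frob:
  fixes x :: "'k::field_prime_char witt fract"
  assumes c: "c \<ge> 1" and e: "e \<le> c" and x: "x \<in> W_ring (CHAR('k) ^ c)"
  shows "W_trace (CHAR('k) ^ c) (W_frob e x) = W_trace (CHAR('k) ^ c) x"
proof -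
  let ?W = "W_ring (CHAR('k) ^ c) :: 'k witt fract set"
  let ?\<Phi> = "\<lambda>e \<tau>. restrict (\<tau> \<circ> W_frob e) ?W"
  have inv: "?\<Phi> e' (?\<Phi> e \<tau>) = \<tau>" if "e' + e = c" "\<tau> \<in> W_aut (CHAR('k) ^ c)" for e e' \<tau>
  proof
    fix y show "?\<Phi> e' (?\<Phi> e \<tau>) y = \<tau> y"
      using that W_frob_closed[of y c] 
      by (cases "y \<in> ?W") (auto simp: W_aut_def extensional_def add.commute)
  qed
  show ?thesis
    unfolding W_trace_def
    using x W_frob_closed(1)[OF x, of e] e inv[of e "c - e"] inv[of "c - e" e] W_frob_twist_aut[OF c]
    by (intro sum.reindex_bij_witness[of _ "?\<Phi> (c - e)" "?\<Phi> e"]) auto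
qed

lemma W_trace_sum:
  fixes g :: "'i \<Rightarrow> 'k::field_prime_char witt fract"
  assumes "\<And>i. i \<in> X \<Longrightarrow> g i \<in> W_ring (CHAR('k) ^ c)"
  shows "W_trace (CHAR('k) ^ c) (sum g X) = (\<Sum>i\<in>X. W_trace (CHAR('k) ^ c) (g i))"
proof -
  have "\<tau> (sum g X) = (\<Sum>i\<in>X. \<tau> (g i))" if t: "\<tau> \<in> W_aut (CHAR('k) ^ c)" for \<tau>
  proof -
    have add: "\<tau> (x + y) = \<tau> x + \<tau> y" if "x \<in> W_ring (CHAR('k) ^ c)" "y \<in> W_ring (CHAR('k) ^ c)" for x y
      using t that by (simp add: W_aut_def)
    have 0: "\<tau> 0 = 0" using add[OF W_ring_0 W_ring_0] by simp
    show ?thesis using assms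
      by (induction X rule: infinite_finite_induct) (auto simp: 0 add W_ring_sum)
  qed
  then have "W_trace (CHAR('k) ^ c) (sum g X) = (\<Sum>\<tau>\<in>W_aut (CHAR('k) ^ c). \<Sum>i\<in>X. \<tau> (g i))"
    unfolding W_trace_def by (intro sum.cong) auto
  also have "\<dots> = (\<Sum>i\<in>X. W_trace (CHAR('k) ^ c) (g i))"
    unfolding W_trace_def by (rule sum.swap)
  finally show ?thesis .
qed

section \<open>Invariance of exponential sums under the Frobenius\<close>

lemma laurent_eval_W_ring:
  fixes h :: "(int ^ 'n) \<Rightarrow>\<^sub>0 'k::field_prime_char witt fract"
  assumes "c \<ge> 1" "\<And>u. u \<in> Poly_Mapping.keys h \<Longrightarrow> Poly_Mapping.lookup h u \<in> mu (CHAR('k) ^ c)"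
    and "x \<in> mu_vec (CHAR('k) ^ c)"
  shows "laurent_eval h x \<in> W_ring (CHAR('k) ^ c)"
  unfolding laurent_eval_def using assms
  by (intro W_ring_sum W_ring_closed mu_W_ring mu_monom_val) auto

lemma power_int_power_nat: "((x::'a::field) ^ n) powi m = (x powi m) ^ n"
  by (simp add: power_int_power power_int_power' mult.commute)

lemma monom_val_power: 
  fixes x :: "'a::field ^ 'n"
  shows "monom_val (\<chi> i. x $ i ^ n) u = monom_val x u ^ n"
  by (simp add: monom_val_def power_int_power_nat prod_power_distrib)

lemma power_int_cong_mod:
  fixes x :: "'a::field"
  assumes "x ^ N = 1" "N \<ge> 1" "int N dvd s - t"
  shows "x powi s = x powi t"
proof -
  have "x \<noteq> 0" using assms by (auto simp: zero_power)
  obtain l where "s = t + int N * l" using assms(3) by (metis add.commute diff_add_cancel dvdE)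
  then show ?thesis using \<open>x \<noteq> 0\<close> assms(1) by (simp add: power_int_add power_int_mult)
qed

lemma monom_val_cong:
  fixes x :: "'k::field_prime_char witt fract ^ 'n" and u u' :: "int ^ 'n"
  assumes "r > 1" "x \<in> mu_vec r" "\<And>i. int (r - 1) dvd u $ i - u' $ i"
  shows "monom_val x u = monom_val x u'"
  unfolding monom_val_def
  using assms by (intro prod.cong refl power_int_cong_mod[of _ "r - 1"] mu_power_eq_1) (auto simp: mu_vec_def)

lemma expsum_cong:
  fixes h :: "(int ^ 'n::finite) \<Rightarrow>\<^sub>0 'k::field_prime_char witt fract" and e e' :: "int ^ 'n"
  assumes "r > 1" "\<And>i. int (r - 1) dvd e $ i - e' $ i"
  shows "expsum h r e = expsum h r e'"
proof -
  have dvd: "int (r - 1) dvd (- e) $ i - (- e') $ i" for i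
  proof -
    have "(- e) $ i - (- e') $ i = - (e $ i - e' $ i)" by simp
    then show ?thesis using assms(2)[of i] by (simp only: dvd_minus_iff)
  qed
  have "monom_val x (- e) = monom_val x (- e')" if "\<forall>i. x $ i \<in> mu r" for x :: "'k witt fract ^ 'n"
    using that by (intro monom_val_cong[OF assms(1) _ dvd]) (simp add: mu_vec_def)
  then show ?thesis unfolding expsum_def by (intro sum.cong) auto
qed

lemma finite_mu_vec:
  assumes "c \<ge> 1"
  shows "finite (mu_vec (CHAR('k) ^ c) :: ('k::{alg_closed_field,field_prime_char} witt fract ^ 'n::finite) set)"
proof -
  let ?M = "mu (CHAR('k) ^ c) :: 'k witt fract set"
  have "mu_vec (CHAR('k) ^ c) \<subseteq> vec_lambda ` ((UNIV :: 'n set) \<rightarrow>\<^sub>E ?M)"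
  proof
    fix x :: "'k witt fract ^ 'n" assume "x \<in> mu_vec (CHAR('k) ^ c)"
    then show "x \<in> vec_lambda ` (UNIV \<rightarrow>\<^sub>E ?M)"
      by (intro image_eqI[of _ _ "vec_nth x"]) (auto simp: mu_vec_def)
  qed
  moreover have "finite (vec_lambda ` ((UNIV :: 'n set) \<rightarrow>\<^sub>E ?M))"
    using mu_eq_teich(3)[OF assms] by (intro finite_imageI finite_PiE) auto
  ultimately show ?thesis by (rule finite_subset)
qed

lemma mu_power_self:
  assumes "r > 1" "x \<in> mu r"
  shows "x ^ r = x"
proof -
  have "x ^ Suc (r - 1) = x" using mu_power_eq_1[OF assms(2)] by (simp only: power_Suc mult_1_right)
  then show ?thesis using assms(1) by simp
qed

text \<open>
  Multiplying the exponent by $q = p^a$ amounts to the substitution $x \mapsto x^q$. It is a bijection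
  on tuples of roots of unity, it is inverted by a further Frobenius power, and it sends $h(x)$ to
  its conjugate, which has the same trace, because the coefficients of \<open>h\<close> are fixed by
  \<open>W_frob a\<close>.
\<close>
lemma expsum_frob:
  fixes h :: "(int ^ 'n::finite) \<Rightarrow>\<^sub>0 'k::{alg_closed_field,field_prime_char} witt fract"
    and e :: "int ^ 'n"
  assumes a: "a \<ge> 1" and k: "k \<ge> 1"
    and h: "\<And>u. u \<in> Poly_Mapping.keys h \<Longrightarrow> Poly_Mapping.lookup h u \<in> mu (CHAR('k) ^ a)"
  shows "expsum h (CHAR('k) ^ (a * k)) (\<chi> i. int (CHAR('k) ^ a) * e $ i) = expsum h (CHAR('k) ^ (a * k)) e"
proof -
  define q where "q = CHAR('k) ^ a"
  define c where "c = a * k"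
  define r where "r = CHAR('k) ^ c"
  have c: "c \<ge> 1" "a \<le> c" using a k by (auto simp: c_def)
  have q1: "q > 1" unfolding q_def by (rule CHAR_power_gt_1[OF a])
  have hr: "Poly_Mapping.lookup h u \<in> mu r" if "u \<in> Poly_Mapping.keys h" for u
    using h[OF that] mu_mono[OF a k] by (auto simp: r_def c_def)
  let ?X = "mu_vec r :: ('k witt fract ^ 'n) set"
  have X: "?X = {x. \<forall>i. x $ i \<in> mu r}" by (simp add: mu_vec_def)
  define Q :: "'k witt fract ^ 'n \<Rightarrow> 'k witt fract ^ 'n" where "Q x = (\<chi> i. x $ i ^ q)" for x
  have fin: "finite ?X" unfolding r_def by (rule finite_mu_vec[OF c(1)])
  have sub: "Q ` ?X \<subseteq> ?X" by (auto simp: mu_vec_def Q_def r_def mu_power)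
  have inj: "inj_on Q ?X"
  proof (rule inj_onI)
    fix x y assume xy: "x \<in> ?X" "y \<in> ?X" "Q x = Q y"
    have "x $ i = y $ i" for i
    proof -
      have m: "x $ i \<in> mu r" "y $ i \<in> mu r" using xy by (auto simp: mu_vec_def)
      have "x $ i ^ q = y $ i ^ q" using xy(3) by (simp add: Q_def vec_eq_iff)
      then have eq: "W_frob a (x $ i) = W_frob a (y $ i)"
        using m W_frob_mu[OF c(1), of "x $ i" a] W_frob_mu[OF c(1), of "y $ i" a]
        by (simp add: r_def q_def)
      have unfrob: "W_frob (c - a) (W_frob a z) = z" if "z \<in> mu r" for z :: "'k witt fract"
      proof -
        have z: "z \<in> W_ring (CHAR('k) ^ c)" using mu_W_ring[OF that] by (simp add: r_def)
        have "W_frob (c - a) (W_frob a z) = W_frob (c - a + a) z" by (rule W_frob_closed(3)[OF z])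
        also have "c - a + a = c" using c by simp
        also have "W_frob c z = z" by (rule W_frob_closed(2)[OF z])
        finally show ?thesis .
      qed
      show ?thesis using unfrob[OF m(1)] unfrob[OF m(2)] eq by metis
    qed
    then show "x = y" by (simp add: vec_eq_iff)
  qed
  have bij: "bij_betw Q ?X ?X"
    using inj sub fin by (simp add: bij_betw_def endo_inj_surj)
  have ev: "laurent_eval h (Q x) = W_frob a (laurent_eval h x)" if x: "x \<in> ?X" for x
  proof -
    have t: "Poly_Mapping.lookup h u * monom_val x u \<in> W_ring r"
      "W_frob a (Poly_Mapping.lookup h u * monom_val x u) = Poly_Mapping.lookup h u * monom_val (Q x) u"
      if u: "u \<in> Poly_Mapping.keys h" for u
    proof -
      have m: "Poly_Mapping.lookup h u \<in> mu r" "monom_val x u \<in> mu r"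
        using hr[OF u] mu_monom_val[OF c(1)] x by (auto simp: r_def)
      then have W: "Poly_Mapping.lookup h u \<in> W_ring r" "monom_val x u \<in> W_ring r" by (auto simp: mu_W_ring)
      then show "Poly_Mapping.lookup h u * monom_val x u \<in> W_ring r" by (simp add: r_def W_ring_closed)
      have "W_frob a (Poly_Mapping.lookup h u * monom_val x u) = Poly_Mapping.lookup h u ^ q * monom_val x u ^ q"
        using W m by (simp add: r_def q_def W_ring_closed(4)[where c = c] W_frob_mu[OF c(1)])
      also have "Poly_Mapping.lookup h u ^ q = Poly_Mapping.lookup h u"
        using h[OF u] q1 unfolding q_def by (intro mu_power_self)
      also have "monom_val x u ^ q = monom_val (Q x) u"
        by (simp add: Q_def monom_val_power)
      finally show "W_frob a (Poly_Mapping.lookup h u * monom_val x u) = Poly_Mapping.lookup h u * monom_val (Q x) u" .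
    qed
    show ?thesis unfolding laurent_eval_def
      using t by (simp add: r_def W_ring_sum(2)[where c = c])
  qed
  have "expsum h r e = (\<Sum>x\<in>?X. fps_const (monom_val x (- e)) * fps_binomial (W_trace r (laurent_eval h x)))"
    by (simp add: expsum_def X)
  also have "\<dots> = (\<Sum>x\<in>?X. fps_const (monom_val (Q x) (- e)) * fps_binomial (W_trace r (laurent_eval h (Q x))))"
    by (rule sum.reindex_bij_betw[OF bij, symmetric])
  also have "\<dots> = (\<Sum>x\<in>?X. fps_const (monom_val x (- (\<chi> i. int q * e $ i))) * fps_binomial (W_trace r (laurent_eval h x)))"
  proof (rule sum.cong)
    fix x assume x: "x \<in> ?X"
    have "monom_val (Q x) (- e) = monom_val x (- (\<chi> i. int q * e $ i))"
      unfolding monom_val_def Q_def by (auto simp: power_int_mult simp flip: mult_minus_right)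
    moreover have "W_trace r (laurent_eval h (Q x)) = W_trace r (laurent_eval h x)"
      unfolding ev[OF x] unfolding r_def
      by (rule W_trace_frob[OF c(1,2) laurent_eval_W_ring[OF c(1)]]) (use hr x in \<open>auto simp: r_def\<close>)
    ultimately show "fps_const (monom_val (Q x) (- e)) * fps_binomial (W_trace r (laurent_eval h (Q x))) =
       fps_const (monom_val x (- (\<chi> i. int q * e $ i))) * fps_binomial (W_trace r (laurent_eval h x))" by simp
  qed simp
  also have "\<dots> = expsum h r (\<chi> i. int q * e $ i)"
    by (simp add: expsum_def X)
  finally show ?thesis by (simp add: r_def q_def c_def)
qed

section \<open>Orthogonality and the exponential sum of a diagonal base change\<close>

lemma vec_box_bij:
  "bij_betw vec_lambda (UNIV \<rightarrow>\<^sub>E S) {x :: 's ^ 'n. \<forall>i. x $ i \<in> S}"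
  by (rule bij_betw_byWitness[where f' = vec_nth]) auto

lemma finite_vec_box:
  assumes "finite S"
  shows "finite {x :: 's ^ 'n::finite. \<forall>i. x $ i \<in> S}"
proof -
  have "finite ((UNIV :: 'n set) \<rightarrow>\<^sub>E S)" using assms by (intro finite_PiE) auto
  then show ?thesis using bij_betw_finite[OF vec_box_bij[where 'n = 'n], of S] by blast
qed

lemma sum_prod_vec_box:
  fixes f :: "'n::finite \<Rightarrow> 's \<Rightarrow> 'a::comm_semiring_1"
  assumes "finite S"
  shows "(\<Sum>x\<in>{x :: 's ^ 'n. \<forall>i. x $ i \<in> S}. \<Prod>i\<in>UNIV. f i (x $ i)) = (\<Prod>i\<in>UNIV. \<Sum>s\<in>S. f i s)"
proof -
  have "(\<Prod>i\<in>UNIV. \<Sum>s\<in>S. f i s) = (\<Sum>g\<in>UNIV \<rightarrow>\<^sub>E S. \<Prod>i\<in>UNIV. f i (g i))"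
    using assms by (intro prod_sum_PiE) auto
  also have "\<dots> = (\<Sum>g\<in>UNIV \<rightarrow>\<^sub>E S. \<Prod>i\<in>UNIV. f i (vec_lambda g $ i))"
    by simp
  also have "\<dots> = (\<Sum>x\<in>{x :: 's ^ 'n. \<forall>i. x $ i \<in> S}. \<Prod>i\<in>UNIV. f i (x $ i))"
    by (rule sum.reindex_bij_betw[OF vec_box_bij])
  finally show ?thesis by simp
qed

lemma sum_powi_geometric:
  fixes x :: "'a::field"
  assumes "x ^ N = 1"
  shows "(\<Sum>t\<in>{0..<int N}. x powi t) = (if x = 1 then of_nat N else 0)"
proof -
  have "(\<Sum>t\<in>{0..<int N}. x powi t) = (\<Sum>i<N. x ^ i)"
    by (rule sum.reindex_bij_witness[of _ int nat]) (auto simp: power_int_def)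
  also have "(x - 1) * (\<Sum>i<N. x ^ i) = 0"
    using assms power_diff_1_eq[of x N] by simp
  then have "(\<Sum>i<N. x ^ i) = (if x = 1 then of_nat N else 0)" by auto
  finally show ?thesis .
qed

text \<open>
  Orthogonality over the roots of unity. If $N = r - 1$ does not divide \<open>e\<close>, then some $x_0$ has
  $x_0^e \neq 1$, as otherwise $X^{e \bmod N} - 1$ would have \<open>N\<close> roots; translation by $x_0$ then
  shows that the sum vanishes.
\<close>
lemma sum_mu_powi:
  fixes e :: int
  assumes c: "c \<ge> 1"
  defines "r \<equiv> CHAR('k::{alg_closed_field,field_prime_char}) ^ c"
  shows "(\<Sum>x\<in>mu r. x powi e :: 'k witt fract) = (if int (r - 1) dvd e then of_nat (r - 1) else 0)"
proof -
  let ?M = "mu r :: 'k witt fract set"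
  have r: "r > 1" unfolding r_def by (rule CHAR_power_gt_1[OF c])
  define N where "N = r - 1"
  have N: "N > 0" using r by (simp add: N_def)
  have card: "card ?M = N" and fin: "finite ?M"
    using mu_eq_teich(2,3)[OF c, where 'k = 'k] by (simp_all add: r_def N_def)
  have pw: "x powi e = x powi (e mod int N)" if "x \<in> ?M" for x
    by (rule power_int_cong_mod[OF mu_power_eq_1[OF that, folded N_def]]) (use N in \<open>auto simp: minus_mod_eq_mult_div\<close>)
  have "(\<Sum>x\<in>?M. x powi e) = (if int N dvd e then of_nat N else 0)"
  proof (cases "int N dvd e")
    case True
    then have "x powi e = 1" if "x \<in> ?M" for x using pw[OF that] by simp
    then show ?thesis using True card by simp
  next
    case False
    define t where "t = nat (e mod int N)"
    have t: "t \<ge> 1" "t < N" "int t = e mod int N"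
    proof -
      have "0 \<le> e mod int N" "e mod int N < int N" using N by auto
      moreover have "e mod int N \<noteq> 0" using False by (simp add: dvd_eq_mod_eq_0)
      ultimately show "t \<ge> 1" "t < N" "int t = e mod int N" by (auto simp: t_def)
    qed
    have "\<exists>x0\<in>?M. x0 powi e \<noteq> 1"
    proof (rule ccontr)
      assume H: "\<not> (\<exists>x0\<in>?M. x0 powi e \<noteq> 1)"
      define P :: "'k witt fract poly" where "P = monom 1 t - 1"
      have deg: "degree P = t"
        unfolding P_def diff_conv_add_uminus using t by (subst degree_add_eq_left) (auto simp: degree_monom_eq)
      have P0: "P \<noteq> 0" using deg t by auto
      have "x ^ t = 1" if "x \<in> ?M" for x
        using H pw[OF that] that unfolding t(3)[symmetric] by simp
      then have "?M \<subseteq> {x. poly P x = 0}" by (auto simp: P_def poly_monom)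
      then have "N \<le> t"
        using card_mono[OF poly_roots_finite[OF P0], of ?M] card_poly_roots_bound[OF P0] deg card by simp
      with t show False by simp
    qed
    then obtain x0 where x0: "x0 \<in> ?M" "x0 powi e \<noteq> 1" by blast
    have "inj_on ((*) x0) ?M" using mu_nonzero[OF r x0(1)] by (auto simp: inj_on_def)
    moreover have "(*) x0 ` ?M \<subseteq> ?M" using x0(1) by (auto simp: r_def mu_mult)
    ultimately have bij: "bij_betw ((*) x0) ?M ?M" using fin by (simp add: bij_betw_def endo_inj_surj)
    have "(\<Sum>x\<in>?M. x powi e) = (\<Sum>x\<in>?M. (x0 * x) powi e)"
      by (rule sum.reindex_bij_betw[OF bij, symmetric])
    also have "\<dots> = x0 powi e * (\<Sum>x\<in>?M. x powi e)"
      by (simp add: power_int_mult_distrib sum_distrib_left)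
    finally have "(x0 powi e - 1) * (\<Sum>x\<in>?M. x powi e) = 0" by (simp add: algebra_simps)
    then show ?thesis using x0(2) False by simp
  qed
  then show ?thesis by (simp only: N_def)
qed

definition row_monoms :: "'a::field ^ ('n \<times> 'm) \<Rightarrow> int ^ 'm \<Rightarrow> 'a ^ 'n"
  where "row_monoms z w = (\<chi> i. \<Prod>l\<in>UNIV. z $ (i, l) powi (w $ l))"

lemma power_int_prod: "(\<Prod>i\<in>A. f i) powi n = (\<Prod>i\<in>A. f i powi n)" for f :: "'i \<Rightarrow> 'a::field"
  by (induction A rule: infinite_finite_induct) (auto simp: power_int_mult_distrib)

lemma prod_UNIV_pair: "(\<Prod>ij\<in>(UNIV :: ('n::finite \<times> 'm::finite) set). F ij) = (\<Prod>i\<in>UNIV. \<Prod>l\<in>UNIV. F (i, l))"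
  by (simp add: prod.cartesian_product)

lemma monom_val_tensor_vec:
  "monom_val z (tensor_vec u w) = monom_val (row_monoms z w) u"
  by (simp add: monom_val_def row_monoms_def tensor_vec_def prod_UNIV_pair power_int_prod power_int_mult mult.commute[of "u $ _"])

lemma monom_val_mult: "monom_val (\<chi> i. x $ i * y $ i) u = monom_val x u * monom_val y u"
  for x y :: "'a::field ^ 'n"
  by (simp add: monom_val_def power_int_mult_distrib prod.distrib)

lemma laurent_eval_0: "laurent_eval 0 x = 0"
  by (simp add: laurent_eval_def)

lemma laurent_eval_add: "laurent_eval (h + h') x = laurent_eval h x + laurent_eval h' x"
  unfolding laurent_eval_def by (rule setsum_keys_plus_distrib) (auto simp: algebra_simps)

lemma laurent_eval_sum: "laurent_eval (sum F A) x = (\<Sum>i\<in>A. laurent_eval (F i) x)"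
  by (induction A rule: infinite_finite_induct) (auto simp: laurent_eval_0 laurent_eval_add)

lemma laurent_eval_single: "laurent_eval (Poly_Mapping.single u c) x = c * monom_val x u"
  by (cases "c = 0") (auto simp: laurent_eval_def)

text \<open>
  Injectivity of \<open>v\<close> and $b_j \neq 0$ ensure that the terms of \<open>g\<close> neither merge nor disappear; the
  rest is $z^{u \otimes w} = (z^w)^u$.
\<close>
lemma laurent_eval_diag_base_change:
  fixes f :: "(int ^ 'n::finite) \<Rightarrow>\<^sub>0 'a::field" and v :: "'m::finite \<Rightarrow> int ^ 'm" and z :: "'a ^ ('n \<times> 'm)"
  assumes "inj v" "\<And>j. b j \<noteq> 0"
  shows "laurent_eval (diag_base_change f (\<Sum>j\<in>UNIV. Poly_Mapping.single (v j) (b j))) z =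
    (\<Sum>j\<in>UNIV. laurent_eval f (\<chi> i. b j $ i * row_monoms z (v j) $ i))"
proof -
  define g where "g = (\<Sum>j\<in>UNIV. Poly_Mapping.single (v j) (b j))"
  have lk: "Poly_Mapping.lookup g (v j) = b j" for j
  proof -
    have "Poly_Mapping.lookup g (v j) = (\<Sum>j'\<in>UNIV. if j' = j then b j' else 0)"
      unfolding g_def lookup_sum lookup_single using assms(1)
      by (intro sum.cong) (auto simp: when_def inj_eq)
    then show ?thesis by simp
  qed
  have "w \<in> range v" if "Poly_Mapping.lookup g w \<noteq> 0" for w
  proof (rule ccontr)
    assume "w \<notin> range v"
    then have "Poly_Mapping.lookup g w = 0"
      unfolding g_def lookup_sum lookup_single by (intro sum.neutral) (auto simp: when_def)
    with that show False by simp
  qed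
  then have keys: "Poly_Mapping.keys g = range v"
    using assms(2) lk by (auto simp: in_keys_iff)
  have "laurent_eval (diag_base_change f g) z =
      (\<Sum>u\<in>Poly_Mapping.keys f. \<Sum>j\<in>UNIV. Poly_Mapping.lookup f u * monom_val (b j) u * monom_val z (tensor_vec u (v j)))"
    unfolding diag_base_change_def keys sum.reindex[OF assms(1)]
    by (simp add: laurent_eval_sum laurent_eval_single lk)
  also have "\<dots> = (\<Sum>j\<in>UNIV. \<Sum>u\<in>Poly_Mapping.keys f. Poly_Mapping.lookup f u * monom_val (b j) u * monom_val z (tensor_vec u (v j)))"
    by (rule sum.swap)
  also have "\<dots> = (\<Sum>j\<in>UNIV. laurent_eval f (\<chi> i. b j $ i * row_monoms z (v j) $ i))"
    by (simp add: laurent_eval_def monom_val_mult monom_val_tensor_vec mult.assoc)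
  finally show ?thesis by (simp add: g_def)
qed

lemma fps_binomial_sum: "fps_binomial (sum F A) = (\<Prod>i\<in>A. fps_binomial (F i))"
  for F :: "'i \<Rightarrow> 'a::field_char_0"
proof -
  have "fps_binomial (0::'a) = 1"
    by (simp add: fps_eq_iff fps_binomial_def gbinomial_0_left)
  then show ?thesis
    by (induction A rule: infinite_finite_induct) (auto simp: fps_binomial_add_mult)
qed

lemma fps_const_prod: "fps_const (\<Prod>i\<in>A. F i) = (\<Prod>i\<in>A. fps_const (F i))" for F :: "'i \<Rightarrow> 'a::comm_ring_1"
  by (induction A rule: infinite_finite_induct) (auto simp flip: fps_const_mult)

lemma fps_const_sum: "fps_const (\<Sum>i\<in>A. F i) = (\<Sum>i\<in>A. fps_const (F i))" for F :: "'i \<Rightarrow> 'a::comm_ring_1"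
  by (induction A rule: infinite_finite_induct) (auto simp flip: fps_const_add)

lemma prod_if_all:
  "finite A \<Longrightarrow> (\<Prod>i\<in>A. if P i then c else 0) = (if \<forall>i\<in>A. P i then c ^ card A else (0 :: 'a::comm_semiring_1))"
  by (induction A rule: finite_induct) auto

lemma monom_val_diff:
  assumes "\<And>i. z $ i \<noteq> 0"
  shows "monom_val z (u - w) = monom_val z u * monom_val z (- w)"
proof -
  have "z $ i powi (u $ i - w $ i) = z $ i powi (u $ i) * z $ i powi (- (w $ i))" for i
    using power_int_add[of "z $ i" "u $ i" "- (w $ i)"] assms[of i] by simp
  then show ?thesis unfolding monom_val_def by (simp add: prod.distrib)
qed

lemma monom_val_sum:
  assumes "\<And>i. z $ i \<noteq> 0"
  shows "monom_val z (\<Sum>j\<in>J. w j) = (\<Prod>j\<in>J. monom_val z (w j))"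
proof (induction J rule: infinite_finite_induct)
  case (insert j J)
  have "monom_val z (u + w) = monom_val z u * monom_val z w" for u w
    using assms by (simp add: monom_val_def power_int_add prod.distrib)
  with insert show ?case by simp
qed (auto simp: monom_val_def)

lemma sum_mu_vec_monom_val:
  fixes w :: "int ^ 'i::finite"
  assumes c: "c \<ge> 1"
  defines "r \<equiv> CHAR('k::{alg_closed_field,field_prime_char}) ^ c"
  shows "(\<Sum>z\<in>mu_vec r. monom_val z w :: 'k witt fract) =
    (if \<forall>i. int (r - 1) dvd w $ i then of_nat (r - 1) ^ CARD('i) else 0)"
proof -
  have fin: "finite (mu r :: 'k witt fract set)" using mu_eq_teich(3)[OF c] by (simp add: r_def)
  have "(\<Sum>z\<in>mu_vec r. monom_val z w :: 'k witt fract) = (\<Prod>i\<in>UNIV. \<Sum>x\<in>mu r. x powi (w $ i))"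
    unfolding mu_vec_def monom_val_def by (rule sum_prod_vec_box[OF fin])
  also have "\<dots> = (\<Prod>i\<in>UNIV. if int (r - 1) dvd w $ i then of_nat (r - 1) else 0)"
    unfolding r_def by (intro prod.cong refl sum_mu_powi[OF c])
  finally show ?thesis by (simp add: prod_if_all)
qed

lemma sum_box_powers:
  fixes t :: "'m::finite \<Rightarrow> 'n::finite \<Rightarrow> 'a::field"
  assumes "\<And>j i. t j i ^ N = 1"
  shows "(\<Sum>e\<in>{e :: int ^ 'n ^ 'm. \<forall>j i. e $ j $ i \<in> {0..<int N}}. \<Prod>j\<in>UNIV. \<Prod>i\<in>UNIV. t j i powi (e $ j $ i)) =
    (if \<forall>j i. t j i = 1 then of_nat N ^ CARD('n \<times> 'm) else 0)"
proof -
  let ?B = "{e :: int ^ 'n. \<forall>i. e $ i \<in> {0..<int N}}"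
  have B: "finite ?B" by (rule finite_vec_box) simp
  have "(\<Sum>e\<in>{e :: int ^ 'n ^ 'm. \<forall>j. e $ j \<in> ?B}. \<Prod>j\<in>UNIV. \<Prod>i\<in>UNIV. t j i powi (e $ j $ i)) =
     (\<Prod>j\<in>UNIV. \<Sum>e\<in>?B. \<Prod>i\<in>UNIV. t j i powi (e $ i))"
    by (rule sum_prod_vec_box[OF B])
  also have "\<dots> = (\<Prod>j\<in>UNIV. \<Prod>i\<in>UNIV. \<Sum>s\<in>{0..<int N}. t j i powi s)"
    by (intro prod.cong refl sum_prod_vec_box) simp
  also have "\<dots> = (\<Prod>j\<in>UNIV. \<Prod>i\<in>UNIV. if t j i = 1 then of_nat N else 0)"
    using assms by (simp only: sum_powi_geometric)
  also have "\<dots> = (if \<forall>j i. t j i = 1 then of_nat N ^ CARD('n \<times> 'm) else 0)"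
    by (simp add: prod_if_all card_prod power_mult flip: UNIV_Times_UNIV)
  finally show ?thesis by simp
qed

text \<open>
  Writing the congruence condition as $N^{-nm} \sum_z z^{V(e) - d}$ with $N = r - 1$ and
  $V(e) = \sum_j e_j \otimes v_j$, and expanding each $S_f$ as a sum over $y_j$, the right-hand side
  becomes a sum over \<open>z\<close>, \<open>y\<close> and \<open>e\<close>. The sum over \<open>e\<close> is the sum of all
  characters at $b_j z^{v_j} / y_j$, so only $y_j = b_j z^{v_j}$ survives, and what is left is the
  left-hand side.
\<close>
lemma expsum_diag_base_change:
  fixes f :: "(int ^ 'n::finite) \<Rightarrow>\<^sub>0 'k::{alg_closed_field,field_prime_char} witt fract"
    and v :: "'m::finite \<Rightarrow> int ^ 'm" and b :: "'m \<Rightarrow> 'k witt fract ^ 'n" and d :: "int ^ ('n \<times> 'm)"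
  assumes c: "c \<ge> 1" and f: "\<And>u. u \<in> Poly_Mapping.keys f \<Longrightarrow> Poly_Mapping.lookup f u \<in> mu (CHAR('k) ^ c)"
    and v: "inj v" and b: "\<And>j. b j \<in> mu_vec (CHAR('k) ^ c)"
  defines "r \<equiv> CHAR('k) ^ c"
  shows "expsum (diag_base_change f (\<Sum>j\<in>UNIV. Poly_Mapping.single (v j) (b j))) r d =
    (\<Sum>e\<in>{e :: int ^ 'n ^ 'm. (\<forall>j i. e $ j $ i \<in> {0..<int (r - 1)}) \<and>
        (\<forall>ij. int (r - 1) dvd (\<Sum>j\<in>UNIV. tensor_vec (e $ j) (v j)) $ ij - d $ ij)}.
      \<Prod>j\<in>UNIV. fps_const (monom_val (b j) (e $ j)) * expsum f r (e $ j))"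
proof -
  define N where "N = r - 1"
  have r: "r > 1" unfolding r_def by (rule CHAR_power_gt_1[OF c])
  have N: "N > 0" using r by (simp add: N_def)
  let ?h = "diag_base_change f (\<Sum>j\<in>UNIV. Poly_Mapping.single (v j) (b j))"
  define X where "X = (mu_vec r :: ('k witt fract ^ 'n) set)"
  define Z where "Z = (mu_vec r :: ('k witt fract ^ ('n \<times> 'm)) set)"
  define YY where "YY = {y :: 'k witt fract ^ 'n ^ 'm. \<forall>j. y $ j \<in> X}"
  define BB where "BB = {e :: int ^ 'n ^ 'm. \<forall>j i. e $ j $ i \<in> {0..<int N}}"
  define \<psi> where "\<psi> x = fps_binomial (W_trace r (laurent_eval f x))" for x :: "'k witt fract ^ 'n"
  define \<Psi> where "\<Psi> y = (\<Prod>j\<in>UNIV. \<psi> (y $ j))" for y :: "'k witt fract ^ 'n ^ 'm"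
  define V where "V e = (\<Sum>j\<in>UNIV. tensor_vec (e $ j) (v j))" for e :: "int ^ 'n ^ 'm"
  define Y where "Y z = (\<chi> j. \<chi> i. b j $ i * row_monoms z (v j) $ i)" for z :: "'k witt fract ^ ('n \<times> 'm)"
  define K where "K = (of_nat N ^ CARD('n \<times> 'm) :: 'k witt fract)"
  have K0: "K \<noteq> 0" using N by (simp add: K_def)
  have fin: "finite X" "finite Z" unfolding X_def Z_def r_def by (rule finite_mu_vec[OF c])+
  have finYY: "finite YY" unfolding YY_def by (rule finite_vec_box[OF fin(1)])
  have finBB: "finite BB"
  proof -
    have "finite {e :: int ^ 'n. \<forall>i. e $ i \<in> {0..<int N}}" by (rule finite_vec_box) simp
    from finite_vec_box[OF this, where 'n = 'm] show ?thesis by (simp add: BB_def)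
  qed
  have nz: "x \<noteq> 0" if "x \<in> mu r" for x :: "'k witt fract" using mu_nonzero[OF r that] .
  have bX: "b j \<in> X" for j using b by (simp add: X_def r_def)
  have row: "row_monoms z w \<in> X" if "z \<in> Z" for z and w :: "int ^ 'm"
    using that unfolding X_def Z_def r_def mu_vec_def row_monoms_def
    by (auto intro!: mu_prod mu_powi[OF c])
  have YZ: "Y z \<in> YY" if z: "z \<in> Z" for z
    using row[OF z] bX by (auto simp: YY_def Y_def X_def mu_vec_def r_def intro!: mu_mult)
  \<comment> \<open>Orthogonality over \<open>z\<close> detects the congruence condition on \<open>e\<close>.\<close>
  have step1: "(\<Sum>z\<in>Z. monom_val z (V e - d)) = (if \<forall>ij. int N dvd V e $ ij - d $ ij then K else 0)" for e
    using sum_mu_vec_monom_val[OF c, where 'k = 'k, of "V e - d"] unfolding Z_def K_def N_def r_def by simp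
  \<comment> \<open>Orthogonality over \<open>e\<close> forces \<open>y\<close> to be the image of \<open>z\<close>.\<close>
  have step2: "(\<Sum>e\<in>BB. \<Prod>j\<in>UNIV. monom_val (b j) (e $ j) * monom_val (y $ j) (- (e $ j)) * monom_val (row_monoms z (v j)) (e $ j)) =
      (if y = Y z then K else 0)" if y: "y \<in> YY" and z: "z \<in> Z" for y z
  proof -
    define t where "t j i = b j $ i * inverse (y $ j $ i) * row_monoms z (v j) $ i" for j i
    have m: "b j $ i \<in> mu r" "y $ j $ i \<in> mu r" "row_monoms z (v j) $ i \<in> mu r" for j i
      using bX[of j] y row[OF z, of "v j"] by (auto simp: X_def YY_def mu_vec_def)
    have "t j i \<in> mu r" for j i
      using m[of j i] unfolding t_def r_def by (intro mu_mult mu_inverse[OF c]) auto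
    then have t1: "t j i ^ N = 1" for j i using mu_power_eq_1 unfolding N_def by blast
    have teq: "t j i = 1 \<longleftrightarrow> y $ j $ i = Y z $ j $ i" for j i
      using nz[OF m(2)[of j i]] by (auto simp: t_def Y_def field_simps)
    have "monom_val (b j) (e $ j) * monom_val (y $ j) (- (e $ j)) * monom_val (row_monoms z (v j)) (e $ j) =
      (\<Prod>i\<in>UNIV. t j i powi (e $ j $ i))" for e :: "int ^ 'n ^ 'm" and j
      by (simp add: monom_val_def t_def power_int_mult_distrib prod.distrib power_int_minus power_int_inverse)
    then have "(\<Sum>e\<in>BB. \<Prod>j\<in>UNIV. monom_val (b j) (e $ j) * monom_val (y $ j) (- (e $ j)) * monom_val (row_monoms z (v j)) (e $ j)) =
      (\<Sum>e\<in>BB. \<Prod>j\<in>UNIV. \<Prod>i\<in>UNIV. t j i powi (e $ j $ i))" by simp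
    also have "\<dots> = (if \<forall>j i. t j i = 1 then K else 0)"
      unfolding BB_def K_def by (rule sum_box_powers[OF t1])
    also have "(\<forall>j i. t j i = 1) \<longleftrightarrow> y = Y z" by (simp add: teq vec_eq_iff)
    finally show ?thesis .
  qed
  have G: "(\<Prod>j\<in>UNIV. fps_const (monom_val (b j) (e $ j)) * expsum f r (e $ j)) =
      (\<Sum>y\<in>YY. fps_const (\<Prod>j\<in>UNIV. monom_val (b j) (e $ j) * monom_val (y $ j) (- (e $ j))) * \<Psi> y)" for e :: "int ^ 'n ^ 'm"
  proof -
    have "fps_const (monom_val (b j) (e $ j)) * expsum f r (e $ j) =
      (\<Sum>x\<in>X. fps_const (monom_val (b j) (e $ j) * monom_val x (- (e $ j))) * \<psi> x)" for j
      unfolding expsum_def X_def mu_vec_def \<psi>_def by (simp add: sum_distrib_left mult.assoc flip: fps_const_mult)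
    then have "(\<Prod>j\<in>UNIV. fps_const (monom_val (b j) (e $ j)) * expsum f r (e $ j)) =
      (\<Prod>j\<in>UNIV. \<Sum>x\<in>X. fps_const (monom_val (b j) (e $ j) * monom_val x (- (e $ j))) * \<psi> x)" by simp
    also have "\<dots> = (\<Sum>y\<in>YY. \<Prod>j\<in>UNIV. fps_const (monom_val (b j) (e $ j) * monom_val (y $ j) (- (e $ j))) * \<psi> (y $ j))"
      unfolding YY_def by (rule sum_prod_vec_box[OF fin(1), symmetric])
    finally show ?thesis by (simp only: prod.distrib \<Psi>_def fps_const_prod fps_const_mult[symmetric])
  qed
  have mz: "monom_val z (V e - d) = monom_val z (- d) * (\<Prod>j\<in>UNIV. monom_val (row_monoms z (v j)) (e $ j))" if "z \<in> Z" for z e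
  proof -
    have "z $ i \<noteq> 0" for i using that nz[of "z $ i"] by (simp add: Z_def mu_vec_def del: split_paired_All)
    then show ?thesis by (simp add: monom_val_diff V_def monom_val_sum monom_val_tensor_vec)
  qed
  have lhs: "expsum ?h r d = (\<Sum>z\<in>Z. fps_const (monom_val z (- d)) * \<Psi> (Y z))"
  proof -
    have "fps_binomial (W_trace r (laurent_eval ?h z)) = \<Psi> (Y z)" if z: "z \<in> Z" for z
    proof -
      have b0: "b j \<noteq> 0" for j using bX[of j] nz by (auto simp: X_def mu_vec_def vec_eq_iff)
      have "Y z $ j \<in> mu_vec r" for j using YZ[OF z] by (simp add: YY_def X_def)
      then have "W_trace r (\<Sum>j\<in>UNIV. laurent_eval f (Y z $ j)) = (\<Sum>j\<in>UNIV. W_trace r (laurent_eval f (Y z $ j)))"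
        unfolding r_def by (intro W_trace_sum laurent_eval_W_ring[OF c f])
      then have "W_trace r (laurent_eval ?h z) = (\<Sum>j\<in>UNIV. W_trace r (laurent_eval f (Y z $ j)))"
        by (simp add: laurent_eval_diag_base_change[OF v b0] Y_def)
      then show ?thesis by (simp add: fps_binomial_sum \<Psi>_def \<psi>_def)
    qed
    then show ?thesis unfolding expsum_def mu_vec_def[symmetric] Z_def[symmetric] by (intro sum.cong) auto
  qed
  let ?cond = "\<lambda>e. \<forall>ij. int N dvd V e $ ij - d $ ij"
  let ?G = "\<lambda>e. \<Prod>j\<in>UNIV. fps_const (monom_val (b j) (e $ j)) * expsum f r (e $ j)"
  let ?A = "\<lambda>e y. \<Prod>j\<in>UNIV. monom_val (b j) (e $ j) * monom_val (y $ j) (- (e $ j))"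
  let ?R = "\<lambda>z e. \<Prod>j\<in>UNIV. monom_val (row_monoms z (v j)) (e $ j)"
  have "fps_const K * (\<Sum>e\<in>{e\<in>BB. ?cond e}. ?G e) = (\<Sum>e\<in>BB. fps_const (if ?cond e then K else 0) * ?G e)"
    using finBB by (simp add: sum.If_cases sum_distrib_left if_distrib[of fps_const] if_distrib[of "\<lambda>x. x * _"] Int_def cong: if_cong)
  also have "\<dots> = (\<Sum>e\<in>BB. (\<Sum>z\<in>Z. fps_const (monom_val z (V e - d))) * ?G e)"
    by (simp only: step1[symmetric] fps_const_sum)
  also have "\<dots> = (\<Sum>e\<in>BB. \<Sum>z\<in>Z. \<Sum>y\<in>YY. fps_const (monom_val z (- d)) * (fps_const (?A e y * ?R z e) * \<Psi> y))"
    unfolding G sum_product by (intro sum.cong refl) (simp add: mz mult_ac flip: fps_const_mult)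
  also have "\<dots> = (\<Sum>z\<in>Z. \<Sum>e\<in>BB. \<Sum>y\<in>YY. fps_const (monom_val z (- d)) * (fps_const (?A e y * ?R z e) * \<Psi> y))"
    by (rule sum.swap)
  also have "\<dots> = (\<Sum>z\<in>Z. \<Sum>y\<in>YY. \<Sum>e\<in>BB. fps_const (monom_val z (- d)) * (fps_const (?A e y * ?R z e) * \<Psi> y))"
    by (intro sum.cong refl sum.swap)
  also have "\<dots> = (\<Sum>z\<in>Z. \<Sum>y\<in>YY. fps_const (monom_val z (- d)) * (fps_const (if y = Y z then K else 0) * \<Psi> y))"
  proof (intro sum.cong refl)
    fix z y assume "z \<in> Z" "y \<in> YY"
    show "(\<Sum>e\<in>BB. fps_const (monom_val z (- d)) * (fps_const (?A e y * ?R z e) * \<Psi> y)) =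
       fps_const (monom_val z (- d)) * (fps_const (if y = Y z then K else 0) * \<Psi> y)"
      unfolding step2[OF \<open>y \<in> YY\<close> \<open>z \<in> Z\<close>, symmetric] fps_const_sum sum_distrib_left sum_distrib_right
        prod.distrib[symmetric] ..
  qed
  also have "\<dots> = (\<Sum>z\<in>Z. fps_const (monom_val z (- d)) * (fps_const K * \<Psi> (Y z)))"
  proof (intro sum.cong refl)
    fix z assume z: "z \<in> Z"
    have "(\<Sum>y\<in>YY. fps_const (monom_val z (- d)) * (fps_const (if y = Y z then K else 0) * \<Psi> y)) =
       (\<Sum>y\<in>YY. if y = Y z then fps_const (monom_val z (- d)) * (fps_const K * \<Psi> (Y z)) else 0)"
      by (intro sum.cong) auto
    then show "(\<Sum>y\<in>YY. fps_const (monom_val z (- d)) * (fps_const (if y = Y z then K else 0) * \<Psi> y)) =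
       fps_const (monom_val z (- d)) * (fps_const K * \<Psi> (Y z))"
      using finYY YZ[OF z] by simp
  qed
  also have "\<dots> = fps_const K * expsum ?h r d"
    by (simp add: lhs sum_distrib_left mult_ac)
  finally have "(\<Sum>e\<in>{e\<in>BB. ?cond e}. ?G e) = expsum ?h r d" using K0 by simp
  then show ?thesis by (simp add: BB_def N_def V_def)
qed

section \<open>Orbits of multiplication by q\<close>

lemma Z_locE:
  assumes "x \<in> Z_loc p" "prime p"
  obtains c where "c > 0" "coprime c p" "of_nat c * x \<in> \<int>"
proof -
  obtain a c where ac: "x = of_int a / of_int c" "\<not> int p dvd c" using assms(1) by (auto simp: Z_loc_def)
  then have c0: "c \<noteq> 0" by auto
  have "\<not> p dvd nat \<bar>c\<bar>" using ac(2) by (simp add: int_dvd_int_iff[symmetric])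
  then have "coprime (nat \<bar>c\<bar>) p" using assms(2) by (meson coprime_commute prime_imp_coprime_nat)
  moreover have "of_nat (nat \<bar>c\<bar>) * x = of_int (sgn c * a)"
    using c0 by (auto simp: ac(1) sgn_if abs_if field_simps)
  then have "of_nat (nat \<bar>c\<bar>) * x \<in> \<int>" by simp
  ultimately show ?thesis using c0 that[of "nat \<bar>c\<bar>"] by simp
qed

lemma Z_locI:
  assumes "of_int c * x \<in> \<int>" "\<not> int p dvd c"
  shows "x \<in> Z_loc p"
proof -
  from assms(1) obtain a where "of_int c * x = of_int a" by (rule Ints_cases)
  moreover have "c \<noteq> 0" using assms(2) by auto
  ultimately have "x = of_int a / of_int c" by (simp add: field_simps)
  then show ?thesis using assms(2) unfolding Z_loc_def by blast
qed

lemma Ints_mult_of_nat: "x \<in> \<int> \<Longrightarrow> of_nat n * x \<in> (\<int> :: rat set)"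
  by simp

lemma loc_tuples_common_denominator:
  fixes u :: "rat ^ 'n::finite ^ 'm::finite"
  assumes "u \<in> loc_tuples p" "prime p"
  obtains c where "c > 0" "coprime c p" "\<And>j i. of_nat c * u $ j $ i \<in> \<int>"
proof -
  have "\<exists>c. c > 0 \<and> coprime c p \<and> of_nat c * u $ j $ i \<in> \<int>" for j i
  proof -
    have "u $ j $ i \<in> Z_loc p" using assms(1) by (simp add: loc_tuples_def)
    then obtain c where "c > 0" "coprime c p" "of_nat c * u $ j $ i \<in> \<int>"
      using assms(2) by (rule Z_locE)
    then show ?thesis by blast
  qed
  then obtain c where c: "\<And>j i. c j i > 0 \<and> coprime (c j i) p \<and> of_nat (c j i) * u $ j $ i \<in> \<int>"
    by metis
  define C where "C = (\<Prod>j\<in>UNIV. \<Prod>i\<in>UNIV. c j i)"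
  have "C > 0" using c by (auto simp: C_def intro!: prod_pos)
  moreover have "coprime C p" unfolding C_def using c by (intro prod_coprime_left) auto
  moreover have "of_nat C * u $ j $ i \<in> \<int>" for j i
  proof -
    have "c j i dvd C" unfolding C_def
      by (rule dvd_trans[OF dvd_prodI[of UNIV i "c j"] dvd_prodI[of UNIV j "\<lambda>j. \<Prod>i\<in>UNIV. c j i"]]) auto
    then obtain t where "C = c j i * t" by blast
    then have "of_nat C * u $ j $ i = of_nat t * (of_nat (c j i) * u $ j $ i)" by simp
    then show ?thesis using c[of j i] by (metis Ints_mult_of_nat)
  qed
  ultimately show ?thesis using that by blast
qed

locale q_orbits =
  fixes p q a :: nat
  assumes p: "prime p" and a: "a \<ge> 1" and q: "q = p ^ a"
begin

lemma q_gt_1: "q > 1"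
  unfolding q by (rule one_less_power) (use a prime_gt_1_nat[OF p] in auto)

lemma q_power_ge_1: "q ^ k \<ge> 1"
  using q_gt_1 by simp

lemma q_power_gt_1: "k \<ge> 1 \<Longrightarrow> q ^ k > 1"
  by (rule one_less_power) (use q_gt_1 in auto)

text \<open>
  The class of \<open>u\<close> modulo $\mathbb{Z}^n$ is fixed by multiplication by $q^k$.
\<close>
definition fixed_by :: "nat \<Rightarrow> rat ^ 'n ^ 'm \<Rightarrow> bool"
  where "fixed_by k u \<longleftrightarrow> (\<forall>j i. (of_nat (q ^ k) - 1) * u $ j $ i \<in> \<int>)"

lemma fixed_by_add:
  assumes "fixed_by k u" "fixed_by l u"
  shows "fixed_by (k + l) u"
proof -
  have "(of_nat (q ^ (k + l)) - 1) * x = of_nat (q ^ k) * ((of_nat (q ^ l) - 1) * x) + (of_nat (q ^ k) - 1) * x"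
    for x :: rat by (simp add: power_add algebra_simps)
  with assms show ?thesis unfolding fixed_by_def by (metis Ints_add Ints_mult_of_nat)
qed

lemma fixed_by_diff:
  assumes "fixed_by k u" "fixed_by (k + l) u"
  shows "fixed_by l u"
proof -
  have "(of_nat (q ^ l) - 1) * x = (of_nat (q ^ (k + l)) - 1) * x - of_nat (q ^ l) * ((of_nat (q ^ k) - 1) * x)"
    for x :: rat by (simp add: power_add algebra_simps)
  with assms show ?thesis unfolding fixed_by_def by (metis Ints_diff Ints_mult_of_nat)
qed

lemma fixed_by_mult: "fixed_by k u \<Longrightarrow> fixed_by (k * t) u"
proof (induction t)
  case 0
  show ?case by (simp add: fixed_by_def)
next
  case (Suc t)
  then show ?case using fixed_by_add[of k u "k * t"] by simp
qed

text \<open>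
  The powers of \<open>q\<close> cannot be distinct modulo a common denominator, which is coprime to \<open>q\<close>.
\<close>
lemma ex_fixed_by:
  fixes u :: "rat ^ 'n::finite ^ 'm::finite"
  assumes "u \<in> loc_tuples p"
  shows "\<exists>k\<ge>1. fixed_by k u"
proof -
  obtain c where c: "c > 0" "coprime c p" "\<And>j i. of_nat c * u $ j $ i \<in> \<int>"
    using loc_tuples_common_denominator[OF assms p] by blast
  have "\<not> inj_on (\<lambda>i. q ^ i mod c) {..c}"
  proof (rule pigeonhole)
    have "(\<lambda>i. q ^ i mod c) ` {..c} \<subseteq> {..<c}" using c(1) by auto
    then have "card ((\<lambda>i. q ^ i mod c) ` {..c}) \<le> card {..<c}" by (intro card_mono) auto
    then show "card ((\<lambda>i. q ^ i mod c) ` {..c}) < card {..c}" by simp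
  qed
  then obtain i j where "q ^ i mod c = q ^ j mod c" "i \<noteq> j" by (auto simp: inj_on_def)
  then obtain i j where ij: "q ^ j mod c = q ^ i mod c" "i < j" by (metis nat_neq_iff)
  define k where "k = j - i"
  have k: "k \<ge> 1" "j = i + k" using ij(2) by (auto simp: k_def)
  have "c dvd q ^ j - q ^ i"
    using ij(1) mod_eq_dvd_iff_nat[of "q ^ i" "q ^ j" c] q_gt_1 k by (simp add: power_increasing)
  then have "c dvd q ^ i * (q ^ k - 1)" by (simp add: k(2) power_add right_diff_distrib')
  moreover have "coprime c (q ^ i)" unfolding q using c(2) by simp
  ultimately have "c dvd q ^ k - 1" by (simp add: coprime_dvd_mult_right_iff)
  then obtain t where "q ^ k - 1 = c * t" by blast
  then have "(of_nat (q ^ k) :: rat) - 1 = of_nat c * of_nat t"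
    using q_power_ge_1[of k] by (metis of_nat_1 of_nat_diff of_nat_mult)
  then have "(of_nat (q ^ k) - 1) * u $ j $ i = of_nat t * (of_nat c * u $ j $ i)" for j i
    by (simp add: mult_ac)
  then have "fixed_by k u" unfolding fixed_by_def using c(3) by (metis Ints_mult_of_nat)
  with k(1) show ?thesis by blast
qed

text \<open>
  The exponents \<open>k\<close> with \<open>fixed_by k u\<close> are closed under sums and differences, hence are the multiples of
  the least positive one.
\<close>
lemma orbit_length:
  fixes u :: "rat ^ 'n::finite ^ 'm::finite"
  assumes "u \<in> loc_tuples p"
  shows "orbit_length q u \<ge> 1" "fixed_by k u \<longleftrightarrow> orbit_length q u dvd k"
proof -
  let ?R = "orbit_length q u"
  have R: "?R = (LEAST k. k \<ge> 1 \<and> fixed_by k u)"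
    by (simp add: orbit_length_def fixed_by_def)
  have "?R \<ge> 1 \<and> fixed_by ?R u"
    unfolding R by (rule LeastI_ex) (use ex_fixed_by[OF assms] in blast)
  then have R1: "?R \<ge> 1" "fixed_by ?R u" by auto
  show "?R \<ge> 1" by fact
  show "fixed_by k u \<longleftrightarrow> ?R dvd k"
  proof
    assume k: "fixed_by k u"
    have "fixed_by (k mod ?R) u"
      by (rule fixed_by_diff[OF fixed_by_mult[OF R1(2), of "k div ?R"]]) (use k in simp)
    moreover have "k mod ?R < ?R" using R1(1) by simp
    ultimately have "\<not> k mod ?R \<ge> 1" unfolding R using not_less_Least by blast
    then show "?R dvd k" by (simp add: dvd_eq_mod_eq_0)
  next
    assume "?R dvd k"
    then show "fixed_by k u" using fixed_by_mult[OF R1(2)] by (auto elim!: dvdE)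
  qed
qed

lemma orbit_rel_iff:
  "(u, u') \<in> orbit_rel p q \<longleftrightarrow> u \<in> loc_tuples p \<and> u' \<in> loc_tuples p \<and>
    (\<exists>k. \<forall>j i. u' $ j $ i - of_nat (q ^ k) * u $ j $ i \<in> \<int>)"
  by (simp add: orbit_rel_def)

text \<open>
  Symmetry is the point that needs finite order: with $R$ the orbit length, $q^{Rk - k}$ undoes
  $q^k$.
\<close>
lemma equiv_orbit_rel: "equiv (loc_tuples p) (orbit_rel p q :: (rat ^ 'n::finite ^ 'm::finite) rel)"
proof (rule equivI)
  show "orbit_rel p q \<subseteq> loc_tuples p \<times> (loc_tuples p :: (rat ^ 'n ^ 'm) set)"
    by (auto simp: orbit_rel_iff)
  show "refl_on (loc_tuples p) (orbit_rel p q :: (rat ^ 'n ^ 'm) rel)"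
    by (auto simp: refl_on_def orbit_rel_iff intro!: exI[of _ 0])
  show "sym (orbit_rel p q :: (rat ^ 'n ^ 'm) rel)"
  proof (rule symI)
    fix u u' :: "rat ^ 'n ^ 'm" assume "(u, u') \<in> orbit_rel p q"
    then obtain k where u: "u \<in> loc_tuples p" "u' \<in> loc_tuples p"
      and k: "\<And>j i. u' $ j $ i - of_nat (q ^ k) * u $ j $ i \<in> \<int>" by (auto simp: orbit_rel_iff)
    define R where "R = orbit_length q u"
    have R: "R \<ge> 1" "fixed_by (R * k) u" using orbit_length[OF u(1)] by (auto simp: R_def)
    define e where "e = R * k - k"
    have e: "e + k = R * k" using R(1) by (simp add: e_def)
    have "u $ j $ i - of_nat (q ^ e) * u' $ j $ i \<in> \<int>" for j i
    proof -
      have "u $ j $ i - of_nat (q ^ e) * u' $ j $ i =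
        - ((of_nat (q ^ (e + k)) - 1) * u $ j $ i) - of_nat (q ^ e) * (u' $ j $ i - of_nat (q ^ k) * u $ j $ i)"
        by (simp add: power_add algebra_simps)
      then show ?thesis using k[of j i] R(2) unfolding e fixed_by_def
        by (metis Ints_diff Ints_minus Ints_mult_of_nat)
    qed
    then show "(u', u) \<in> orbit_rel p q" using u by (auto simp: orbit_rel_iff)
  qed
  show "trans (orbit_rel p q :: (rat ^ 'n ^ 'm) rel)"
  proof (rule transI)
    fix u u' u'' :: "rat ^ 'n ^ 'm" assume "(u, u') \<in> orbit_rel p q" "(u', u'') \<in> orbit_rel p q"
    then obtain k l where u: "u \<in> loc_tuples p" "u'' \<in> loc_tuples p"
      and k: "\<And>j i. u' $ j $ i - of_nat (q ^ k) * u $ j $ i \<in> \<int>"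
      and l: "\<And>j i. u'' $ j $ i - of_nat (q ^ l) * u' $ j $ i \<in> \<int>" by (auto simp: orbit_rel_iff)
    have "u'' $ j $ i - of_nat (q ^ (l + k)) * u $ j $ i \<in> \<int>" for j i
    proof -
      have "u'' $ j $ i - of_nat (q ^ (l + k)) * u $ j $ i = 
         (u'' $ j $ i - of_nat (q ^ l) * u' $ j $ i) + of_nat (q ^ l) * (u' $ j $ i - of_nat (q ^ k) * u $ j $ i)"
        by (simp add: power_add algebra_simps)
      then show ?thesis using k[of j i] l[of j i] by (metis Ints_add Ints_mult_of_nat)
    qed
    then show "(u, u'') \<in> orbit_rel p q" using u by (auto simp: orbit_rel_iff)
  qed
qed

definition exp_quot :: "nat \<Rightarrow> int ^ 'n ^ 'm \<Rightarrow> rat ^ 'n ^ 'm"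
  where "exp_quot k e = (\<chi> j i. of_int (e $ j $ i) / (of_nat (q ^ k) - 1))"

lemma q_power_minus_1: "(of_nat (q ^ k - 1) :: 'r::ring_1) = of_nat (q ^ k) - 1"
  using q_power_ge_1[of k] by (simp add: of_nat_diff)

lemma q_power_minus_1_pos: "k \<ge> 1 \<Longrightarrow> (of_nat (q ^ k) :: rat) - 1 > 0"
  using q_power_gt_1[of k] by (metis diff_gt_0_iff_gt of_nat_1 of_nat_less_iff)

lemma not_dvd_q_power_minus_1: "k \<ge> 1 \<Longrightarrow> \<not> int p dvd int (q ^ k - 1)"
proof
  assume k: "k \<ge> 1" and "int p dvd int (q ^ k - 1)"
  then have "p dvd q ^ k - 1" by (simp only: int_dvd_int_iff)
  moreover have "p dvd q ^ k" using k a unfolding q by (auto simp flip: power_mult intro!: dvd_power)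
  ultimately have "p dvd q ^ k - (q ^ k - 1)" using dvd_diff_nat by blast
  then show False using q_power_ge_1[of k] p by simp
qed

lemma exp_quot_fixed:
  assumes "k \<ge> 1"
  shows "exp_quot k e \<in> loc_tuples p" "fixed_by k (exp_quot k e)"
proof -
  have eq: "(of_nat (q ^ k) - 1) * exp_quot k e $ j $ i = of_int (e $ j $ i)" for j i
    using q_power_minus_1_pos[OF assms] by (simp add: exp_quot_def)
  then show "fixed_by k (exp_quot k e)" by (simp add: fixed_by_def del: of_nat_power)
  have "of_int (int (q ^ k - 1)) * exp_quot k e $ j $ i \<in> \<int>" for j i
    using eq[of j i] q_power_minus_1[of k, where 'r = rat] by (simp del: of_nat_power of_nat_diff)
  then show "exp_quot k e \<in> loc_tuples p"
    unfolding loc_tuples_def using Z_locI[OF _ not_dvd_q_power_minus_1[OF assms]] by blast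
qed

lemma orbit_members_fixed:
  fixes u u' :: "rat ^ 'n::finite ^ 'm::finite"
  assumes "(u, u') \<in> orbit_rel p q" "fixed_by k u"
  shows "fixed_by k u'"
proof -
  obtain l where l: "\<And>j i. u' $ j $ i - of_nat (q ^ l) * u $ j $ i \<in> \<int>"
    using assms(1) by (auto simp: orbit_rel_iff)
  have "(of_nat (q ^ k) - 1) * u' $ j $ i = (of_nat (q ^ k) * (u' $ j $ i - of_nat (q ^ l) * u $ j $ i) -
      (u' $ j $ i - of_nat (q ^ l) * u $ j $ i)) + of_nat (q ^ l) * ((of_nat (q ^ k) - 1) * u $ j $ i)" for j i
    by (simp add: algebra_simps)
  then show ?thesis using assms(2) l unfolding fixed_by_def
    by (metis Ints_add Ints_diff Ints_mult_of_nat)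
qed

text \<open>
  Representatives of the exponent tuples modulo $q^k - 1$; through \<open>exp_quot k\<close> they represent the
  classes fixed by $q^k$.
\<close>
definition exp_box :: "nat \<Rightarrow> (int ^ 'n ^ 'm) set"
  where "exp_box k = {e. \<forall>j i. e $ j $ i \<in> {0..<int (q ^ k - 1)}}"

text \<open>
  The representative in the box of $q^t u (q^k - 1)$. The floor serves to read off an integer; it is
  applied to classes fixed by $q^k$, where nothing is rounded.
\<close>
definition twist_exp :: "nat \<Rightarrow> rat ^ 'n ^ 'm \<Rightarrow> nat \<Rightarrow> int ^ 'n ^ 'm"
  where "twist_exp k u t = (\<chi> j i. (int (q ^ t) * \<lfloor>u $ j $ i * (of_nat (q ^ k) - 1)\<rfloor>) mod int (q ^ k - 1))"

lemma of_int_floor_Ints: "x \<in> \<int> \<Longrightarrow> of_int \<lfloor>x\<rfloor> = (x :: rat)"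
  by (erule Ints_cases) simp

lemma twist_exp_quot:
  assumes "k \<ge> 1" "fixed_by k u"
  shows "exp_quot k (twist_exp k u t) $ j $ i - of_nat (q ^ t) * u $ j $ i \<in> \<int>"
proof -
  define N where "N = int (q ^ k - 1)"
  define x where "x = \<lfloor>u $ j $ i * (of_nat (q ^ k) - 1)\<rfloor>"
  have Nr: "of_int N = (of_nat (q ^ k) - 1 :: rat)" unfolding N_def of_int_of_nat_eq by (rule q_power_minus_1)
  have N0: "(of_int N :: rat) > 0" unfolding Nr by (rule q_power_minus_1_pos[OF assms(1)])
  have "u $ j $ i * (of_nat (q ^ k) - 1) \<in> \<int>" using assms(2) by (simp add: fixed_by_def mult.commute)
  then have x: "of_int x = u $ j $ i * of_int N" unfolding x_def Nr by (rule of_int_floor_Ints)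
  have "exp_quot k (twist_exp k u t) $ j $ i = of_int ((int (q ^ t) * x) mod N) / of_int N"
    unfolding exp_quot_def twist_exp_def x_def Nr N_def[symmetric] by simp
  also have "(int (q ^ t) * x) mod N = int (q ^ t) * x - N * ((int (q ^ t) * x) div N)"
    by (simp add: minus_mult_div_eq_mod)
  also have "of_int \<dots> / of_int N = of_nat (q ^ t) * u $ j $ i - of_int ((int (q ^ t) * x) div N)"
    using N0 x by (simp add: diff_divide_distrib)
  finally show ?thesis by simp
qed

lemma twist_exp_in_box: "k \<ge> 1 \<Longrightarrow> twist_exp k u t \<in> exp_box k"
proof -
  assume "k \<ge> 1"
  then have "int (q ^ k - 1) > 0" using q_power_gt_1[of k] by (simp only: of_nat_0_less_iff zero_less_diff)
  then show ?thesis
    unfolding exp_box_def twist_exp_def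
    by (simp only: mem_Collect_eq vec_lambda_beta atLeastLessThan_iff pos_mod_sign pos_mod_bound) simp
qed

lemma exp_box_eqI:
  assumes k: "k \<ge> 1" and e: "e \<in> exp_box k" "e' \<in> exp_box k"
    and eq: "\<And>j i. exp_quot k e $ j $ i - exp_quot k e' $ j $ i \<in> \<int>"
  shows "e = e'"
proof -
  define N where "N = int (q ^ k - 1)"
  have N: "of_int N = (of_nat (q ^ k) - 1 :: rat)" unfolding N_def of_int_of_nat_eq by (rule q_power_minus_1)
  have N0: "(of_int N :: rat) > 0" unfolding N by (rule q_power_minus_1_pos[OF k])
  have "e $ j $ i = e' $ j $ i" for j i
  proof -
    have "exp_quot k e $ j $ i - exp_quot k e' $ j $ i = of_int (e $ j $ i - e' $ j $ i) / of_int N"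
      by (simp add: exp_quot_def N diff_divide_distrib)
    then have "of_int (e $ j $ i - e' $ j $ i) / of_int N \<in> (\<int> :: rat set)"
      using eq[of j i] by (simp only:)
    then obtain z where "of_int (e $ j $ i - e' $ j $ i) / of_int N = (of_int z :: rat)"
      by (rule Ints_cases)
    then have "of_int (e $ j $ i - e' $ j $ i) = (of_int (z * N) :: rat)" using N0 by (simp add: field_simps)
    then have "e $ j $ i - e' $ j $ i = z * N" by (simp only: of_int_eq_iff)
    then have "(e $ j $ i) mod N = (e' $ j $ i) mod N" by (metis mod_mult_self2 add.commute diff_add_cancel mult.commute)
    then show ?thesis using e by (simp add: exp_box_def N_def)
  qed
  then show ?thesis by (simp add: vec_eq_iff)
qed

text \<open>
  If the representatives for $s \le t$ agree, then $q^s (q^{t-s} - 1) u$ is integral. The factor $q^s$ is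
  removed by a further multiplication, with $q^{Rs-s}$, as $q^{Rs} u \equiv u$.
\<close>
lemma twist_exp_period:
  fixes u :: "rat ^ 'n::finite ^ 'm::finite"
  assumes u: "u \<in> loc_tuples p" and k: "k \<ge> 1" "orbit_length q u dvd k"
  shows "twist_exp k u s = twist_exp k u t \<longleftrightarrow> s mod orbit_length q u = t mod orbit_length q u"
proof -
  define R where "R = orbit_length q u"
  have fixed: "fixed_by k u" using orbit_length(2)[OF u] k by blast
  have main: "twist_exp k u s = twist_exp k u t \<longleftrightarrow> R dvd t - s" if "s \<le> t" for s t
  proof
    assume eq: "twist_exp k u s = twist_exp k u t"
    have d: "of_nat (q ^ t) * u $ j $ i - of_nat (q ^ s) * u $ j $ i \<in> \<int>" for j i
      using Ints_diff[OF twist_exp_quot[OF k(1) fixed, of s j i] twist_exp_quot[OF k(1) fixed, of t j i]]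
      unfolding eq by simp
    define l where "l = R * s - s"
    have R: "R \<ge> 1" using orbit_length(1)[OF u] by (simp add: R_def)
    have l: "l + s = R * s" using R by (simp add: l_def)
    have fixR: "fixed_by (R * s + (t - s)) u"
      unfolding fixed_by_def
    proof (intro allI)
      fix j i
      have fs: "(of_nat (q ^ (R * s)) - 1) * u $ j $ i \<in> \<int>"
        using orbit_length(2)[OF u, of "R * s"] by (simp add: R_def fixed_by_def)
      have exp: "R * s + (t - s) = l + t" using l that by simp
      have "(of_nat (q ^ (l + t)) - 1) * u $ j $ i =
        of_nat (q ^ l) * (of_nat (q ^ t) * u $ j $ i - of_nat (q ^ s) * u $ j $ i) + (of_nat (q ^ (l + s)) - 1) * u $ j $ i"
        by (simp add: power_add algebra_simps)
      then have "(of_nat (q ^ (R * s + (t - s))) - 1) * u $ j $ i =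
        of_nat (q ^ l) * (of_nat (q ^ t) * u $ j $ i - of_nat (q ^ s) * u $ j $ i) + (of_nat (q ^ (R * s)) - 1) * u $ j $ i"
        by (simp only: exp l)
      then show "(of_nat (q ^ (R * s + (t - s))) - 1) * u $ j $ i \<in> \<int>"
        using d fs by (metis Ints_add Ints_mult_of_nat)
    qed
    have "fixed_by (R * s) u" using orbit_length(2)[OF u] by (simp add: R_def)
    from fixed_by_diff[OF this fixR] show "R dvd t - s" using orbit_length(2)[OF u] by (simp add: R_def)
  next
    assume "R dvd t - s"
    then have f: "fixed_by (t - s) u" using orbit_length(2)[OF u] by (simp add: R_def)
    show "twist_exp k u s = twist_exp k u t"
    proof (rule exp_box_eqI[OF k(1)])
      fix j i
      have "(of_nat (q ^ (t - s)) - 1) * u $ j $ i \<in> \<int>" using f by (simp add: fixed_by_def)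
      from Ints_mult_of_nat[OF this, of "q ^ s"]
      have "of_nat (q ^ s) * ((of_nat (q ^ (t - s)) - 1) * u $ j $ i) \<in> \<int>" .
      moreover have "of_nat (q ^ s) * ((of_nat (q ^ (t - s)) - 1) * u $ j $ i) = of_nat (q ^ t) * u $ j $ i - of_nat (q ^ s) * u $ j $ i"
      proof -
        have "of_nat (q ^ t) = (of_nat (q ^ s) * of_nat (q ^ (t - s)) :: rat)"
          using that by (simp flip: power_add)
        then show ?thesis by (simp only:) (simp add: algebra_simps)
      qed
      ultimately have d: "of_nat (q ^ t) * u $ j $ i - of_nat (q ^ s) * u $ j $ i \<in> \<int>" by simp
      have "exp_quot k (twist_exp k u s) $ j $ i - exp_quot k (twist_exp k u t) $ j $ i =
         (exp_quot k (twist_exp k u s) $ j $ i - of_nat (q ^ s) * u $ j $ i) -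
         (exp_quot k (twist_exp k u t) $ j $ i - of_nat (q ^ t) * u $ j $ i) -
         (of_nat (q ^ t) * u $ j $ i - of_nat (q ^ s) * u $ j $ i)" by simp
      then show "exp_quot k (twist_exp k u s) $ j $ i - exp_quot k (twist_exp k u t) $ j $ i \<in> \<int>"
        using twist_exp_quot[OF k(1) fixed, of _ j i] d by (metis Ints_diff)
    qed (use k in \<open>auto intro: twist_exp_in_box\<close>)
  qed
  have "R dvd t - s \<longleftrightarrow> s mod R = t mod R" if "s \<le> t" for s t
    using mod_eq_dvd_iff_nat[OF that] by metis
  with main show ?thesis unfolding R_def[symmetric] by (metis linear)
qed

text \<open>
  Only an orbit whose length divides \<open>k\<close> has members with denominators dividing $q^k - 1$, and then
  its members are $u, qu, \dots, q^{R-1}u$.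
\<close>
lemma exp_box_orbit_fibre:
  fixes u :: "rat ^ 'n::finite ^ 'm::finite"
  assumes u: "u \<in> loc_tuples p" and k: "k \<ge> 1"
  shows "{e \<in> exp_box k. orbit_rel p q `` {exp_quot k e} = orbit_rel p q `` {u}} =
    (if orbit_length q u dvd k then twist_exp k u ` {..<orbit_length q u} else {})" (is "?Fib = _")
proof -
  have cls: "orbit_rel p q `` {exp_quot k e} = orbit_rel p q `` {u} \<longleftrightarrow> (u, exp_quot k e) \<in> orbit_rel p q" for e
    using eq_equiv_class_iff[OF equiv_orbit_rel exp_quot_fixed(1)[OF k] u] 
      equivE[OF equiv_orbit_rel] by (metis symE)
  show ?thesis
  proof (cases "orbit_length q u dvd k")
    case False
    have "?Fib = {}"
    proof (rule equals0I)
      fix e assume "e \<in> ?Fib"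
      then have "(u, exp_quot k e) \<in> orbit_rel p q" by (simp add: cls)
      then have "(exp_quot k e, u) \<in> orbit_rel p q" using equivE[OF equiv_orbit_rel] by (metis symE)
      then have "fixed_by k u" using orbit_members_fixed exp_quot_fixed(2)[OF k] by blast
      then show False using False orbit_length(2)[OF u] by blast
    qed
    then show ?thesis using False by simp
  next
    case True
    then have fixed: "fixed_by k u" using orbit_length(2)[OF u] by blast
    have "e \<in> ?Fib \<longleftrightarrow> e \<in> twist_exp k u ` {..<orbit_length q u}" for e
    proof
      assume e: "e \<in> ?Fib"
      then have "(u, exp_quot k e) \<in> orbit_rel p q" by (simp add: cls)
      then obtain t where t: "\<And>j i. exp_quot k e $ j $ i - of_nat (q ^ t) * u $ j $ i \<in> \<int>"
        by (auto simp: orbit_rel_iff)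
      have "e = twist_exp k u t"
      proof (rule exp_box_eqI[OF k])
        fix j i
        show "exp_quot k e $ j $ i - exp_quot k (twist_exp k u t) $ j $ i \<in> \<int>"
          using Ints_diff[OF t[of j i] twist_exp_quot[OF k fixed, of t j i]] by simp
      qed (use e k twist_exp_in_box in auto)
      also have "\<dots> = twist_exp k u (t mod orbit_length q u)"
        using twist_exp_period[OF u k True] by simp
      finally show "e \<in> twist_exp k u ` {..<orbit_length q u}"
        using orbit_length(1)[OF u] by auto
    next
      assume "e \<in> twist_exp k u ` {..<orbit_length q u}"
      then obtain t where t: "e = twist_exp k u t" by blast
      have "(u, exp_quot k e) \<in> orbit_rel p q"
        unfolding orbit_rel_iff t using u exp_quot_fixed(1)[OF k] twist_exp_quot[OF k fixed] by blast
      then show "e \<in> ?Fib" using twist_exp_in_box[OF k] by (simp add: cls t)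
    qed
    then show ?thesis using True by auto
  qed
qed

lemma card_exp_box_orbit_fibre:
  fixes u :: "rat ^ 'n::finite ^ 'm::finite"
  assumes u: "u \<in> loc_tuples p" and k: "k \<ge> 1" "orbit_length q u dvd k"
  shows "card (twist_exp k u ` {..<orbit_length q u}) = orbit_length q u"
  by (subst card_image) (auto simp: inj_on_def twist_exp_period[OF assms])

end

lemma integral_basis_inj: "integral_basis v \<Longrightarrow> inj v"
  unfolding integral_basis_def Let_def by (simp add: inj_def)

lemma det_of_int: "det (\<chi> i j. of_int (A $ i $ j) :: 'a::comm_ring_1 ^ 'n::finite ^ 'n) = of_int (det A)"
  by (simp add: det_def)

text \<open>
  The determinant of the basis is an integer, so it can be tested for zero over the reals, where the
  basis spans, and used over the rationals.
\<close>
lemma integral_basis_rational_inverse: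
  fixes v :: "'m::finite \<Rightarrow> int ^ 'm"
  assumes "integral_basis v"
  obtains B :: "rat ^ 'm ^ 'm"
  where "\<And>j t. (\<Sum>l\<in>UNIV. of_int (v j $ l) * B $ l $ t) = (if j = t then 1 else 0)"
proof -
  define A where "A = (\<chi> j l. v j $ l)"
  define Ar :: "real ^ 'm ^ 'm" where "Ar = (\<chi> j l. of_int (A $ j $ l))"
  define Aq :: "rat ^ 'm ^ 'm" where "Aq = (\<chi> j l. of_int (A $ j $ l))"
  have "rows Ar = range (\<lambda>j. \<chi> i. real_of_int (v j $ i))"
    by (auto simp: rows_def row_def Ar_def A_def)
  then have "span (rows Ar) = UNIV" using assms by (simp add: integral_basis_def Let_def)
  then obtain B where "B ** Ar = mat 1" using matrix_left_invertible_span_rows by blast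
  then have "det B * det Ar = 1" by (metis det_I det_mul)
  then have "det Ar \<noteq> 0" by auto
  then have "det A \<noteq> 0" by (simp add: Ar_def det_of_int)
  then have "det Aq \<noteq> 0" by (simp add: Aq_def det_of_int)
  then obtain B' where B': "Aq ** B' = mat 1" by (auto simp: invertible_det_nz[symmetric] invertible_right_inverse)
  have "(\<Sum>l\<in>UNIV. of_int (v j $ l) * B' $ l $ t) = (Aq ** B') $ j $ t" for j t
    by (simp add: matrix_matrix_mult_def Aq_def A_def)
  then show ?thesis using that[of B'] by (simp add: B' mat_def)
qed

lemma finite_common_denominator:
  fixes X :: "rat set"
  assumes "finite X"
  shows "\<exists>D>0. \<forall>x\<in>X. of_nat D * x \<in> \<int>"
  using assms
proof (induction X rule: finite_induct)
  case (insert x X)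
  then obtain D where D: "D > 0" "\<forall>x\<in>X. of_nat D * x \<in> \<int>" by blast
  obtain n m where nm: "quotient_of x = (n, m)" by fastforce
  have m: "m > 0" "x = of_int n / of_int m"
    using quotient_of_denom_pos[OF nm] quotient_of_div[OF nm] by auto
  have 1: "of_nat (D * nat m) * x = of_nat D * of_int n" using m by simp
  have 2: "of_nat (D * nat m) * y \<in> \<int>" if "y \<in> X" for y
  proof -
    have "of_nat (D * nat m) * y = of_nat (nat m) * (of_nat D * y)" by (simp add: mult_ac del: of_nat_nat)
    then show ?thesis using D that by (metis Ints_mult_of_nat)
  qed
  have "of_nat (D * nat m) * x \<in> \<int>" unfolding 1 by simp
  with 2 m D show ?case by (intro exI[of _ "D * nat m"]) (auto simp del: of_nat_mult)
qed auto

context q_orbits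
begin

text \<open>
  The condition $\sum_j u_j \otimes v_j \equiv d/(q-1)$, entry by entry.
\<close>
definition tensor_cond :: "('m::finite \<Rightarrow> int ^ 'm) \<Rightarrow> int ^ ('n::finite \<times> 'm) \<Rightarrow> rat ^ 'n ^ 'm \<Rightarrow> bool"
  where "tensor_cond v d u \<longleftrightarrow> (\<forall>ij.
    (\<Sum>j\<in>UNIV. u $ j $ fst ij * of_int (v j $ snd ij)) - of_int (d $ ij) / (of_nat q - 1) \<in> \<int>)"

lemma admissible_orbits_eq:
  "admissible_orbits p q v d = {C \<in> loc_tuples p // orbit_rel p q. \<forall>u\<in>C. tensor_cond v d u}"
  by (simp add: admissible_orbits_def tensor_cond_def tensor_vec_def)

lemma q_minus_1_quotient:
  obtains M where "q ^ k - 1 = (q - 1) * M" "(q ^ k - 1) div (q - 1) = M"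
    "(of_nat (q ^ k) - 1 :: rat) = (of_nat q - 1) * of_nat M"
proof -
  define M where "M = (q ^ k - 1) div (q - 1)"
  have M: "q ^ k - 1 = (q - 1) * M"
    unfolding M_def using nat_minus_1_dvd_power_minus_1[of q k] q_gt_1 by simp
  then have "(of_nat (q ^ k - 1) :: rat) = of_nat (q - 1) * of_nat M" by simp
  then have "(of_nat (q ^ k) - 1 :: rat) = (of_nat q - 1) * of_nat M"
    unfolding q_power_minus_1 using q_power_minus_1[of 1, where 'r = rat] by simp
  with M M_def that show ?thesis by blast
qed

text \<open>
  Multiplication by $q^k$ changes the right-hand side $d/(q-1)$ by the integral vector
  $d\,(q^k - 1)/(q - 1)$.
\<close>
lemma tensor_cond_orbit:
  fixes v :: "'m::finite \<Rightarrow> int ^ 'm"  and d :: "int ^ ('n::finite \<times> 'm)" and u u' :: "rat ^ 'n ^ 'm"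
  assumes "(u, u') \<in> orbit_rel p q" "tensor_cond v d u"
  shows "tensor_cond v d u'"
  unfolding tensor_cond_def
proof
  fix ij :: "'n \<times> 'm"
  define i l where "i = fst ij" and "l = snd ij"
  obtain k where k: "\<And>j i. u' $ j $ i - of_nat (q ^ k) * u $ j $ i \<in> \<int>"
    using assms(1) by (auto simp: orbit_rel_iff)
  obtain M where M: "(of_nat (q ^ k) - 1 :: rat) = (of_nat q - 1) * of_nat M"
    by (rule q_minus_1_quotient)
  have q1: "(of_nat q :: rat) - 1 > 0" using q_power_minus_1_pos[of 1] by simp
  define Q D where "Q = (of_nat (q ^ k) :: rat)" and "D = (of_int (d $ ij) :: rat)"
  define E where "E = D / (of_nat q - 1)"
  have "(\<Sum>j\<in>UNIV. u' $ j $ i * of_int (v j $ l)) - E =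
     (\<Sum>j\<in>UNIV. (u' $ j $ i - Q * u $ j $ i) * of_int (v j $ l)) +
     Q * ((\<Sum>j\<in>UNIV. u $ j $ i * of_int (v j $ l)) - E) + (Q - 1) * E"
    by (simp add: algebra_simps sum_subtractf sum_distrib_left sum.distrib)
  also have "(Q - 1) * E = of_nat M * D"
    unfolding Q_def E_def M using q1 by simp
  also have "(\<Sum>j\<in>UNIV. (u' $ j $ i - Q * u $ j $ i) * of_int (v j $ l)) +
     Q * ((\<Sum>j\<in>UNIV. u $ j $ i * of_int (v j $ l)) - E) + of_nat M * D \<in> \<int>"
    using k assms(2) unfolding Q_def E_def D_def tensor_cond_def i_def l_def
    by (intro Ints_add Ints_sum Ints_mult_of_nat Ints_mult) (auto simp del: of_nat_power split_paired_All)
  finally show "(\<Sum>j\<in>UNIV. u' $ j $ fst ij * of_int (v j $ snd ij)) - of_int (d $ ij) / (of_nat q - 1) \<in> \<int>"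
    by (simp add: i_def l_def D_def E_def)
qed

lemma orbit_admissible_iff:
  fixes u :: "rat ^ 'n::finite ^ 'm::finite"
  assumes "u \<in> loc_tuples p"
  shows "orbit_rel p q `` {u} \<in> admissible_orbits p q v d \<longleftrightarrow> tensor_cond v d u"
proof -
  have "u \<in> orbit_rel p q `` {u}" using equiv_class_self[OF equiv_orbit_rel assms] .
  moreover have "orbit_rel p q `` {u} \<in> loc_tuples p // orbit_rel p q" using assms by (rule quotientI)
  ultimately show ?thesis unfolding admissible_orbits_eq using tensor_cond_orbit by blast
qed

text \<open>
  The condition on exponents modulo $q^k - 1$ that occurs in the exponential sum over the field with $q^k$
  elements, divided by $q^k - 1$, no longer depends on \<open>k\<close>.
\<close>
lemma tensor_cond_exp_quot:
  assumes "k \<ge> 1"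
  shows "tensor_cond v d (exp_quot k e) \<longleftrightarrow> (\<forall>ij. int (q ^ k - 1) dvd
    (\<Sum>j\<in>UNIV. tensor_vec (e $ j) (v j)) $ ij - (\<chi> ij. d $ ij * int ((q ^ k - 1) div (q - 1))) $ ij)"
proof -
  define N where "N = int (q ^ k - 1)"
  have Nr: "of_int N = (of_nat (q ^ k) - 1 :: rat)" unfolding N_def of_int_of_nat_eq by (rule q_power_minus_1)
  have N0: "(of_int N :: rat) > 0" unfolding Nr by (rule q_power_minus_1_pos[OF assms])
  obtain M where M: "(q ^ k - 1) div (q - 1) = M" "(of_nat (q ^ k) - 1 :: rat) = (of_nat q - 1) * of_nat M"
    by (rule q_minus_1_quotient[of k])
  have Ints_iff: "of_int y / of_int N \<in> (\<int> :: rat set) \<longleftrightarrow> N dvd y" for y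
  proof
    assume "of_int y / of_int N \<in> (\<int> :: rat set)"
    then obtain z where "of_int y / of_int N = (of_int z :: rat)" by (rule Ints_cases)
    then have "(of_int y :: rat) = of_int (N * z)" using N0 by (simp add: field_simps)
    then show "N dvd y" by (simp only: of_int_eq_iff) simp
  next
    assume "N dvd y"
    then obtain z where "y = N * z" by blast
    then show "of_int y / of_int N \<in> (\<int> :: rat set)" using N0 by simp
  qed
  have "(\<Sum>j\<in>UNIV. exp_quot k e $ j $ fst ij * of_int (v j $ snd ij)) - of_int (d $ ij) / (of_nat q - 1) =
     of_int ((\<Sum>j\<in>UNIV. tensor_vec (e $ j) (v j)) $ ij - d $ ij * int M) / of_int N" for ij
  proof -
    have "of_int (d $ ij) / (of_nat q - 1) = (of_int (d $ ij * int M) / of_int N :: rat)"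
      using N0 unfolding Nr M(2) by auto
    moreover have "(\<Sum>j\<in>UNIV. exp_quot k e $ j $ fst ij * of_int (v j $ snd ij)) =
       of_int ((\<Sum>j\<in>UNIV. tensor_vec (e $ j) (v j)) $ ij) / of_int N"
      by (simp add: exp_quot_def tensor_vec_def sum_divide_distrib Nr)
    ultimately show ?thesis by (simp only: of_int_diff diff_divide_distrib)
  qed
  then show ?thesis unfolding tensor_cond_def N_def[symmetric] M(1) by (simp only: Ints_iff vec_lambda_beta)
qed

text \<open>
  The condition bounds the denominators of $\sum_j u_j \otimes v_j$ by $q - 1$; applying the
  rational inverse of the basis, with common denominator \<open>D\<close>, bounds those of \<open>u\<close> by $D(q-1)$. Every
  class has a representative with entries in $[0,1)$.
\<close>
lemma finite_admissible_orbits: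
  fixes v :: "'m::finite \<Rightarrow> int ^ 'm" and d :: "int ^ ('n::finite \<times> 'm)"
  assumes "integral_basis v"
  shows "finite (admissible_orbits p q v d)"
proof -
  obtain B :: "rat ^ 'm ^ 'm"
    where B: "\<And>j t. (\<Sum>l\<in>UNIV. of_int (v j $ l) * B $ l $ t) = (if j = t then 1 else 0)"
    using integral_basis_rational_inverse[OF assms] by blast
  have "finite (range (\<lambda>(l, t). B $ l $ t))" by simp
  then obtain D where D: "D > 0" "\<forall>x\<in>range (\<lambda>(l, t). B $ l $ t). of_nat D * x \<in> \<int>"
    using finite_common_denominator by blast
  then have DB: "of_nat D * B $ l $ t \<in> \<int>" for l t by auto
  define M where "M = D * (q - 1)"
  have M0: "M > 0" using D q_gt_1 by (simp add: M_def)
  have q1: "(of_nat (q - 1) :: rat) = of_nat q - 1" using q_power_minus_1[of 1] by simp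
  have den: "of_nat M * u $ t $ i \<in> \<int>" if u: "tensor_cond v d u" for u t i
  proof -
    define w where "w l = (\<Sum>j\<in>UNIV. u $ j $ i * of_int (v j $ l))" for l
    have w: "of_nat (q - 1) * w l \<in> \<int>" for l
    proof -
      have "w l - of_int (d $ (i, l)) / of_nat (q - 1) \<in> \<int>"
        using spec[OF u[unfolded tensor_cond_def], of "(i, l)"] unfolding w_def q1 by (simp only: fst_conv snd_conv)
      then have "of_nat (q - 1) * (w l - of_int (d $ (i, l)) / of_nat (q - 1)) \<in> \<int>" by (rule Ints_mult_of_nat)
      moreover have "of_nat (q - 1) * (w l - of_int (d $ (i, l)) / of_nat (q - 1)) = of_nat (q - 1) * w l - of_int (d $ (i, l))"
        using q_gt_1 by (simp add: right_diff_distrib)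
      ultimately have "of_nat (q - 1) * w l - of_int (d $ (i, l)) \<in> \<int>" by simp
      from Ints_add[OF this, of "of_int (d $ (i, l))"] show ?thesis by simp
    qed
    have "(\<Sum>l\<in>UNIV. w l * B $ l $ t) = (\<Sum>j\<in>UNIV. u $ j $ i * (\<Sum>l\<in>UNIV. of_int (v j $ l) * B $ l $ t))"
      unfolding w_def sum_distrib_left sum_distrib_right by (subst sum.swap) (simp add: mult_ac)
    also have "\<dots> = u $ t $ i" by (simp add: B if_distrib[of "\<lambda>x. _ * x"] cong: if_cong)
    finally have u_eq: "(\<Sum>l\<in>UNIV. w l * B $ l $ t) = u $ t $ i" .
    have "of_nat M * u $ t $ i = (\<Sum>l\<in>UNIV. (of_nat (q - 1) * w l) * (of_nat D * B $ l $ t))"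
      unfolding u_eq[symmetric] M_def sum_distrib_left by (intro sum.cong) (simp_all add: mult_ac)
    also have "\<dots> \<in> \<int>" by (intro Ints_sum Ints_mult w DB)
    finally show ?thesis .
  qed
  define S :: "rat set" where "S = (\<lambda>t. of_int t / of_nat M) ` {0..<int M}"
  have fin: "finite {u :: rat ^ 'n ^ 'm. \<forall>j i. u $ j $ i \<in> S}"
  proof -
    have "finite {x :: rat ^ 'n. \<forall>i. x $ i \<in> S}" by (rule finite_vec_box) (simp add: S_def)
    from finite_vec_box[OF this, where 'n = 'm] show ?thesis by simp
  qed
  have "admissible_orbits p q v d \<subseteq> (\<lambda>u. orbit_rel p q `` {u}) ` {u :: rat ^ 'n ^ 'm. \<forall>j i. u $ j $ i \<in> S}"
  proof
    fix C assume C: "C \<in> admissible_orbits p q v d"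
    then obtain u where u: "u \<in> loc_tuples p" "C = orbit_rel p q `` {u}"
      unfolding admissible_orbits_eq by (auto elim: quotientE)
    then have cond: "tensor_cond v d u" using C orbit_admissible_iff by blast
    define u' where "u' = (\<chi> j i. frac (u $ j $ i))"
    have loc: "u' \<in> loc_tuples p"
    proof -
      obtain c where c: "c > 0" "coprime c p" "\<And>j i. of_nat c * u $ j $ i \<in> \<int>"
        using loc_tuples_common_denominator[OF u(1) p] by blast
      have "of_nat c * u' $ j $ i \<in> \<int>" for j i
      proof -
        have "of_nat c * u' $ j $ i = of_nat c * u $ j $ i - of_int (int c * \<lfloor>u $ j $ i\<rfloor>)"
          by (simp add: u'_def frac_def right_diff_distrib)
        then show ?thesis using c(3)[of j i] by (simp only: Ints_diff Ints_of_int)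
      qed
      moreover have "\<not> p dvd c"
      proof
        assume "p dvd c"
        then have "p dvd 1" using coprime_common_divisor[OF c(2), of p] by simp
        then show False using p by simp
      qed
      then have "\<not> int p dvd int c" by (simp only: int_dvd_int_iff) simp
      ultimately have "u' $ j $ i \<in> Z_loc p" for j i
        using Z_locI[of "int c" "u' $ j $ i" p] by simp
      then show ?thesis by (simp add: loc_tuples_def)
    qed
    have "(u, u') \<in> orbit_rel p q"
      unfolding orbit_rel_iff using u(1) loc by (auto intro!: exI[of _ 0] simp: u'_def frac_def)
    then have "C = orbit_rel p q `` {u'}"
      unfolding u(2) by (rule equiv_class_eq[OF equiv_orbit_rel])
    moreover have "u' $ j $ i \<in> S" for j i
    proof -
      have "of_nat M * u' $ j $ i = of_nat M * u $ j $ i - of_int (int M * \<lfloor>u $ j $ i\<rfloor>)"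
        by (simp add: u'_def frac_def right_diff_distrib)
      then have "of_nat M * u' $ j $ i \<in> \<int>" using den[OF cond, of j i] by (simp only: Ints_diff Ints_of_int)
      then obtain t where t: "of_nat M * u' $ j $ i = of_int t" by (rule Ints_cases)
      have fr: "0 \<le> u' $ j $ i" "u' $ j $ i < 1" by (auto simp: u'_def frac_lt_1)
      have "(0::rat) \<le> of_int t" unfolding t[symmetric] using fr by simp
      moreover have "(of_int t :: rat) < of_int (int M)" unfolding t[symmetric] using fr M0 by simp
      ultimately have "t \<in> {0..<int M}" by (simp only: of_int_0_le_iff of_int_less_iff atLeastLessThan_iff)
      moreover have "u' $ j $ i = of_int t / of_nat M" using t M0 by (simp add: field_simps)
      ultimately show ?thesis unfolding S_def by blast
    qed
    ultimately show "C \<in> (\<lambda>u. orbit_rel p q `` {u}) ` {u :: rat ^ 'n ^ 'm. \<forall>j i. u $ j $ i \<in> S}" by blast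
  qed
  then show ?thesis using finite_surj[OF fin] by blast
qed

end

section \<open>The L-function of a diagonal base change\<close>

lemma monom_val_scale: "monom_val x (\<chi> i. u $ i * int s) = monom_val x u ^ s"
  by (simp add: monom_val_def power_int_mult prod_power_distrib)

text \<open>
  The quotient is a geometric sum of \<open>l\<close> powers of \<open>q\<close>, each congruent to 1 modulo $q - 1$.
\<close>
lemma power_quotient_cong:
  fixes q R l :: nat
  assumes "q > 1" "R \<ge> 1"
  shows "int (q - 1) dvd int ((q ^ (R * l) - 1) div (q ^ R - 1)) - int l"
proof -
  define Q where "Q = q ^ R"
  have Q: "Q > 1" unfolding Q_def by (rule one_less_power) (use assms in auto)
  have "int (Q ^ l - 1) = int (Q - 1) * (\<Sum>i<l. int Q ^ i)"
    using Q power_diff_1_eq[of "int Q" l] by (simp add: of_nat_diff)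
  then have "int (Q ^ l - 1) = int ((Q - 1) * (\<Sum>i<l. Q ^ i))" by simp
  then have "Q ^ l - 1 = (Q - 1) * (\<Sum>i<l. Q ^ i)" by (simp only: of_nat_eq_iff)
  then have quot: "(Q ^ l - 1) div (Q - 1) = (\<Sum>i<l. Q ^ i)" using Q by simp
  have "int (q - 1) dvd (\<Sum>i<l. int Q ^ i - 1)"
  proof (intro dvd_sum)
    fix i assume "i \<in> {..<l}"
    have "int q - 1 dvd int q ^ (R * i) - 1" by (simp add: power_diff_1_eq)
    then show "int (q - 1) dvd int Q ^ i - 1" using assms(1) by (simp add: Q_def power_mult of_nat_diff)
  qed
  then show ?thesis using quot by (simp add: Q_def power_mult sum_subtractf)
qed

lemma expsum_frob_power:
  fixes h :: "(int ^ 'n::finite) \<Rightarrow>\<^sub>0 'k::{alg_closed_field,field_prime_char} witt fract"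
    and e :: "int ^ 'n"
  assumes a: "a \<ge> 1" and k: "k \<ge> 1"
    and h: "\<And>u. u \<in> Poly_Mapping.keys h \<Longrightarrow> Poly_Mapping.lookup h u \<in> mu (CHAR('k) ^ a)"
  shows "expsum h (CHAR('k) ^ (a * k)) (\<chi> i. int ((CHAR('k) ^ a) ^ t) * e $ i) = expsum h (CHAR('k) ^ (a * k)) e"
proof (induction t)
  case 0
  have "(\<chi> i. int ((CHAR('k) ^ a) ^ 0) * e $ i) = e" by (simp add: vec_eq_iff)
  then show ?case by (simp only:)
next
  case (Suc t)
  have "(\<chi> i. int ((CHAR('k) ^ a) ^ Suc t) * e $ i) =
    (\<chi> i. int (CHAR('k) ^ a) * (\<chi> i. int ((CHAR('k) ^ a) ^ t) * e $ i) $ i)"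
    by (simp add: vec_eq_iff mult.assoc)
  then have "expsum h (CHAR('k) ^ (a * k)) (\<chi> i. int ((CHAR('k) ^ a) ^ Suc t) * e $ i) =
    expsum h (CHAR('k) ^ (a * k)) (\<chi> i. int ((CHAR('k) ^ a) ^ t) * e $ i)"
    by (simp only: expsum_frob[OF a k h])
  then show ?case by (simp only: Suc)
qed

text \<open>
  The exponent of a member $q^t u$ of the orbit is $q^t \cdot u_j (q^R - 1) \cdot M$ modulo $q^k - 1$, where
  $k = Rl$ and $M = (q^k - 1)/(q^R - 1)$. The exponential sum ignores the factor $q^t$ by
  \<open>expsum_frob_power\<close>. The entries of \<open>b\<close> are $(q-1)$-th roots of unity, for which $q^t$ acts as 1 and
  \<open>M\<close> as \<open>l\<close>.
\<close>
lemma diag_expsum_orbit_term: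
  fixes f :: "(int ^ 'n::finite) \<Rightarrow>\<^sub>0 'k::{alg_closed_field,field_prime_char} witt fract"
    and b :: "'k witt fract ^ 'n" and u :: "rat ^ 'n ^ 'm::finite"
  assumes orb: "q_orbits p q a" and char: "p = CHAR('k)"
    and f: "\<And>w. w \<in> Poly_Mapping.keys f \<Longrightarrow> Poly_Mapping.lookup f w \<in> mu q"
    and b: "b \<in> mu_vec q"
    and u: "u \<in> loc_tuples p" and R: "R = orbit_length q u" and l: "l \<ge> 1"
  shows "fps_const (monom_val b (q_orbits.twist_exp q (R * l) u t $ j)) * expsum f (q ^ (R * l)) (q_orbits.twist_exp q (R * l) u t $ j) =
    fps_const (monom_val b (orbit_exponent q u j)) ^ l *
      expsum f ((q ^ R) ^ l) (\<chi> i. orbit_exponent q u j $ i * int (((q ^ R) ^ l - 1) div (q ^ R - 1)))"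
proof -
  interpret q_orbits p q a by fact
  define k where "k = R * l"
  have R1: "R \<ge> 1" using orbit_length(1)[OF u] by (simp add: R)
  have k: "k \<ge> 1" using R1 l by (simp add: k_def)
  define M where "M = (q ^ k - 1) div (q ^ R - 1)"
  define N where "N = int (q ^ k - 1)"
  define oe where "oe = orbit_exponent q u j"
  define y where "y = (\<chi> i. oe $ i * int M)"
  define e where "e = twist_exp k u t $ j"
  have QR: "q ^ k = (q ^ R) ^ l" by (simp add: k_def power_mult)
  have M: "q ^ k - 1 = (q ^ R - 1) * M"
    unfolding M_def QR using nat_minus_1_dvd_power_minus_1[of "q ^ R" l] q_power_ge_1 by simp
  have fixed: "fixed_by R u" using orbit_length(2)[OF u] by (simp add: R)
  have oe: "of_int (oe $ i) = u $ j $ i * (of_nat (q ^ R) - 1)" for i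
    unfolding oe_def orbit_exponent_def R[symmetric] vec_lambda_beta
    by (rule of_int_floor_Ints) (use fixed in \<open>simp add: fixed_by_def mult.commute\<close>)
  have y: "\<lfloor>u $ j $ i * (of_nat (q ^ k) - 1)\<rfloor> = y $ i" for i
  proof -
    have "u $ j $ i * (of_nat (q ^ k) - 1) = u $ j $ i * of_nat (q ^ k - 1)" by (simp only: q_power_minus_1)
    also have "\<dots> = (u $ j $ i * (of_nat (q ^ R) - 1)) * of_nat M"
      unfolding M of_nat_mult q_power_minus_1 by (simp only: mult.assoc)
    also have "\<dots> = of_int (y $ i)" unfolding oe[symmetric] y_def by simp
    finally show ?thesis by (simp only: floor_of_int)
  qed
  have e_mod: "N dvd e $ i - int (q ^ t) * y $ i" for i
  proof -
    have "e $ i = (int (q ^ t) * y $ i) mod N"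
      unfolding e_def twist_exp_def vec_lambda_beta y N_def ..
    then show ?thesis by (metis dvd_minus_mod dvd_minus_iff minus_diff_eq)
  qed
  have qk: "q ^ k > 1" by (rule q_power_gt_1[OF k])
  have qp: "q ^ k = CHAR('k) ^ (a * k)" by (simp add: q char power_mult)
  have S: "expsum f (q ^ k) e = expsum f (q ^ k) y"
  proof -
    have "expsum f (q ^ k) e = expsum f (q ^ k) (\<chi> i. int (q ^ t) * y $ i)"
      by (rule expsum_cong[OF qk]) (use e_mod in \<open>simp add: N_def\<close>)
    also have "\<dots> = expsum f (q ^ k) y"
      using expsum_frob_power[OF a k, of f t y] f unfolding qp by (simp add: q char)
    finally show ?thesis .
  qed
  have q1: "int (q - 1) dvd int (q ^ t) - 1"
    using q_gt_1 by (simp add: of_nat_diff power_diff_1_eq)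
  have q_N: "int (q - 1) dvd N"
    unfolding N_def int_dvd_int_iff using nat_minus_1_dvd_power_minus_1 q_gt_1 by simp
  have "monom_val b e = monom_val b (\<chi> i. oe $ i * int l)"
  proof (rule monom_val_cong[OF q_gt_1 b])
    fix i
    have "e $ i - oe $ i * int l = (e $ i - int (q ^ t) * y $ i) + (int (q ^ t) - 1) * y $ i + oe $ i * (int M - int l)"
      by (simp add: y_def algebra_simps)
    also have "int (q - 1) dvd \<dots>"
      using dvd_trans[OF q_N e_mod] q1 power_quotient_cong[OF q_gt_1 R1, of l] unfolding M_def k_def
      by (intro dvd_add dvd_mult dvd_mult2) auto
    finally show "int (q - 1) dvd e $ i - (\<chi> i. oe $ i * int l) $ i" by simp
  qed
  then have B: "fps_const (monom_val b e) = fps_const (monom_val b oe) ^ l"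
    by (simp add: monom_val_scale fps_const_power)
  show ?thesis
    unfolding k_def[symmetric] e_def[symmetric] QR[symmetric] oe_def[symmetric] M_def[symmetric] y_def[symmetric] S B ..
qed

theorem theorem1p20:
  fixes p q a :: nat
    and f :: "(int ^ 'n::finite) \<Rightarrow>\<^sub>0 'k::{alg_closed_field,field_prime_char} witt fract"
    and g :: "(int ^ 'm::finite) \<Rightarrow>\<^sub>0 'k witt fract ^ 'n"
    and v :: "'m \<Rightarrow> int ^ 'm"
    and b :: "'m \<Rightarrow> 'k witt fract ^ 'n"
    and d :: "int ^ ('n \<times> 'm)"
  assumes p: "p = CHAR('k)"
    and q: "a \<ge> 1" "q = p ^ a"
    and f_coeffs: "\<forall>u\<in>Poly_Mapping.keys f. Poly_Mapping.lookup f u \<in> mu q"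
    and f_nonconst: "\<not> Poly_Mapping.keys f \<subseteq> {0}"
    and v: "integral_basis v"
    and b: "\<forall>j i. b j $ i \<in> mu q"
    and g: "g = (\<Sum>j\<in>UNIV. Poly_Mapping.single (v j) (b j))"
  shows "finite (admissible_orbits p q v d) \<and>
    Lfun (diag_base_change f g) q d powi ((-1) ^ (CARD('n) * CARD('m) - 1)) =
    (\<Prod>C\<in>admissible_orbits p q v d.
      let u = (SOME u. u \<in> C); r = orbit_length q u in
        fps_tensor (\<lambda>j. Lfun f (q ^ r) (orbit_exponent q u j) powi ((-1) ^ (CARD('n) - 1)))
          oo (fps_const (fps_const (\<Prod>j\<in>UNIV. monom_val (b j) (orbit_exponent q u j))) * fps_X ^ r))"
proof -
  have orb: "q_orbits p q a" using p q by (unfold_locales) simp_all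
  note char = p and a_ge_1 = q(1) and q_eq = q(2)
  interpret q_orbits p q a by (rule orb)
  define Adm where "Adm = admissible_orbits p q v d"
  have fin: "finite Adm" unfolding Adm_def by (rule finite_admissible_orbits[OF v])
  have qp: "q ^ k = CHAR('k) ^ (a * k)" for k by (simp add: q_eq char power_mult)
  have f_mu: "Poly_Mapping.lookup f w \<in> mu q" if "w \<in> Poly_Mapping.keys f" for w
    using f_coeffs that by blast
  have b_mu: "b j \<in> mu_vec q" for j using b by (simp add: mu_vec_def)
  have mono: "mu q \<subseteq> (mu (CHAR('k) ^ (a * k)) :: 'k witt fract set)" if "k \<ge> 1" for k
    using mu_mono[OF a_ge_1 that] by (simp add: q_eq char)
  define U where "U C = (SOME u. u \<in> C)" for C :: "(rat ^ 'n ^ 'm) set"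
  define R where "R C = orbit_length q (U C)" for C :: "(rat ^ 'n ^ 'm) set"
  have U: "U C \<in> loc_tuples p" "C = orbit_rel p q `` {U C}" if C: "C \<in> Adm" for C
  proof -
    have Cq: "C \<in> loc_tuples p // orbit_rel p q" using C by (simp add: Adm_def admissible_orbits_eq)
    then obtain w where w: "w \<in> loc_tuples p" "C = orbit_rel p q `` {w}" by (rule quotientE)
    then have "w \<in> C" using equiv_class_self[OF equiv_orbit_rel w(1)] by simp
    then have "U C \<in> C" unfolding U_def by (rule someI)
    then have wU: "(w, U C) \<in> orbit_rel p q" using w by simp
    then show "U C \<in> loc_tuples p" by (simp add: orbit_rel_iff)
    show "C = orbit_rel p q `` {U C}" unfolding w(2)
      using equiv_class_eq[OF equiv_orbit_rel wU] w(2) by simp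
  qed
  have R1: "R C \<ge> 1" if "C \<in> Adm" for C unfolding R_def by (rule orbit_length(1)[OF U(1)[OF that]])
  define S where "S C l j = expsum f ((q ^ R C) ^ l) (\<chi> i. orbit_exponent q (U C) j $ i * int (((q ^ R C) ^ l - 1) div (q ^ R C - 1)))"
    for C l j
  define B where "B C = fps_const (\<Prod>j\<in>UNIV. monom_val (b j) (orbit_exponent q (U C) j))" for C
  define cc where "cc k = expsum (diag_base_change f g) (q ^ k) (\<chi> ij. d $ ij * int ((q ^ k - 1) div (q - 1)))" for k
  define summand where "summand k e = (\<Prod>j\<in>UNIV. fps_const (monom_val (b j) (e $ j)) * expsum f (q ^ k) (e $ j))"
    for k and e :: "int ^ 'n ^ 'm"
  \<comment> \<open>The exponential sum over the field with \<open>q ^ k\<close> elements, sorted by orbits.\<close>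
  have main: "cc k = (\<Sum>C\<in>Adm. if R C dvd k then of_nat (R C) * B C ^ (k div R C) * (\<Prod>j\<in>UNIV. S C (k div R C) j) else 0)"
    if k: "k \<ge> 1" for k
  proof -
    define E where "E = {e \<in> exp_box k. tensor_cond v d (exp_quot k e)}"
    define cl where "cl e = orbit_rel p q `` {exp_quot k e}" for e :: "int ^ 'n ^ 'm"
    have ak: "a * k \<ge> 1" using a_ge_1 k by simp
    have "cc k = (\<Sum>e\<in>E. summand k e)"
    proof -
      have "expsum (diag_base_change f (\<Sum>j\<in>UNIV. Poly_Mapping.single (v j) (b j))) (CHAR('k) ^ (a * k)) d' =
        (\<Sum>e\<in>{e :: int ^ 'n ^ 'm. (\<forall>j i. e $ j $ i \<in> {0..<int (CHAR('k) ^ (a * k) - 1)}) \<and>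
        (\<forall>ij. int (CHAR('k) ^ (a * k) - 1) dvd (\<Sum>j\<in>UNIV. tensor_vec (e $ j) (v j)) $ ij - d' $ ij)}.
         \<Prod>j\<in>UNIV. fps_const (monom_val (b j) (e $ j)) * expsum f (CHAR('k) ^ (a * k)) (e $ j))" for d'
        using f_mu b_mu mono[OF k] 
        by (intro expsum_diag_base_change[OF ak _ integral_basis_inj[OF v]]) (auto simp: mu_vec_def)
      then have "cc k = (\<Sum>e\<in>{e. (\<forall>j i. e $ j $ i \<in> {0..<int (q ^ k - 1)}) \<and>
        (\<forall>ij. int (q ^ k - 1) dvd (\<Sum>j\<in>UNIV. tensor_vec (e $ j) (v j)) $ ij -
           (\<chi> ij. d $ ij * int ((q ^ k - 1) div (q - 1))) $ ij)}. summand k e)"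
        unfolding cc_def g summand_def qp[symmetric] by blast
      also have "{e :: int ^ 'n ^ 'm. (\<forall>j i. e $ j $ i \<in> {0..<int (q ^ k - 1)}) \<and>
        (\<forall>ij. int (q ^ k - 1) dvd (\<Sum>j\<in>UNIV. tensor_vec (e $ j) (v j)) $ ij -
           (\<chi> ij. d $ ij * int ((q ^ k - 1) div (q - 1))) $ ij)} = E"
        unfolding E_def exp_box_def tensor_cond_exp_quot[OF k] by blast
      finally show ?thesis .
    qed
    also have "\<dots> = (\<Sum>C\<in>Adm. \<Sum>e\<in>{e\<in>E. cl e = C}. summand k e)"
    proof (rule sum.group[symmetric])
      have "finite {x :: int ^ 'n. \<forall>i. x $ i \<in> {0..<int (q ^ k - 1)}}" by (rule finite_vec_box) simp
      from finite_vec_box[OF this, where 'n = 'm] have "finite (exp_box k :: (int ^ 'n ^ 'm) set)"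
        by (simp add: exp_box_def)
      then show "finite E" by (simp add: E_def)
      show "cl ` E \<subseteq> Adm"
        using orbit_admissible_iff[OF exp_quot_fixed(1)[OF k]] by (auto simp: E_def cl_def Adm_def)
    qed (rule fin)
    also have "\<dots> = (\<Sum>C\<in>Adm. if R C dvd k then of_nat (R C) * B C ^ (k div R C) * (\<Prod>j\<in>UNIV. S C (k div R C) j) else 0)"
    proof (rule sum.cong[OF refl])
      fix C assume C: "C \<in> Adm"
      have "{e\<in>E. cl e = C} = {e\<in>exp_box k. cl e = C}"
        using C orbit_admissible_iff[OF exp_quot_fixed(1)[OF k]] by (auto simp: E_def cl_def Adm_def)
      also have "\<dots> = {e\<in>exp_box k. orbit_rel p q `` {exp_quot k e} = orbit_rel p q `` {U C}}"
        using U(2)[OF C] by (auto simp: cl_def)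
      also have "\<dots> = (if R C dvd k then twist_exp k (U C) ` {..<R C} else {})"
        unfolding R_def by (rule exp_box_orbit_fibre[OF U(1)[OF C] k])
      finally have fib: "{e\<in>E. cl e = C} = (if R C dvd k then twist_exp k (U C) ` {..<R C} else {})" .
      show "(\<Sum>e\<in>{e\<in>E. cl e = C}. summand k e) =
        (if R C dvd k then of_nat (R C) * B C ^ (k div R C) * (\<Prod>j\<in>UNIV. S C (k div R C) j) else 0)"
      proof (cases "R C dvd k")
        case True
        define l where "l = k div R C"
        have kl: "k = R C * l" using True by (simp add: l_def)
        then have l: "l \<ge> 1" using k by (cases l) auto
        have "summand k (twist_exp k (U C) t) = B C ^ l * (\<Prod>j\<in>UNIV. S C l j)" for t
        proof -
          have "summand k (twist_exp k (U C) t) =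
            (\<Prod>j\<in>UNIV. fps_const (monom_val (b j) (orbit_exponent q (U C) j)) ^ l * S C l j)"
            unfolding summand_def kl S_def
            by (intro prod.cong refl diag_expsum_orbit_term[OF orb char f_mu b_mu U(1)[OF C] R_def l])
          then show ?thesis by (simp only: prod.distrib B_def fps_const_prod prod_power_distrib)
        qed
        then have "(\<Sum>e\<in>twist_exp k (U C) ` {..<R C}. summand k e) =
           (\<Sum>e\<in>twist_exp k (U C) ` {..<R C}. B C ^ l * (\<Prod>j\<in>UNIV. S C l j))"
          by (intro sum.cong) auto
        also have "\<dots> = of_nat (R C) * (B C ^ l * (\<Prod>j\<in>UNIV. S C l j))"
          using card_exp_box_orbit_fibre[OF U(1)[OF C] k] True by (simp add: R_def)
        finally show ?thesis using True by (simp add: fib l_def mult.assoc)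
      qed (simp add: fib)
    qed
    finally show ?thesis .
  qed
  \<comment> \<open>Both numbers of variables are positive, so the natural-number subtraction in the signs is harmless.\<close>
  have sgn: "(-1) ^ (n - 1) = - ((-1) ^ n :: 'k witt fract fps)" if "n \<ge> 1" for n :: nat
    using that by (cases n) auto
  have n1: "CARD('n) \<ge> 1" "CARD('n) * CARD('m) \<ge> 1" by (simp_all add: Suc_leI)
  have lhs: "Lfun (diag_base_change f g) q d powi ((-1) ^ (CARD('n) * CARD('m) - 1)) =
    exp_series (\<lambda>k. - ((-1) ^ (CARD('n) * CARD('m)) * cc k))"
    unfolding Lfun_def cc_def[symmetric] exp_series_powi_sign by (simp only: sgn[OF n1(2)] mult_minus_left)
  have factor: "(let u = (SOME u. u \<in> C); r = orbit_length q u in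
        fps_tensor (\<lambda>j. Lfun f (q ^ r) (orbit_exponent q u j) powi ((-1) ^ (CARD('n) - 1)))
          oo (fps_const (fps_const (\<Prod>j\<in>UNIV. monom_val (b j) (orbit_exponent q u j))) * fps_X ^ r)) =
     exp_series (\<lambda>k. - ((-1) ^ (CARD('n) * CARD('m)) *
        (if R C dvd k then of_nat (R C) * B C ^ (k div R C) * (\<Prod>j\<in>UNIV. S C (k div R C) j) else 0)))"
    if C: "C \<in> Adm" for C
  proof -
    have "Lfun f (q ^ R C) (orbit_exponent q (U C) j) powi ((-1) ^ (CARD('n) - 1)) =
      exp_series (\<lambda>l. - ((-1) ^ CARD('n) * S C l j))" for j
      unfolding Lfun_def S_def[symmetric] exp_series_powi_sign by (simp only: sgn[OF n1(1)] mult_minus_left)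
    then have "fps_tensor (\<lambda>j. Lfun f (q ^ R C) (orbit_exponent q (U C) j) powi ((-1) ^ (CARD('n) - 1))) =
      exp_series (\<lambda>l. - (\<Prod>j\<in>UNIV. (-1) ^ CARD('n) * S C l j))"
      by (simp only: fps_tensor_exp_series)
    also have "\<dots> = exp_series (\<lambda>l. - ((-1) ^ (CARD('n) * CARD('m)) * (\<Prod>j\<in>UNIV. S C l j)))"
      by (simp add: prod.distrib power_mult)
    finally have tensor: "fps_tensor (\<lambda>j. Lfun f (q ^ R C) (orbit_exponent q (U C) j) powi ((-1) ^ (CARD('n) - 1))) =
      exp_series (\<lambda>l. - ((-1) ^ (CARD('n) * CARD('m)) * (\<Prod>j\<in>UNIV. S C l j)))" .
    show ?thesis
      unfolding Let_def U_def[symmetric] R_def[symmetric] B_def[symmetric] tensor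
        exp_series_compose_monom[OF R1[OF C]] exp_series_eq_iff
      by (auto simp: mult_ac)
  qed
  have "Lfun (diag_base_change f g) q d powi ((-1) ^ (CARD('n) * CARD('m) - 1)) =
    (\<Prod>C\<in>Adm. exp_series (\<lambda>k. - ((-1) ^ (CARD('n) * CARD('m)) *
        (if R C dvd k then of_nat (R C) * B C ^ (k div R C) * (\<Prod>j\<in>UNIV. S C (k div R C) j) else 0))))"
    unfolding lhs exp_series_sum exp_series_eq_iff by (intro allI impI) (simp only: main sum_distrib_left sum_negf)
  also have "\<dots> = (\<Prod>C\<in>Adm.
      let u = (SOME u. u \<in> C); r = orbit_length q u in
        fps_tensor (\<lambda>j. Lfun f (q ^ r) (orbit_exponent q u j) powi ((-1) ^ (CARD('n) - 1)))
          oo (fps_const (fps_const (\<Prod>j\<in>UNIV. monom_val (b j) (orbit_exponent q u j))) * fps_X ^ r))"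
    by (rule prod.cong[OF refl factor[symmetric]])
  finally show ?thesis using fin unfolding Adm_def by blast
qed

end
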